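(* Let $\mathfrak{g}\subseteq\mathfrak{gl}(k_0+1|k_1)$ be a finite-dimensional Lie superalgebra with basis $e_i$, let $\rho\colon\mathfrak{g}\to\mathrm{Mat}(k_0+1|k_1)$ be its matrix representation and $\boldsymbol{\varrho}\colon\mathfrak{g}\to\mathrm{Vect}(W;\mathrm{poly})$ its realisation by polynomial vector fields on the $(k_0|k_1)$-dimensional supermanifold $W$. Let $\alpha=a^i\rho(e_i)\,\mathrm{d}x+b^j\rho(e_j)\,\mathrm{d}t$ be a $\mathfrak{g}$-valued zero-curvature representation for a $\mathbb{Z}_2$-graded system $\mathcal{E}$ with independent variables $x,t$, and let $\tau\colon\tilde{\mathcal{E}}=W\times\mathcal{E}^\infty\to\mathcal{E}^\infty$ be the $(k_0|k_1)$-dimensional covering with fibre variables $w^\ell$ such that $$w^\ell_x=-a^i\,\boldsymbol{\varrho}(e_i)\lrcorner\,\mathrm{d}w^\ell,\qquad w^\ell_t=-b^j\,\boldsymbol{\varrho}(e_j)\lrcorner\,\mathrm{d}w^\ell,\qquad \ell=1,\dots,k_0+k_1,$$ with structure element $U$. Put $\boldsymbol\partial_\alpha=\bar{\mathrm d}_h-[\alpha,\cdot\,]$, $\partial_U=[\,\cdot\,,U]^{\mathrm{FN}}$ and $\nabla=\boldsymbol{\varrho}\circ\rho^{-1}$. Then the diagram $$\begin{array}{ccccc}\mathfrak{g}\otimes\Lambda^0(\mathcal{E}^\infty)&\xrightarrow{\ \rho\ }&\mathrm{Mat}(k_0+1|k_1)\otimes\Lambda^0(\mathcal{E}^\infty)&\xrightarrow{\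 \boldsymbol\partial_\alpha\ }&\mathrm{Mat}(k_0+1|k_1)\otimes\Lambda^1(\mathcal{E}^\infty)\\ \Vert&&\downarrow\nabla&&\downarrow\nabla\\ \mathfrak{g}\otimes\Lambda^0(\mathcal{E}^\infty)&\xrightarrow{\ \boldsymbol{\varrho}\ }&\Gamma T(\Lambda^0(\tilde{\mathcal{E}}))&\xrightarrow{\ \partial_U\ }&\Gamma T(\Lambda^1(\tilde{\mathcal{E}}))\end{array}$$ is commutative; in particular $(\nabla\circ\boldsymbol\partial_\alpha\circ\rho)(\gamma)=(\partial_U\circ\boldsymbol{\varrho})(\gamma)$ for all $\gamma\in\mathfrak{g}\otimes\Lambda^0(\mathcal{E}^\infty)$.
   Context: $\mathcal{E}^\infty$ is the infinite prolongation of $\mathcal{E}$ in the infinite jet superspace of even unknowns $u^k$ and odd unknowns $\xi^a$; $\bar D_x,\bar D_t$ are the restricted total derivatives; $\bar{\mathrm d}_h=\mathrm{d}x\,\bar D_x+\mathrm{d}t\,\bar D_t$ is the horizontal differential; $\mathfrak{g}\otimes\Lambda^q(\mathcal{E}^\infty)$ here refers to $\mathfrak{g}$-valued horizontal $q$-forms. The bracket on $\mathfrak{g}$-valued horizontal forms is $[\sigma,\sigma']=\sigma\cdot\sigma'-(-1)^{rs}(-1)^{\mathsf{p}(\sigma)\mathsf{p}(\sigma')}\sigma'\cdot\sigma$ for forms of degrees $r,s$ (product induced by matrix multiplication and wedge product, $(A\otimes\mu)\cdot(B\otimes\nu)=(-1)^{\mathsf{p}(B)\mathsf{p}(\mu)}AB\otimes\mu\wedge\nu$;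 $\mathsf p$ is the parity). A zero-curvature representation is a $\mathfrak{g}$-valued horizontal 1-form with $\bar{\mathrm d}_h\alpha=\tfrac12[\alpha,\alpha]$ on $\mathcal{E}^\infty$. Summation over repeated indices is understood. Representations. $\rho$ is the tautological matrix representation of $\mathfrak{g}$. The realisation $\boldsymbol{\varrho}$ is given by $\boldsymbol{\varrho}(g)=\boldsymbol{w}\,g\,\partial_{\boldsymbol{w}}$, where, for a fixed constant $\mu\neq0$ and coordinates $w^1,\dots,w^{k_0}$ (even), $w^{k_0+1},\dots,w^{k_0+k_1}$ (odd) on $W$, one puts $\boldsymbol{w}=(\mu,w^1,\dots,w^{k_0+k_1})$ and $\partial_{\boldsymbol{w}}=\bigl(-\tfrac1\mu\sum_jw^j\partial/\partial w^j,\ \partial/\partial w^1,\dots,\partial/\partial w^{k_0+k_1}\bigr)^{\mathrm t}$ (left derivatives); it satisfies $[\boldsymbol{\varrho}(g),\boldsymbol{\varrho}(h)]=\boldsymbol{\varrho}([g,h])$. The maps $\rho$, $\boldsymbol{\varrho}$, $\nabla$ are extended linearly over (horizontal forms with) function coefficients, so $\nabla(q^k\rho(e_k))=q^k\boldsymbol{\varrho}(e_k)$; the coefficients of $\boldsymbol\varrho(\gamma)$ are read as functions on $\tilde{\mathcal{E}}$. Covering. $\tau$ is the covering whose total derivatives are $\tilde D_x=\bar D_x+w^\ell_x\,\partial/\partial w^\ell$, $\tilde D_t=\bar D_t+w^\ell_t\,\partial/\partial w^\ell$ (these commute). $\Gamma T(\Lambda^r(\tilde{\mathcal{E}}))$ is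 the module of $\Lambda^r(\tilde{\mathcal{E}})$-valued derivations of $C^\infty(\tilde{\mathcal{E}})$ (vector-valued $r$-forms). The structure element is $$U=\bar{\mathrm d}_{\mathcal C}(u^k_\sigma)\frac{\partial}{\partial u^k_\sigma}+\bar{\mathrm d}_{\mathcal C}(\xi^a_\sigma)\frac{\vec\partial}{\partial\xi^a_\sigma}+(\mathrm{d}w^\ell-w^\ell_x\,\mathrm{d}x-w^\ell_t\,\mathrm{d}t)\frac{\vec\partial}{\partial w^\ell}\in\Gamma T(\Lambda^1(\tilde{\mathcal{E}})),$$ where $\bar{\mathrm d}_{\mathcal C}=\bar{\mathrm d}-\bar{\mathrm d}_h$ is the Cartan (vertical) differential. The Frölicher–Nijenhuis bracket of $\Omega\in\Gamma T(\Lambda^r)$ and $\Theta\in\Gamma T(\Lambda^s)$ is $[\Omega,\Theta]^{\mathrm{FN}}(g)=L_\Omega(\Theta(g))-(-1)^{rs+\mathsf{p}(\Omega)\mathsf{p}(\Theta)}L_\Theta(\Omega(g))$ for $g\in C^\infty(\tilde{\mathcal{E}})$, with $L_\Omega$ the Lie derivative along $\Omega$. *)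

theory Defs
  imports "HOL-Analysis.Analysis" "HOL-Library.Function_Algebras" "HOL-Library.Countable"
begin

section \<open>Superfunctions on infinite-dimensional superspace\<close>

text \<open>
  Coordinates on the product of the fibre W with the infinite jet superspace over the plane:
  the independent variables, the even jets \<open>Ujet k i j\<close> (the unknown \<open>u\<^sup>k\<close> differentiated \<open>i\<close> times
  in x and \<open>j\<close> times in t), the odd jets \<open>Xijet a i j\<close>, and the fibre variables (even or odd).
\<close>

datatype indep = Xvar | Tvar
datatype ecoord = Base indep | Ujet nat nat nat | Weven nat
datatype ocoord = Xijet nat nat nat | Wodd nat

type_synonym coord = "ecoord + ocoord"

instantiation indep :: linorder
begin
definition less_eq_indep :: "indep \<Rightarrow> indep \<Rightarrow> bool"
  where "less_eq_indep a b \<longleftrightarrow> a = Xvar \<or> b = Tvar"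
definition less_indep :: "indep \<Rightarrow> indep \<Rightarrow> bool"
  where "less_indep a b \<longleftrightarrow> a = Xvar \<and> b = Tvar"
instance
  by intro_classes (auto simp: less_eq_indep_def less_indep_def intro: indep.exhaust)
end

instance ocoord :: countable by countable_datatype

text \<open>An arbitrary linear order, used only to order the factors of Grassmann monomials.\<close>

instantiation ocoord :: linorder
begin
definition less_eq_ocoord :: "ocoord \<Rightarrow> ocoord \<Rightarrow> bool"
  where "less_eq_ocoord a b \<longleftrightarrow> to_nat a \<le> to_nat b"
definition less_ocoord :: "ocoord \<Rightarrow> ocoord \<Rightarrow> bool"
  where "less_ocoord a b \<longleftrightarrow> to_nat a < to_nat b"
instance
  by intro_classes (auto simp: less_eq_ocoord_def less_ocoord_def)
end

text \<open>
  \<open>f p S\<close> is the coefficient, at the point \<open>p\<close>, of the product of the odd coordinates in \<open>S\<close>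
  taken in increasing order. Addition, subtraction and zero are the pointwise ones of
  Function_Algebras; the product is \<open>\<star>\<close> below (and never the pointwise \<open>*\<close>).
\<close>

type_synonym superfun = "(ecoord \<Rightarrow> real) \<Rightarrow> ocoord set \<Rightarrow> real"

definition mono_sign :: "'o::linorder set \<Rightarrow> 'o set \<Rightarrow> real"
  where "mono_sign S S' = (- 1) ^ card {(a, b). a \<in> S \<and> b \<in> S' \<and> b < a}"

definition smult :: "superfun \<Rightarrow> superfun \<Rightarrow> superfun" (infixl "\<star>" 70)
  where "f \<star> g = (\<lambda>p S. \<Sum>S'\<in>Pow S. mono_sign S' (S - S') * f p S' * g p (S - S'))"

definition cmul :: "real \<Rightarrow> superfun \<Rightarrow> superfun"
  where "cmul c f = (\<lambda>p S. c * f p S)"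

definition sconst :: "real \<Rightarrow> superfun"
  where "sconst c = (\<lambda>p S. if S = {} then c else 0)"

fun coord_fun :: "coord \<Rightarrow> superfun"
  where
    "coord_fun (Inl e) = (\<lambda>p S. if S = {} then p e else 0)"
  | "coord_fun (Inr o') = (\<lambda>p S. if S = {o'} then 1 else 0)"

text \<open>Parities are the natural numbers 0 and 1.\<close>

fun cpar :: "coord \<Rightarrow> nat"
  where
    "cpar (Inl e) = 0"
  | "cpar (Inr o') = 1"

definition spart :: "nat \<Rightarrow> superfun \<Rightarrow> superfun"
  where "spart \<epsilon> f = (\<lambda>p S. if card S mod 2 = \<epsilon> then f p S else 0)"

definition has_parity :: "nat \<Rightarrow> superfun \<Rightarrow> bool"
  where "has_parity \<epsilon> f \<longleftrightarrow> spart \<epsilon> f = f"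

text \<open>\<open>sinv m f\<close> is \<open>(-1)\<close> to the power \<open>m p(f)\<close> times \<open>f\<close>, extended additively.\<close>

definition sinv :: "nat \<Rightarrow> superfun \<Rightarrow> superfun"
  where "sinv m f = (\<lambda>p S. (- 1) ^ (m * card S) * f p S)"

definition pdiff :: "ecoord \<Rightarrow> ((ecoord \<Rightarrow> real) \<Rightarrow> real) \<Rightarrow> ((ecoord \<Rightarrow> real) \<Rightarrow> real)"
  where "pdiff e h = (\<lambda>p. deriv (\<lambda>s. h (p(e := s))) (p e))"

text \<open>Left partial derivatives.\<close>

fun pd :: "coord \<Rightarrow> superfun \<Rightarrow> superfun"
  where
    "pd (Inl e) f = (\<lambda>p S. pdiff e (\<lambda>q. f q S) p)"
  | "pd (Inr o') f = (\<lambda>p S. if o' \<in> S then 0 else (- 1) ^ card {s \<in> S. s < o'} * f p (insert o' S))"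

text \<open>
  Continuity is with respect to the product topology; for a function of finitely many of the
  coordinates the following is ordinary smoothness.
\<close>

definition smooth :: "((ecoord \<Rightarrow> real) \<Rightarrow> real) \<Rightarrow> bool"
  where "smooth h \<longleftrightarrow>
    (\<forall>es. continuous_on UNIV (foldr pdiff es h) \<and>
      (\<forall>e p. (\<lambda>s. foldr pdiff es h (p(e := s))) differentiable (at (p e))))"

definition depends_only :: "coord set \<Rightarrow> superfun \<Rightarrow> bool"
  where "depends_only B f \<longleftrightarrow>
    (\<forall>p q S. (\<forall>e. Inl e \<in> B \<longrightarrow> p e = q e) \<longrightarrow> f p S = f q S) \<and>
    (\<forall>p S. f p S \<noteq> 0 \<longrightarrow> Inr ` S \<subseteq> B)"

definition Cinf :: "coord set \<Rightarrow> superfun set"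
  where "Cinf A = {f. (\<exists>B\<subseteq>A. finite B \<and> depends_only B f) \<and> (\<forall>S. smooth (\<lambda>p. f p S))}"


section \<open>Systems and their infinite prolongations\<close>

record zsystem =
  n_even :: nat
  n_odd :: nat
  eqns :: "superfun set"

definition jet_deps :: "zsystem \<Rightarrow> coord set"
  where "jet_deps \<E> =
    {Inl (Ujet k i j) | k i j. k < n_even \<E>} \<union> {Inr (Xijet a i j) | a i j. a < n_odd \<E>}"

definition jet_coords :: "zsystem \<Rightarrow> coord set"
  where "jet_coords \<E> = range (\<lambda>i. Inl (Base i)) \<union> jet_deps \<E>"

fun jet_shift :: "indep \<Rightarrow> coord \<Rightarrow> coord"
  where
    "jet_shift Xvar (Inl (Ujet k i j)) = Inl (Ujet k (Suc i) j)"
  | "jet_shift Tvar (Inl (Ujet k i j)) = Inl (Ujet k i (Suc j))"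
  | "jet_shift Xvar (Inr (Xijet a i j)) = Inr (Xijet a (Suc i) j)"
  | "jet_shift Tvar (Inr (Xijet a i j)) = Inr (Xijet a i (Suc j))"
  | "jet_shift v z = z"

text \<open>The total derivative; on functions that also involve fibre variables, these are inert.\<close>

definition Dtot :: "zsystem \<Rightarrow> indep \<Rightarrow> superfun \<Rightarrow> superfun"
  where "Dtot \<E> v f =
    pd (Inl (Base v)) f +
    (\<Sum>z\<in>{z \<in> jet_deps \<E>. pd z f \<noteq> 0}. coord_fun (jet_shift v z) \<star> pd z f)"

definition zgraded_system :: "zsystem \<Rightarrow> bool"
  where "zgraded_system \<E> \<longleftrightarrow>
    finite (eqns \<E>) \<and>
    (\<forall>F\<in>eqns \<E>. F \<in> Cinf (jet_coords \<E>) \<and> (\<exists>\<epsilon><2. has_parity \<epsilon> F))"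

definition prolongation :: "zsystem \<Rightarrow> superfun set"
  where "prolongation \<E> = {foldr (Dtot \<E>) vs F | vs F. F \<in> eqns \<E>}"

inductive_set gen_ideal :: "superfun set \<Rightarrow> superfun set \<Rightarrow> superfun set"
  for C P :: "superfun set"
  where
    zero: "0 \<in> gen_ideal C P"
  | step: "h \<in> C \<Longrightarrow> f \<in> P \<Longrightarrow> g \<in> gen_ideal C P \<Longrightarrow> h \<star> f + g \<in> gen_ideal C P"

text \<open>
  The algebra of functions on the infinite prolongation is the quotient of
  \<open>Cinf (jet_coords \<E>)\<close> by the differential ideal \<open>jet_ideal \<E>\<close>. Its elements are handled
  through representatives: \<open>f\<close> and \<open>g\<close> are the same function on the prolongation iff
  \<open>f - g \<in> jet_ideal \<E>\<close>. The ideal is stable under the total derivatives, so their restrictions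
  to the prolongation are computed on representatives. The same applies to all derived objects.
\<close>

definition jet_ideal :: "zsystem \<Rightarrow> superfun set"
  where "jet_ideal \<E> = gen_ideal (Cinf (jet_coords \<E>)) (prolongation \<E>)"


section \<open>Matrix Lie superalgebras\<close>

type_synonym rmat = "nat \<Rightarrow> nat \<Rightarrow> real"

text \<open>
  A subalgebra of gl(k0+1|k1) with a basis \<open>gbasis 0\<close>, ..., \<open>gbasis (gdim - 1)\<close> of homogeneous
  elements. Rows and columns are indexed by 0, ..., k0+k1, the first k0+1 indices being even.
\<close>

record matalg =
  k0 :: nat
  k1 :: nat
  alg :: "rmat set"
  gdim :: nat
  gbasis :: "nat \<Rightarrow> rmat"
  bpar :: "nat \<Rightarrow> nat"

definition topidx :: "matalg \<Rightarrow> nat"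
  where "topidx G = k0 G + k1 G"

definition ipar :: "matalg \<Rightarrow> nat \<Rightarrow> nat"
  where "ipar G i = (if i \<le> k0 G then 0 else 1)"

definition gl :: "matalg \<Rightarrow> rmat set"
  where "gl G = {M. \<forall>i j. M i j \<noteq> 0 \<longrightarrow> i \<le> topidx G \<and> j \<le> topidx G}"

definition mat_part :: "matalg \<Rightarrow> nat \<Rightarrow> rmat \<Rightarrow> rmat"
  where "mat_part G \<epsilon> M = (\<lambda>i j. if (ipar G i + ipar G j) mod 2 = \<epsilon> then M i j else 0)"

definition mat_mul :: "matalg \<Rightarrow> rmat \<Rightarrow> rmat \<Rightarrow> rmat"
  where "mat_mul G M N = (\<lambda>i j. \<Sum>k\<le>topidx G. M i k * N k j)"

definition scale_mat :: "real \<Rightarrow> rmat \<Rightarrow> rmat"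
  where "scale_mat c M = (\<lambda>i j. c * M i j)"

definition mat_bracket :: "matalg \<Rightarrow> rmat \<Rightarrow> rmat \<Rightarrow> rmat"
  where "mat_bracket G M N =
    (\<Sum>\<epsilon><2. \<Sum>\<delta><2.
      mat_mul G (mat_part G \<epsilon> M) (mat_part G \<delta> N)
      - scale_mat ((- 1) ^ (\<epsilon> * \<delta>)) (mat_mul G (mat_part G \<delta> N) (mat_part G \<epsilon> M)))"

definition lie_subsuperalgebra :: "matalg \<Rightarrow> bool"
  where "lie_subsuperalgebra G \<longleftrightarrow>
    alg G \<subseteq> gl G \<and> 0 \<in> alg G \<and>
    (\<forall>M\<in>alg G. \<forall>N\<in>alg G. M + N \<in> alg G) \<and>
    (\<forall>c. \<forall>M\<in>alg G. scale_mat c M \<in> alg G) \<and>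
    (\<forall>M\<in>alg G. \<forall>\<epsilon><2. mat_part G \<epsilon> M \<in> alg G) \<and>
    (\<forall>M\<in>alg G. \<forall>N\<in>alg G. mat_bracket G M N \<in> alg G)"

definition homogeneous_basis :: "matalg \<Rightarrow> bool"
  where "homogeneous_basis G \<longleftrightarrow>
    (\<forall>i<gdim G. gbasis G i \<in> alg G \<and> bpar G i < 2 \<and>
       mat_part G (bpar G i) (gbasis G i) = gbasis G i) \<and>
    (\<forall>c. (\<Sum>i<gdim G. scale_mat (c i) (gbasis G i)) = 0 \<longrightarrow> (\<forall>i<gdim G. c i = 0)) \<and>
    (\<forall>M\<in>alg G. \<exists>c. M = (\<Sum>i<gdim G. scale_mat (c i) (gbasis G i)))"


section \<open>Horizontal forms with values in matrices and in the Lie superalgebra\<close>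

text \<open>
  \<open>\<omega> S\<close> is the coefficient of the wedge product of the \<open>dv\<close>, \<open>v \<in> S\<close>, in increasing order.
  Forms obey the bigraded rule with sign exponent \<open>rs + p p'\<close>, so dx and dt commute with all
  functions.
\<close>

type_synonym hform = "indep set \<Rightarrow> superfun"

definition hwedge :: "hform \<Rightarrow> hform \<Rightarrow> hform"
  where "hwedge \<omega> \<theta> = (\<lambda>S. \<Sum>S'\<in>Pow S. cmul (mono_sign S' (S - S')) (\<omega> S' \<star> \<theta> (S - S')))"

definition hfun :: "superfun \<Rightarrow> hform"
  where "hfun f = (\<lambda>S. if S = {} then f else 0)"

definition hone :: "superfun \<Rightarrow> superfun \<Rightarrow> hform"
  where "hone f g = (\<lambda>S. if S = {Xvar} then f else if S = {Tvar} then g else 0)"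

definition dh :: "zsystem \<Rightarrow> hform \<Rightarrow> hform"
  where "dh \<E> \<omega> = (\<lambda>S. \<Sum>v\<in>S. cmul (mono_sign {v} (S - {v})) (Dtot \<E> v (\<omega> (S - {v}))))"

text \<open>
  The element \<open>A \<otimes> \<mu>\<close> of the tensor product of matrices and horizontal forms is the array
  \<open>\<lambda>i j. A i j \<mu>\<close>. The sign in \<open>mf_prod\<close> comes from \<open>\<mu>\<close> passing the elementary matrix with
  indices \<open>k, j\<close>.
\<close>

type_synonym mform = "nat \<Rightarrow> nat \<Rightarrow> hform"

definition mforms :: "zsystem \<Rightarrow> matalg \<Rightarrow> nat \<Rightarrow> mform set"
  where "mforms \<E> G q =
    {\<sigma>. \<forall>i j S. \<sigma> i j S \<in> Cinf (jet_coords \<E>) \<and>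
      (\<not> (i \<le> topidx G \<and> j \<le> topidx G \<and> card S = q) \<longrightarrow> \<sigma> i j S = 0)}"

definition mf_eq :: "zsystem \<Rightarrow> mform \<Rightarrow> mform \<Rightarrow> bool"
  where "mf_eq \<E> \<sigma> \<sigma>' \<longleftrightarrow> (\<forall>i j S. \<sigma> i j S - \<sigma>' i j S \<in> jet_ideal \<E>)"

definition mf_scale :: "real \<Rightarrow> mform \<Rightarrow> mform"
  where "mf_scale c \<sigma> = (\<lambda>i j S. cmul c (\<sigma> i j S))"

definition mf_prod :: "matalg \<Rightarrow> mform \<Rightarrow> mform \<Rightarrow> mform"
  where "mf_prod G \<sigma> \<tau> =
    (\<lambda>i j. \<Sum>k\<le>topidx G. hwedge (\<lambda>S. sinv (ipar G k + ipar G j) (\<sigma> i k S)) (\<tau> k j))"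

definition mf_part :: "matalg \<Rightarrow> nat \<Rightarrow> mform \<Rightarrow> mform"
  where "mf_part G \<epsilon> \<sigma> = (\<lambda>i j S. spart ((\<epsilon> + ipar G i + ipar G j) mod 2) (\<sigma> i j S))"

text \<open>The bracket of forms of degrees \<open>r\<close> and \<open>s\<close>, extended bilinearly from homogeneous ones.\<close>

definition mf_bracket :: "matalg \<Rightarrow> nat \<Rightarrow> nat \<Rightarrow> mform \<Rightarrow> mform \<Rightarrow> mform"
  where "mf_bracket G r s \<sigma> \<tau> =
    (\<Sum>\<epsilon><2. \<Sum>\<delta><2.
      mf_prod G (mf_part G \<epsilon> \<sigma>) (mf_part G \<delta> \<tau>)
      - mf_scale ((- 1) ^ (r * s) * (- 1) ^ (\<epsilon> * \<delta>))
          (mf_prod G (mf_part G \<delta> \<tau>) (mf_part G \<epsilon> \<sigma>)))"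

definition mf_dh :: "zsystem \<Rightarrow> mform \<Rightarrow> mform"
  where "mf_dh \<E> \<sigma> = (\<lambda>i j. dh \<E> (\<sigma> i j))"

text \<open>The operator \<open>\<partial>\<^sub>\<alpha>\<close> on \<open>q\<close>-forms, for a 1-form \<open>\<alpha>\<close>.\<close>

definition partial_alpha :: "zsystem \<Rightarrow> matalg \<Rightarrow> nat \<Rightarrow> mform \<Rightarrow> mform \<Rightarrow> mform"
  where "partial_alpha \<E> G q \<alpha> \<sigma> = mf_dh \<E> \<sigma> - mf_bracket G 1 q \<alpha> \<sigma>"

text \<open>\<open>\<gamma>\<close> stands for the sum of the products \<open>\<gamma> k e\<^sub>k\<close>, with coefficients on the left.\<close>

type_synonym gform = "nat \<Rightarrow> hform"

definition gforms :: "zsystem \<Rightarrow> matalg \<Rightarrow> nat \<Rightarrow> gform set"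
  where "gforms \<E> G q =
    {\<gamma>. \<forall>k S. \<gamma> k S \<in> Cinf (jet_coords \<E>) \<and> (\<not> (k < gdim G \<and> card S = q) \<longrightarrow> \<gamma> k S = 0)}"

definition gf_eq :: "zsystem \<Rightarrow> gform \<Rightarrow> gform \<Rightarrow> bool"
  where "gf_eq \<E> \<gamma> \<gamma>' \<longleftrightarrow> (\<forall>k S. \<gamma> k S - \<gamma>' k S \<in> jet_ideal \<E>)"

text \<open>
  A left coefficient \<open>q\<close> becomes a right tensor factor by the sign rule:
  \<open>q A\<close> is \<open>(-1)\<close> to the power \<open>p(q) p(A)\<close> times \<open>A \<otimes> q\<close>.
\<close>

definition rho :: "matalg \<Rightarrow> gform \<Rightarrow> mform"
  where "rho G \<gamma> = (\<lambda>i j S. \<Sum>k<gdim G. cmul (gbasis G k i j) (sinv (bpar G k) (\<gamma> k S)))"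

definition rho_image :: "zsystem \<Rightarrow> matalg \<Rightarrow> nat \<Rightarrow> mform set"
  where "rho_image \<E> G q = {\<sigma> \<in> mforms \<E> G q. \<exists>\<gamma>\<in>gforms \<E> G q. mf_eq \<E> (rho G \<gamma>) \<sigma>}"

definition rho_inverse :: "zsystem \<Rightarrow> matalg \<Rightarrow> nat \<Rightarrow> mform \<Rightarrow> gform"
  where "rho_inverse \<E> G q \<sigma> = (SOME \<gamma>. \<gamma> \<in> gforms \<E> G q \<and> mf_eq \<E> (rho G \<gamma>) \<sigma>)"

text \<open>
  The form with coefficients \<open>a i\<close> along dx and \<open>b i\<close> along dt; it is an even element, that is,
  \<open>a i\<close> and \<open>b i\<close> have the parity of \<open>e\<^sub>i\<close>.
\<close>

definition alpha_form :: "matalg \<Rightarrow> (nat \<Rightarrow> superfun) \<Rightarrow> (nat \<Rightarrow> superfun) \<Rightarrow> gform"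
  where "alpha_form G a b = (\<lambda>i. if i < gdim G then hone (a i) (b i) else 0)"

definition zero_curvature ::
    "zsystem \<Rightarrow> matalg \<Rightarrow> (nat \<Rightarrow> superfun) \<Rightarrow> (nat \<Rightarrow> superfun) \<Rightarrow> bool"
  where "zero_curvature \<E> G a b \<longleftrightarrow>
    (\<forall>i<gdim G. a i \<in> Cinf (jet_coords \<E>) \<and> b i \<in> Cinf (jet_coords \<E>) \<and>
       has_parity (bpar G i) (a i) \<and> has_parity (bpar G i) (b i)) \<and>
    (let \<alpha> = rho G (alpha_form G a b)
     in mf_eq \<E> (mf_dh \<E> \<alpha>) (mf_scale (1 / 2) (mf_bracket G 1 1 \<alpha> \<alpha>)))"


section \<open>The covering space and its forms\<close>

definition wcoord :: "matalg \<Rightarrow> nat \<Rightarrow> coord"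
  where "wcoord G l = (if l \<le> k0 G then Inl (Weven l) else Inr (Wodd l))"

definition cov_coords :: "zsystem \<Rightarrow> matalg \<Rightarrow> coord set"
  where "cov_coords \<E> G = jet_coords \<E> \<union> wcoord G ` {1..topidx G}"

abbreviation CinfW :: "zsystem \<Rightarrow> matalg \<Rightarrow> superfun set"
  where "CinfW \<E> G \<equiv> Cinf (cov_coords \<E> G)"

definition cov_ideal :: "zsystem \<Rightarrow> matalg \<Rightarrow> superfun set"
  where "cov_ideal \<E> G = gen_ideal (CinfW \<E> G) (prolongation \<E>)"

text \<open>
  One-forms: \<open>\<omega> A\<close> is the coefficient of the differential of the coordinate \<open>A\<close>, which stands to
  the left of it. The differential of a coordinate has degree 1 and the parity of the coordinate.
\<close>

type_synonym oneform = "coord \<Rightarrow> superfun"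

definition extd :: "superfun \<Rightarrow> oneform"
  where "extd f = (\<lambda>A. pd A f)"

definition rmul :: "oneform \<Rightarrow> superfun \<Rightarrow> oneform"
  where "rmul \<omega> f = (\<lambda>A. \<omega> A \<star> f)"

definition lmul :: "superfun \<Rightarrow> oneform \<Rightarrow> oneform"
  where "lmul f \<omega> = (\<lambda>A. sinv (cpar A) f \<star> \<omega> A)"

definition form_scale :: "real \<Rightarrow> oneform \<Rightarrow> oneform"
  where "form_scale c \<omega> = (\<lambda>A. cmul c (\<omega> A))"

definition form_part :: "nat \<Rightarrow> oneform \<Rightarrow> oneform"
  where "form_part \<epsilon> \<omega> = (\<lambda>A. spart ((\<epsilon> + cpar A) mod 2) (\<omega> A))"

definition of_hform :: "hform \<Rightarrow> oneform"
  where "of_hform \<omega> = (\<lambda>A. case A of Inl (Base v) \<Rightarrow> \<omega> {v} | _ \<Rightarrow> 0)"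

definition Lambda1 :: "zsystem \<Rightarrow> matalg \<Rightarrow> oneform set"
  where "Lambda1 \<E> G =
    {\<omega>. (\<forall>A. \<omega> A \<in> CinfW \<E> G) \<and> finite {A. \<omega> A \<noteq> 0} \<and> {A. \<omega> A \<noteq> 0} \<subseteq> cov_coords \<E> G}"

text \<open>
  The forms that vanish on the covering space: the submodule generated by the ideal and by the
  differentials of its elements.
\<close>

inductive_set null_forms :: "zsystem \<Rightarrow> matalg \<Rightarrow> oneform set"
  for \<E> :: zsystem and G :: matalg
  where
    zero: "0 \<in> null_forms \<E> G"
  | add: "\<omega> \<in> null_forms \<E> G \<Longrightarrow> \<theta> \<in> null_forms \<E> G \<Longrightarrow> \<omega> + \<theta> \<in> null_forms \<E> G"
  | ideal: "\<omega> \<in> Lambda1 \<E> G \<Longrightarrow> h \<in> cov_ideal \<E> G \<Longrightarrow> rmul \<omega> h \<in> null_forms \<E> G"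
  | diff: "h \<in> cov_ideal \<E> G \<Longrightarrow> f \<in> CinfW \<E> G \<Longrightarrow> rmul (extd h) f \<in> null_forms \<E> G"

type_synonym vfield = "superfun \<Rightarrow> superfun"
type_synonym vform = "superfun \<Rightarrow> oneform"

definition op_part :: "nat \<Rightarrow> vfield \<Rightarrow> vfield"
  where "op_part \<epsilon> \<Omega> = (\<lambda>g. \<Sum>\<eta><2. spart ((\<epsilon> + \<eta>) mod 2) (\<Omega> (spart \<eta> g)))"

definition vform_part :: "nat \<Rightarrow> vform \<Rightarrow> vform"
  where "vform_part \<epsilon> \<Theta> = (\<lambda>g. \<Sum>\<eta><2. form_part ((\<epsilon> + \<eta>) mod 2) (\<Theta> (spart \<eta> g)))"

definition vfield_eq :: "zsystem \<Rightarrow> matalg \<Rightarrow> vfield \<Rightarrow> vfield \<Rightarrow> bool"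
  where "vfield_eq \<E> G \<Omega> \<Omega>' \<longleftrightarrow> (\<forall>g\<in>CinfW \<E> G. \<Omega> g - \<Omega>' g \<in> cov_ideal \<E> G)"

definition vform_eq :: "zsystem \<Rightarrow> matalg \<Rightarrow> vform \<Rightarrow> vform \<Rightarrow> bool"
  where "vform_eq \<E> G \<Theta> \<Theta>' \<longleftrightarrow> (\<forall>g\<in>CinfW \<E> G. \<Theta> g - \<Theta>' g \<in> null_forms \<E> G)"

text \<open>
  Derivations of the function algebra of the covering space with values in functions and in
  one-forms; the Leibniz rule is the sum of the graded ones of the homogeneous components.
\<close>

definition GT0 :: "zsystem \<Rightarrow> matalg \<Rightarrow> vfield set"
  where "GT0 \<E> G = {\<Omega>.
    (\<forall>g\<in>CinfW \<E> G. \<Omega> g \<in> CinfW \<E> G) \<and>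
    (\<forall>g\<in>CinfW \<E> G. \<forall>h\<in>CinfW \<E> G. g - h \<in> cov_ideal \<E> G \<longrightarrow> \<Omega> g - \<Omega> h \<in> cov_ideal \<E> G) \<and>
    (\<forall>g\<in>CinfW \<E> G. \<forall>h\<in>CinfW \<E> G. \<Omega> (g + h) - (\<Omega> g + \<Omega> h) \<in> cov_ideal \<E> G) \<and>
    (\<forall>c. \<forall>g\<in>CinfW \<E> G. \<Omega> (cmul c g) - cmul c (\<Omega> g) \<in> cov_ideal \<E> G) \<and>
    (\<forall>g\<in>CinfW \<E> G. \<forall>h\<in>CinfW \<E> G.
      \<Omega> (g \<star> h) - (\<Sum>\<epsilon><2. op_part \<epsilon> \<Omega> g \<star> h + sinv \<epsilon> g \<star> op_part \<epsilon> \<Omega> h) \<in> cov_ideal \<E> G)}"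

definition GT1 :: "zsystem \<Rightarrow> matalg \<Rightarrow> vform set"
  where "GT1 \<E> G = {\<Theta>.
    (\<forall>g\<in>CinfW \<E> G. \<Theta> g \<in> Lambda1 \<E> G) \<and>
    (\<forall>g\<in>CinfW \<E> G. \<forall>h\<in>CinfW \<E> G. g - h \<in> cov_ideal \<E> G \<longrightarrow> \<Theta> g - \<Theta> h \<in> null_forms \<E> G) \<and>
    (\<forall>g\<in>CinfW \<E> G. \<forall>h\<in>CinfW \<E> G. \<Theta> (g + h) - (\<Theta> g + \<Theta> h) \<in> null_forms \<E> G) \<and>
    (\<forall>c. \<forall>g\<in>CinfW \<E> G. \<Theta> (cmul c g) - form_scale c (\<Theta> g) \<in> null_forms \<E> G) \<and>
    (\<forall>g\<in>CinfW \<E> G. \<forall>h\<in>CinfW \<E> G.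
      \<Theta> (g \<star> h) - (\<Sum>\<epsilon><2. rmul (vform_part \<epsilon> \<Theta> g) h + lmul (sinv \<epsilon> g) (vform_part \<epsilon> \<Theta> h))
        \<in> null_forms \<E> G)}"

definition contract :: "vfield \<Rightarrow> oneform \<Rightarrow> superfun"
  where "contract \<Omega> \<omega> = (\<Sum>A\<in>{A. \<omega> A \<noteq> 0}. \<Omega> (coord_fun A) \<star> \<omega> A)"

text \<open>
  The Lie derivative of one-forms along a vector field of parity \<open>\<epsilon>\<close> is the derivation that
  commutes with the differential:
  \<open>dA f\<close> is sent to \<open>d(\<Omega> A) f + (-1)\<^bsup>\<epsilon> p(A)\<^esup> dA \<Omega>(f)\<close>.
\<close>

definition lie_form :: "nat \<Rightarrow> vfield \<Rightarrow> oneform \<Rightarrow> oneform"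
  where "lie_form \<epsilon> \<Omega> \<omega> =
    (\<Sum>A\<in>{A. \<omega> A \<noteq> 0}.
      rmul (extd (\<Omega> (coord_fun A))) (\<omega> A)
      + form_scale ((- 1) ^ (\<epsilon> * cpar A)) (rmul (extd (coord_fun A)) (\<Omega> (\<omega> A))))"

text \<open>
  The Froelicher--Nijenhuis bracket in degrees r = 0 and s = 1, extended bilinearly from
  homogeneous arguments. The Lie derivative of a function along \<open>\<Theta>\<close> is \<open>\<Theta>\<close> applied to it.
\<close>

definition fn_bracket :: "vfield \<Rightarrow> vform \<Rightarrow> vform"
  where "fn_bracket \<Omega> \<Theta> = (\<lambda>g. \<Sum>\<epsilon><2. \<Sum>\<delta><2.
    lie_form \<epsilon> (op_part \<epsilon> \<Omega>) (vform_part \<delta> \<Theta> g)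
    - form_scale ((- 1) ^ (0 * 1 + \<epsilon> * \<delta>)) (vform_part \<delta> \<Theta> (op_part \<epsilon> \<Omega> g)))"


section \<open>The realisation by vector fields, the covering and its structure element\<close>

definition wvec :: "matalg \<Rightarrow> real \<Rightarrow> nat \<Rightarrow> superfun"
  where "wvec G \<mu> i = (if i = 0 then sconst \<mu> else coord_fun (wcoord G i))"

definition dvec :: "matalg \<Rightarrow> real \<Rightarrow> nat \<Rightarrow> vfield"
  where "dvec G \<mu> j f =
    (if j = 0
     then cmul (- 1 / \<mu>) (\<Sum>l\<in>{1..topidx G}. coord_fun (wcoord G l) \<star> pd (wcoord G l) f)
     else pd (wcoord G j) f)"

definition realisation :: "matalg \<Rightarrow> real \<Rightarrow> rmat \<Rightarrow> vfield"
  where "realisation G \<mu> M f =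
    (\<Sum>i\<le>topidx G. \<Sum>j\<le>topidx G. cmul (M i j) (wvec G \<mu> i \<star> dvec G \<mu> j f))"

definition varrho0 :: "matalg \<Rightarrow> real \<Rightarrow> gform \<Rightarrow> vfield"
  where "varrho0 G \<mu> \<gamma> = (\<lambda>g. \<Sum>k<gdim G. \<gamma> k {} \<star> realisation G \<mu> (gbasis G k) g)"

definition varrho1 :: "matalg \<Rightarrow> real \<Rightarrow> gform \<Rightarrow> vform"
  where "varrho1 G \<mu> \<gamma> =
    (\<lambda>g. \<Sum>k<gdim G. rmul (of_hform (\<gamma> k)) (realisation G \<mu> (gbasis G k) g))"

definition nabla0 :: "zsystem \<Rightarrow> matalg \<Rightarrow> real \<Rightarrow> mform \<Rightarrow> vfield"
  where "nabla0 \<E> G \<mu> \<sigma> = varrho0 G \<mu> (rho_inverse \<E> G 0 \<sigma>)"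

definition nabla1 :: "zsystem \<Rightarrow> matalg \<Rightarrow> real \<Rightarrow> mform \<Rightarrow> vform"
  where "nabla1 \<E> G \<mu> \<sigma> = varrho1 G \<mu> (rho_inverse \<E> G 1 \<sigma>)"

definition Dcov :: "zsystem \<Rightarrow> matalg \<Rightarrow> indep \<Rightarrow> (nat \<Rightarrow> superfun) \<Rightarrow> vfield"
  where "Dcov \<E> G v w f = Dtot \<E> v f + (\<Sum>l\<in>{1..topidx G}. w l \<star> pd (wcoord G l) f)"

definition covering ::
    "zsystem \<Rightarrow> matalg \<Rightarrow> (nat \<Rightarrow> superfun) \<Rightarrow> (nat \<Rightarrow> superfun) \<Rightarrow> bool"
  where "covering \<E> G wx wt \<longleftrightarrow>
    (\<forall>l\<in>{1..topidx G}. wx l \<in> CinfW \<E> G \<and> wt l \<in> CinfW \<E> G \<and>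
       has_parity (cpar (wcoord G l)) (wx l) \<and> has_parity (cpar (wcoord G l)) (wt l)) \<and>
    (\<forall>g\<in>CinfW \<E> G.
       Dcov \<E> G Xvar wx (Dcov \<E> G Tvar wt g) - Dcov \<E> G Tvar wt (Dcov \<E> G Xvar wx g)
         \<in> cov_ideal \<E> G)"

definition fibre_velocity :: "matalg \<Rightarrow> real \<Rightarrow> (nat \<Rightarrow> superfun) \<Rightarrow> nat \<Rightarrow> superfun"
  where "fibre_velocity G \<mu> a l =
    - (\<Sum>i<gdim G. a i \<star> contract (realisation G \<mu> (gbasis G i)) (extd (coord_fun (wcoord G l))))"

definition cartan_d :: "zsystem \<Rightarrow> superfun \<Rightarrow> oneform"
  where "cartan_d \<E> f = extd f - of_hform (dh \<E> (hfun f))"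

definition structure_element ::
    "zsystem \<Rightarrow> matalg \<Rightarrow> (nat \<Rightarrow> superfun) \<Rightarrow> (nat \<Rightarrow> superfun) \<Rightarrow> vform"
  where "structure_element \<E> G wx wt g =
    (\<Sum>z\<in>{z \<in> jet_deps \<E>. pd z g \<noteq> 0}. rmul (cartan_d \<E> (coord_fun z)) (pd z g)) +
    (\<Sum>l\<in>{1..topidx G}.
      rmul (extd (coord_fun (wcoord G l))
            - lmul (wx l) (extd (coord_fun (Inl (Base Xvar))))
            - lmul (wt l) (extd (coord_fun (Inl (Base Tvar)))))
        (pd (wcoord G l) g))"

definition partial_U :: "vform \<Rightarrow> vfield \<Rightarrow> vform"
  where "partial_U U \<Omega> = fn_bracket \<Omega> U"

text \<open>
  A map between quotients that is given on representatives: it preserves the carriers and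
  respects the equivalences.
\<close>

definition well_defined_map ::
    "'a set \<Rightarrow> ('a \<Rightarrow> 'a \<Rightarrow> bool) \<Rightarrow> 'b set \<Rightarrow> ('b \<Rightarrow> 'b \<Rightarrow> bool) \<Rightarrow> ('a \<Rightarrow> 'b) \<Rightarrow> bool"
  where "well_defined_map A eqA B eqB f \<longleftrightarrow>
    (\<forall>a\<in>A. f a \<in> B) \<and> (\<forall>a\<in>A. \<forall>a'\<in>A. eqA a a' \<longrightarrow> eqB (f a) (f a'))"

end

(*
  On representatives the structure element is U g = dg - dx Dx g - dt Dt g, where Dx, Dt are the total
  derivatives of the covering. The Lie derivative along a vertical vector field V commutes with d, so
  [V, U] g = dx [Dx, V] g + dt [Dt, V] g. For V = sum_k gamma^k R_k, where R_k is the realisation of e_k,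
  the jet part of Dx commutes with every R_k, and the fibre part of Dx is - a^i R_i modulo the ideal of
  the equation. Hence [Dx, V] = (Dx gamma^k) R_k - [a^i R_i, gamma^k R_k], and since [R_i, R_k] is the
  realisation of [e_i, e_k], the coefficients of this field are those of the matrix
  Dx (rho gamma) - [alpha_x, rho gamma]. Everything descends to the quotients by the ideals because these
  are generated by homogeneous elements, and rho is injective modulo the ideal because the basis matrices
  are linearly independent.
*)

theory Submission
  imports Defs
begin

section \<open>Grassmann signs and the product of superfunctions\<close>

text \<open>The realisation is the linear action on homogeneous coordinates (w^0, w^1, ...),
  restricted to functions of degree 0 and read at w^0 = \<mu>. On such functions the full Euler
  field vanishes, so the derivative by w^0 becomes -1/\<mu> times the Euler field of the remaining
  coordinates; this is where the constant comes from. The price is that the operators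
  \<open>dvec\<close> are neither dual to the \<open>wvec\<close> nor supercommuting. Both defects
  are multiples of 1/\<mu>, and they cancel in the commutators of the products w^i d_j. The other
  obstacle is the use of representatives. The velocities \<open>wx\<close>, \<open>wt\<close> are
  prescribed only modulo the ideal, and \<open>rho_inverse\<close> is an arbitrary choice, so the
  commutators with the total derivatives of the covering are merely congruent to vertical fields.
  The matrix side, in contrast, is computed exactly; the ideal enters only through the velocities,
  through changes of representatives and through the choice of preimages under
  \<open>rho\<close>.\<close>

lemma sum_fun_eval: "(\<Sum>i\<in>I. f i) x = (\<Sum>i\<in>I. f i x)"
  by (induction I rule: infinite_finite_induct) auto

lemma sum_hom:
  fixes F :: "'a::comm_monoid_add \<Rightarrow> 'b::comm_monoid_add"
  assumes "F 0 = 0" "\<And>x y. F (x + y) = F x + F y"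
  shows "F (\<Sum>i\<in>I. f i) = (\<Sum>i\<in>I. F (f i))"
  using sum_comp_morphism[of F f I] assms by (simp add: o_def)

lemma neg_one_power_mod_2: "(- 1 :: real) ^ (m * (n mod 2)) = (- 1) ^ (m * n)"
  by (cases "even n") (simp_all add: minus_one_power_iff odd_iff_mod_2_eq_one flip: even_iff_mod_2_eq_zero)

lemma mono_sign_empty [simp]: "mono_sign {} S = 1" "mono_sign S {} = 1"
  by (auto simp: mono_sign_def)

lemma finite_inversions:
  "finite A \<Longrightarrow> finite B \<Longrightarrow> finite {(a, b). a \<in> A \<and> b \<in> B \<and> b < a}"
  by (rule finite_subset[of _ "A \<times> B"]) auto

lemma mono_sign_Un_left:
  assumes "finite A" "finite B" "finite C" "A \<inter> B = {}"
  shows "mono_sign (A \<union> B) C = mono_sign A C * mono_sign B C"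
proof -
  have "{(a, b). a \<in> A \<union> B \<and> b \<in> C \<and> b < a}
    = {(a, b). a \<in> A \<and> b \<in> C \<and> b < a} \<union> {(a, b). a \<in> B \<and> b \<in> C \<and> b < a}" by auto
  moreover have "{(a, b). a \<in> A \<and> b \<in> C \<and> b < a} \<inter> {(a, b). a \<in> B \<and> b \<in> C \<and> b < a} = {}"
    using assms by auto
  ultimately show ?thesis
    unfolding mono_sign_def using assms
    by (simp add: card_Un_disjoint finite_inversions power_add)
qed

lemma mono_sign_Un_right:
  assumes "finite A" "finite B" "finite C" "B \<inter> C = {}"
  shows "mono_sign A (B \<union> C) = mono_sign A B * mono_sign A C"
proof -
  have "{(a, b). a \<in> A \<and> b \<in> B \<union> C \<and> b < a}
    = {(a, b). a \<in> A \<and> b \<in> B \<and> b < a} \<union> {(a, b). a \<in> A \<and> b \<in> C \<and> b < a}" by auto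
  moreover have "{(a, b). a \<in> A \<and> b \<in> B \<and> b < a} \<inter> {(a, b). a \<in> A \<and> b \<in> C \<and> b < a} = {}"
    using assms by auto
  ultimately show ?thesis
    unfolding mono_sign_def using assms
    by (simp add: card_Un_disjoint finite_inversions power_add)
qed

lemma mono_sign_square [simp]: "mono_sign A B * mono_sign A B = 1"
  by (simp add: mono_sign_def flip: power_add)

lemma mono_sign_square_left [simp]: "mono_sign A B * (mono_sign A B * x) = x"
  by (simp flip: mult.assoc)

text \<open>The sets are disjoint, so each pair in \<open>A \<times> B\<close> is an inversion for
  exactly one of the two orders, and the two counts add up to
  \<open>card A * card B\<close>.\<close>

lemma mono_sign_commute:
  assumes "finite A" "finite B" "A \<inter> B = {}"
  shows "mono_sign A B = (- 1) ^ (card A * card B) * mono_sign B A"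
proof -
  let ?P = "{(a, b). a \<in> A \<and> b \<in> B \<and> b < a}"
  let ?Q = "{(b, a). b \<in> B \<and> a \<in> A \<and> a < b}"
  have "A \<times> B = ?P \<union> prod.swap ` ?Q"
    using assms by (auto simp: image_iff)
  moreover have "?P \<inter> prod.swap ` ?Q = {}" by auto
  ultimately have "card (A \<times> B) = card ?P + card (prod.swap ` ?Q)"
    using finite_inversions[OF assms(1,2)] finite_inversions[OF assms(2,1)]
    by (simp add: card_Un_disjoint)
  also have "card (prod.swap ` ?Q) = card ?Q"
    by (rule card_image) (auto simp: inj_on_def)
  finally have "card A * card B = card ?P + card ?Q" by (simp add: card_cartesian_product)
  then have "(- 1) ^ (card A * card B) * mono_sign B A
      = (- 1) ^ card ?P * ((- 1) ^ card ?Q * (- 1 :: real) ^ card ?Q)"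
    by (simp add: mono_sign_def power_add)
  then show ?thesis by (simp add: mono_sign_def flip: power_add)
qed

text \<open>\<open>Pow S\<close> is infinite and the sum over it is 0 by convention. An identity
  between a product and a function that is not a product therefore needs that function to vanish on
  infinite sets, which \<open>Cinf_infinite\<close> supplies.\<close>

lemma smult_infinite: "infinite S \<Longrightarrow> (f \<star> g) p S = 0"
  by (simp add: smult_def)

lemma smult_add_left: "(f + g) \<star> h = f \<star> h + g \<star> h"
  by (simp add: smult_def fun_eq_iff algebra_simps sum.distrib)

lemma smult_add_right: "h \<star> (f + g) = h \<star> f + h \<star> g"
  by (simp add: smult_def fun_eq_iff algebra_simps sum.distrib)

lemma smult_diff_left: "(f - g) \<star> h = f \<star> h - g \<star> h"
  by (simp add: smult_def fun_eq_iff algebra_simps sum_subtractf)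

lemma smult_diff_right: "h \<star> (f - g) = h \<star> f - h \<star> g"
  by (simp add: smult_def fun_eq_iff algebra_simps sum_subtractf)

lemma smult_zero [simp]: "0 \<star> f = 0" "f \<star> 0 = 0"
  by (simp_all add: smult_def fun_eq_iff)

lemma smult_cmul_left [simp]: "cmul c f \<star> g = cmul c (f \<star> g)"
  by (simp add: smult_def cmul_def fun_eq_iff sum_distrib_left mult_ac)

lemma smult_cmul_right [simp]: "f \<star> cmul c g = cmul c (f \<star> g)"
  by (simp add: smult_def cmul_def fun_eq_iff sum_distrib_left mult_ac)

lemma cmul_cmul [simp]: "cmul c (cmul d f) = cmul (c * d) f"
  by (simp add: cmul_def mult_ac)

lemma cmul_one [simp]: "cmul 1 f = f"
  by (simp add: cmul_def)

lemma cmul_minus_one: "cmul (- 1) f = - f"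
  by (simp add: cmul_def fun_eq_iff)

lemma cmul_zero [simp]: "cmul 0 f = 0" "cmul c 0 = 0"
  by (simp_all add: cmul_def fun_eq_iff)

lemma cmul_add_right: "cmul c (f + g) = cmul c f + cmul c g"
  by (simp add: cmul_def fun_eq_iff algebra_simps)

lemma cmul_diff_right: "cmul c (f - g) = cmul c f - cmul c g"
  by (simp add: cmul_def fun_eq_iff algebra_simps)

lemma cmul_diff_left: "cmul (c - d) f = cmul c f - cmul d f"
  by (simp add: cmul_def fun_eq_iff algebra_simps)

lemma cmul_minus_left: "cmul (- c) f = - cmul c f"
  by (simp add: cmul_def fun_eq_iff)

lemma cmul_sum: "cmul c (\<Sum>i\<in>I. f i) = (\<Sum>i\<in>I. cmul c (f i))"
  by (rule sum_hom[of "cmul c"]) (simp_all add: smult_add_left smult_add_right cmul_add_right)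

lemma sum_cmul: "cmul (\<Sum>i\<in>I. c i) f = (\<Sum>i\<in>I. cmul (c i) f)"
  by (simp add: cmul_def fun_eq_iff sum_fun_eval sum_distrib_right)

lemma smult_sum_left: "(\<Sum>i\<in>I. f i) \<star> h = (\<Sum>i\<in>I. f i \<star> h)"
  by (rule sum_hom[of "\<lambda>f. f \<star> h"]) (simp_all add: smult_add_left smult_add_right cmul_add_right)

lemma smult_sum_right: "h \<star> (\<Sum>i\<in>I. f i) = (\<Sum>i\<in>I. h \<star> f i)"
  by (rule sum_hom[of "\<lambda>f. h \<star> f"]) (simp_all add: smult_add_left smult_add_right cmul_add_right)

text \<open>Both sides run over the ordered partitions of \<open>S\<close> into three blocks, and
  both signs count the inversions between different blocks.\<close>

lemma smult_assoc: "(f \<star> g) \<star> h = f \<star> (g \<star> h)"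
proof (intro ext)
  fix p S
  show "(f \<star> g \<star> h) p S = (f \<star> (g \<star> h)) p S"
  proof (cases "finite S")
    case False
    then show ?thesis by (simp add: smult_infinite)
  next
    case fin: True
    have "(f \<star> g \<star> h) p S = (\<Sum>(T, V)\<in>(SIGMA T:Pow S. Pow T).
        mono_sign T (S - T) * mono_sign V (T - V) * f p V * g p (T - V) * h p (S - T))"
      using fin finite_subset[of _ S]
      by (simp add: smult_def sum_distrib_left sum_distrib_right sum.Sigma mult_ac)
    also have "\<dots> = (\<Sum>(V, W)\<in>(SIGMA V:Pow S. Pow (S - V)).
        mono_sign V (S - V) * mono_sign W (S - V - W) * f p V * g p W * h p (S - V - W))"
    proof (rule sum.reindex_bij_witness[of _ "\<lambda>(V, W). (V \<union> W, V)" "\<lambda>(T, V). (V, T - V)"],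
        goal_cases)
      case (5 x)
      then obtain T V where x: "x = (T, V)" "V \<subseteq> T" "T \<subseteq> S" by auto
      then have f: "finite V" "finite T" "finite (S - T)" "finite (T - V)"
        using fin by (auto intro: finite_subset)
      have U1: "V \<union> (T - V) = T" and U2: "S - V = (T - V) \<union> (S - T)"
        and D: "(T - V) \<inter> (S - T) = {}" using x by auto
      have "mono_sign T (S - T) * mono_sign V (T - V)
          = mono_sign V (S - V) * mono_sign (T - V) (S - T)"
        using mono_sign_Un_left[of V "T - V" "S - T", unfolded U1]
          mono_sign_Un_right[of V "T - V" "S - T", folded U2] f D by auto
      moreover have "S - V - (T - V) = S - T" using x by auto
      ultimately show ?case using x by simp
    qed auto
    also have "\<dots> = (f \<star> (g \<star> h)) p S"
      using fin
      by (simp add: smult_def sum_distrib_left sum_distrib_right sum.Sigma mult_ac)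
    finally show ?thesis .
  qed
qed

section \<open>Parity: supercommutativity, the sign automorphism and homogeneous parts\<close>

lemma has_parity_iff: "has_parity e f \<longleftrightarrow> (\<forall>p S. f p S \<noteq> 0 \<longrightarrow> card S mod 2 = e)"
  by (auto simp: has_parity_def spart_def fun_eq_iff)

text \<open>Passing to the complementary subset exchanges the factors. The exchange sign depends on
  \<open>S - T\<close> only through the parity of its size, which \<open>g\<close> fixes as
  \<open>e\<close>, so it turns into \<open>sinv e\<close> applied to \<open>f\<close>.\<close>

lemma smult_commute:
  assumes "has_parity e g"
  shows "f \<star> g = g \<star> sinv e f"
proof (intro ext)
  fix p S
  show "(f \<star> g) p S = (g \<star> sinv e f) p S"
  proof (cases "finite S")
    case fin: True
    show ?thesis unfolding smult_def
    proof (rule sum.reindex_bij_witness[of _ "\<lambda>T. S - T" "\<lambda>T. S - T"], goal_cases)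
      case (5 T)
      then have T: "finite T" "finite (S - T)" "S - (S - T) = T"
        using fin by (auto intro: finite_subset)
      show ?case
      proof (cases "g p (S - T) = 0")
        case False
        then have "card (S - T) mod 2 = e" using assms by (auto simp: has_parity_iff)
        then have "(- 1 :: real) ^ (card T * card (S - T)) = (- 1) ^ (e * card T)"
          using neg_one_power_mod_2[of "card T" "card (S - T)"] by (simp only: mult.commute)
        moreover have "mono_sign T (S - T) = (- 1) ^ (card T * card (S - T)) * mono_sign (S - T) T"
          by (rule mono_sign_commute) (use T in auto)
        ultimately have "mono_sign T (S - T) = (- 1) ^ (e * card T) * mono_sign (S - T) T"
          by (simp only:)
        then show ?thesis unfolding T(3) sinv_def by (simp only: mult_ac)
      next
        case True
        then show ?thesis by simp
      qed
    qed auto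
  qed (simp add: smult_infinite)
qed

lemma sinv_smult: "sinv m (f \<star> g) = sinv m f \<star> sinv m g"
proof (intro ext)
  fix p S
  show "sinv m (f \<star> g) p S = (sinv m f \<star> sinv m g) p S"
  proof (cases "finite S")
    case fin: True
    have "card S = card T + card (S - T)" if "T \<subseteq> S" for T
      using that fin by (metis card_Diff_subset card_mono finite_subset le_add_diff_inverse)
    then have "(- 1) ^ (m * card S) = (- 1) ^ (m * card T) * (- 1 :: real) ^ (m * card (S - T))"
      if "T \<subseteq> S" for T
      using that by (simp flip: power_add add_mult_distrib2)
    then show ?thesis
      by (auto simp: sinv_def smult_def sum_distrib_left mult_ac intro!: sum.cong)
  qed (simp add: smult_infinite sinv_def)
qed

lemma sinv_add [simp]: "sinv m (f + g) = sinv m f + sinv m g"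
  by (simp add: sinv_def fun_eq_iff algebra_simps)
lemma sinv_diff [simp]: "sinv m (f - g) = sinv m f - sinv m g"
  by (simp add: sinv_def fun_eq_iff algebra_simps)
lemma sinv_zero [simp]: "sinv m 0 = 0"
  by (simp add: sinv_def fun_eq_iff)
lemma sinv_0 [simp]: "sinv 0 f = f"
  by (simp add: sinv_def)
lemma sinv_cmul [simp]: "sinv m (cmul c f) = cmul c (sinv m f)"
  by (simp add: sinv_def cmul_def mult_ac)
lemma sinv_sum: "sinv m (\<Sum>i\<in>I. f i) = (\<Sum>i\<in>I. sinv m (f i))"
  by (rule sum_hom[of "sinv m"]) (simp_all add: smult_add_left smult_add_right cmul_add_right)
lemma sinv_sinv [simp]: "sinv m (sinv n f) = sinv (m + n) f"
  by (simp add: sinv_def add_mult_distrib power_add fun_eq_iff)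
lemma sinv_cong: "even (m + n) \<Longrightarrow> sinv m f = sinv n f"
  by (auto simp: sinv_def fun_eq_iff uminus_power_if)
lemma sinv_even: "even m \<Longrightarrow> sinv m f = f"
  using sinv_cong[of m 0 f] by simp

lemma sinv_parity:
  assumes "has_parity e f"
  shows "sinv m f = cmul ((- 1) ^ (m * e)) f"
proof (intro ext)
  fix p S
  show "sinv m f p S = cmul ((- 1) ^ (m * e)) f p S"
  proof (cases "f p S = 0")
    case False
    then have "card S mod 2 = e" using assms by (auto simp: has_parity_iff)
    then have "(- 1 :: real) ^ (m * card S) = (- 1) ^ (m * e)"
      using neg_one_power_mod_2[of m "card S"] by simp
    then show ?thesis by (simp add: sinv_def cmul_def)
  qed (simp add: sinv_def cmul_def)
qed

text \<open>The parity projection as an average over the sign automorphism: what is linear and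
  compatible with \<open>sinv 1\<close> is then compatible with \<open>spart\<close>.\<close>

lemma spart_eq_sinv:
  assumes "e < 2"
  shows "spart e f = cmul (1 / 2) (f + cmul ((- 1) ^ e) (sinv 1 f))"
proof (intro ext)
  fix p :: "ecoord \<Rightarrow> real" and S :: "ocoord set"
  have e: "e = 0 \<or> e = 1" using assms by linarith
  have c: "card S mod 2 = (if even (card S) then 0 else 1)" by presburger
  show "spart e f p S = cmul (1 / 2) (f + cmul ((- 1) ^ e) (sinv 1 f)) p S"
    using e unfolding spart_def cmul_def sinv_def c by (cases "even (card S)") auto
qed

lemma has_parity_spart [simp]: "has_parity e (spart e f)"
  by (simp add: has_parity_def spart_def fun_eq_iff)

lemma spart_add [simp]: "spart e (f + g) = spart e f + spart e g"
  by (auto simp: spart_def fun_eq_iff)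
lemma spart_diff [simp]: "spart e (f - g) = spart e f - spart e g"
  by (auto simp: spart_def fun_eq_iff)
lemma spart_zero [simp]: "spart e 0 = 0"
  by (auto simp: spart_def fun_eq_iff)
lemma spart_cmul [simp]: "spart e (cmul c f) = cmul c (spart e f)"
  by (auto simp: spart_def cmul_def fun_eq_iff)
lemma spart_sum: "spart e (\<Sum>i\<in>I. f i) = (\<Sum>i\<in>I. spart e (f i))"
  by (rule sum_hom[of "spart e"]) (simp_all add: smult_add_left smult_add_right cmul_add_right)

lemma spart_parity:
  assumes "has_parity d f"
  shows "spart e f = (if e = d then f else 0)"
  using assms by (auto simp: has_parity_iff spart_def fun_eq_iff)

lemma sum_lessThan_2: "(\<Sum>e<(2::nat). f e) = f 0 + f 1"
  by (simp add: numeral_2_eq_2)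

lemma spart_decompose: "f = (\<Sum>e<2. spart e f)"
  by (auto simp: sum_lessThan_2 spart_def fun_eq_iff)

lemma has_parity_add: "has_parity e f \<Longrightarrow> has_parity e g \<Longrightarrow> has_parity e (f + g)"
  by (simp add: has_parity_def)
lemma has_parity_diff: "has_parity e f \<Longrightarrow> has_parity e g \<Longrightarrow> has_parity e (f - g)"
  by (simp add: has_parity_def)
lemma has_parity_zero [simp]: "has_parity e 0"
  by (simp add: has_parity_def)
lemma has_parity_cmul: "has_parity e f \<Longrightarrow> has_parity e (cmul c f)"
  by (simp add: has_parity_def)
lemma has_parity_sum: "(\<And>i. i \<in> I \<Longrightarrow> has_parity e (f i)) \<Longrightarrow> has_parity e (\<Sum>i\<in>I. f i)"
  by (simp add: has_parity_def spart_sum)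
lemma has_parity_sinv: "has_parity e f \<Longrightarrow> has_parity e (sinv m f)"
  by (simp add: sinv_parity has_parity_cmul)

lemma has_parity_smult:
  assumes "has_parity d f" "has_parity e g" "c = (d + e) mod 2"
  shows "has_parity c (f \<star> g)"
  unfolding has_parity_iff
proof (intro allI impI)
  fix p S
  assume nz: "(f \<star> g) p S \<noteq> 0"
  then have fin: "finite S" using smult_infinite by blast
  obtain T where T: "T \<subseteq> S" "f p T \<noteq> 0" "g p (S - T) \<noteq> 0"
  proof -
    from nz obtain T where "T \<in> Pow S" "mono_sign T (S - T) * f p T * g p (S - T) \<noteq> 0"
      unfolding smult_def by (rule sum.not_neutral_contains_not_neutral)
    then show ?thesis using that by auto
  qed
  then have "card S = card T + card (S - T)"
    using fin by (metis card_Diff_subset card_mono finite_subset le_add_diff_inverse)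
  moreover have "card T mod 2 = d" "card (S - T) mod 2 = e"
    using T assms(1,2) unfolding has_parity_iff by blast+
  ultimately show "card S mod 2 = c"
    using assms(3) by (metis mod_add_eq)
qed

lemma has_parity_coord_fun: "has_parity (cpar A) (coord_fun A)"
  by (cases A) (auto simp: has_parity_iff)

lemma spart_smult_right:
  assumes "has_parity d g" "d < 2" "e < 2"
  shows "spart e (f \<star> g) = spart ((e + d) mod 2) f \<star> g"
proof -
  have *: "(e + d) mod 2 < 2" by simp
  have sgn: "(- 1 :: real) ^ ((e + d) mod 2) = (- 1) ^ e * (- 1) ^ d"
    using neg_one_power_mod_2[of 1 "e + d"] by (simp add: power_add)
  show ?thesis
    unfolding spart_eq_sinv[OF assms(3)] spart_eq_sinv[OF *] sgn
    by (simp add: sinv_smult sinv_parity[OF assms(1)] smult_add_left mult.commute)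
qed

lemma spart_smult_left:
  assumes "has_parity d f" "d < 2" "e < 2"
  shows "spart e (f \<star> g) = f \<star> spart ((e + d) mod 2) g"
proof -
  have *: "(e + d) mod 2 < 2" by simp
  have sgn: "(- 1 :: real) ^ ((e + d) mod 2) = (- 1) ^ e * (- 1) ^ d"
    using neg_one_power_mod_2[of 1 "e + d"] by (simp add: power_add)
  show ?thesis
    unfolding spart_eq_sinv[OF assms(3)] spart_eq_sinv[OF *] sgn
    by (simp add: sinv_smult sinv_parity[OF assms(1)] smult_add_right mult.commute)
qed

section \<open>Smooth functions and the symmetry of mixed partial derivatives\<close>

lemma smooth_continuous: "smooth h \<Longrightarrow> continuous_on UNIV h"
  unfolding smooth_def by (metis foldr.simps(1) id_apply)

lemma smooth_pdiff: 
  assumes "smooth h"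
  shows "smooth (pdiff e h)"
  unfolding smooth_def
proof
  fix es
  have "foldr pdiff es (pdiff e h) = foldr pdiff (es @ [e]) h" by simp
  then show "continuous_on UNIV (foldr pdiff es (pdiff e h)) \<and>
      (\<forall>e' p. (\<lambda>s. foldr pdiff es (pdiff e h) (p(e' := s))) differentiable (at (p e')))"
    using assms unfolding smooth_def by metis
qed

lemma smooth_differentiable:
  assumes "smooth h"
  shows "(\<lambda>s. h (p(e := s))) differentiable (at x)"
proof -
  have "(\<lambda>s. foldr pdiff [] h ((p(e := x))(e := s))) differentiable (at ((p(e := x)) e))"
    using assms unfolding smooth_def by blast
  then show ?thesis by simp
qed

lemma DERIV_pdiff:
  assumes "(\<lambda>s. h (p(e := s))) differentiable (at x)"
  shows "DERIV (\<lambda>s. h (p(e := s))) x :> pdiff e h (p(e := x))"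
  using assms unfolding pdiff_def by (simp add: DERIV_deriv_iff_real_differentiable)

lemma pdiff_eqI:
  assumes "\<And>p. DERIV (\<lambda>s. h (p(e := s))) (p e) :> h' p"
  shows "pdiff e h = h'"
  unfolding pdiff_def using assms by (simp add: DERIV_imp_deriv fun_eq_iff)

lemma pdiff_const [simp]: "pdiff e (\<lambda>p. c) = (\<lambda>p. 0)"
  by (rule pdiff_eqI) simp

lemma pdiff_coord: "pdiff e (\<lambda>p. p e') = (\<lambda>p. if e = e' then 1 else 0)"
  by (rule pdiff_eqI) auto

text \<open>Closed under \<open>pdiff\<close> by the Leibniz rule, hence consisting of smooth functions.\<close>

inductive_set smooth_alg :: "((ecoord \<Rightarrow> real) \<Rightarrow> real) set" where
  base: "smooth h \<Longrightarrow> h \<in> smooth_alg"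
| const: "(\<lambda>p. c) \<in> smooth_alg"
| coord: "(\<lambda>p. p e) \<in> smooth_alg"
| add: "f \<in> smooth_alg \<Longrightarrow> g \<in> smooth_alg \<Longrightarrow> (\<lambda>p. f p + g p) \<in> smooth_alg"
| mult: "f \<in> smooth_alg \<Longrightarrow> g \<in> smooth_alg \<Longrightarrow> (\<lambda>p. f p * g p) \<in> smooth_alg"

lemma smooth_alg_differentiable:
  assumes "h \<in> smooth_alg"
  shows "(\<lambda>s. h (p(e := s))) differentiable (at x)"
  using assms
proof induction
  case (base h)
  then show ?case by (rule smooth_differentiable)
next
  case (coord e')
  show ?case by (cases "e = e'") auto
next
  case (add f g)
  from add.IH show ?case by (rule differentiable_add)
next
  case (mult f g)
  from mult.IH show ?case by (rule differentiable_mult)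
qed simp

lemma DERIV_pdiff_alg:
  assumes "h \<in> smooth_alg"
  shows "DERIV (\<lambda>s. h (p(e := s))) (p e) :> pdiff e h p"
  using DERIV_pdiff[OF smooth_alg_differentiable[OF assms], of p e "p e"] by (simp only: fun_upd_triv)

lemma pdiff_add_alg:
  assumes "f \<in> smooth_alg" "g \<in> smooth_alg"
  shows "pdiff e (\<lambda>p. f p + g p) = (\<lambda>p. pdiff e f p + pdiff e g p)"
proof (rule pdiff_eqI)
  fix p
  show "DERIV (\<lambda>s. f (p(e := s)) + g (p(e := s))) (p e) :> pdiff e f p + pdiff e g p"
    using DERIV_add[OF DERIV_pdiff_alg[OF assms(1), of p] DERIV_pdiff_alg[OF assms(2), of p]] .
qed

lemma pdiff_mult_alg:
  assumes "f \<in> smooth_alg" "g \<in> smooth_alg"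
  shows "pdiff e (\<lambda>p. f p * g p) = (\<lambda>p. pdiff e f p * g p + f p * pdiff e g p)"
proof (rule pdiff_eqI)
  fix p
  show "DERIV (\<lambda>s. f (p(e := s)) * g (p(e := s))) (p e) :> pdiff e f p * g p + f p * pdiff e g p"
    using DERIV_mult[OF DERIV_pdiff_alg[OF assms(1), of p] DERIV_pdiff_alg[OF assms(2), of p]] by (simp add: mult.commute)
qed

lemma smooth_alg_pdiff: "h \<in> smooth_alg \<Longrightarrow> pdiff e h \<in> smooth_alg"
proof (induction rule: smooth_alg.induct)
  case (coord e')
  then show ?case by (cases "e = e'") (auto simp: pdiff_coord intro: smooth_alg.const)
qed (simp_all add: pdiff_add_alg pdiff_mult_alg smooth_pdiff smooth_alg.intros)

lemma smooth_alg_continuous: "h \<in> smooth_alg \<Longrightarrow> continuous_on UNIV h"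
proof (induction rule: smooth_alg.induct)
  case (coord e)
  show ?case by (rule continuous_on_product_coordinates)
qed (simp_all add: smooth_continuous continuous_on_add continuous_on_mult)

lemma smooth_alg_smooth:
  assumes "h \<in> smooth_alg"
  shows "smooth h"
proof -
  have "foldr pdiff es h \<in> smooth_alg" for es
    by (induction es) (auto simp: assms smooth_alg_pdiff)
  then show ?thesis
    unfolding smooth_def by (blast intro: smooth_alg_continuous smooth_alg_differentiable)
qed

lemma smooth_const [simp]: "smooth (\<lambda>p. c)"
  by (rule smooth_alg_smooth[OF smooth_alg.const])
lemma smooth_coord [simp]: "smooth (\<lambda>p. p e)"
  by (rule smooth_alg_smooth[OF smooth_alg.coord])
lemma smooth_add: "smooth f \<Longrightarrow> smooth g \<Longrightarrow> smooth (\<lambda>p. f p + g p)"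
  by (rule smooth_alg_smooth[OF smooth_alg.add[OF smooth_alg.base smooth_alg.base]])
lemma smooth_mult: "smooth f \<Longrightarrow> smooth g \<Longrightarrow> smooth (\<lambda>p. f p * g p)"
  by (rule smooth_alg_smooth[OF smooth_alg.mult[OF smooth_alg.base smooth_alg.base]])
lemma smooth_sum: "(\<And>i. i \<in> I \<Longrightarrow> smooth (f i)) \<Longrightarrow> smooth (\<lambda>p. \<Sum>i\<in>I. f i p)"
  by (induction I rule: infinite_finite_induct) (auto intro: smooth_add)

lemma pdiff_add: "smooth f \<Longrightarrow> smooth g \<Longrightarrow> pdiff e (\<lambda>p. f p + g p) = (\<lambda>p. pdiff e f p + pdiff e g p)"
  by (simp add: pdiff_add_alg smooth_alg.base)
lemma pdiff_mult: "smooth f \<Longrightarrow> smooth g \<Longrightarrow>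
    pdiff e (\<lambda>p. f p * g p) = (\<lambda>p. pdiff e f p * g p + f p * pdiff e g p)"
  by (simp add: pdiff_mult_alg smooth_alg.base)
lemma pdiff_cmult: "smooth f \<Longrightarrow> pdiff e (\<lambda>p. c * f p) = (\<lambda>p. c * pdiff e f p)"
  by (simp add: pdiff_mult)
lemma pdiff_sum:
  "(\<And>i. i \<in> I \<Longrightarrow> smooth (f i)) \<Longrightarrow> pdiff e (\<lambda>p. \<Sum>i\<in>I. f i p) = (\<lambda>p. \<Sum>i\<in>I. pdiff e (f i) p)"
  by (induction I rule: infinite_finite_induct) (auto simp: pdiff_add smooth_sum)

lemma DERIV_pdiff_smooth:
  "smooth h \<Longrightarrow> DERIV (\<lambda>s. h (p(e := s))) x :> pdiff e h (p(e := x))"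
  by (simp add: DERIV_pdiff smooth_differentiable)

text \<open>
  The left-hand side is symmetric under exchanging \<open>(e, a)\<close> and \<open>(e', b)\<close>, so that letting \<open>k\<close> tend
  to 0 gives the equality of the mixed partial derivatives.
\<close>

lemma second_difference:
  assumes h: "smooth h" and ne: "e \<noteq> e'" and k: "0 < k"
  shows "\<exists>s t. a < s \<and> s < a + k \<and> b < t \<and> t < b + k \<and>
    h (p(e := a + k, e' := b + k)) - h (p(e := a + k, e' := b))
      - h (p(e := a, e' := b + k)) + h (p(e := a, e' := b))
    = k * k * pdiff e' (pdiff e h) (p(e := s, e' := t))"
proof -
  let ?g = "\<lambda>s. h (p(e := s, e' := b + k)) - h (p(e := s, e' := b))"
  let ?g' = "\<lambda>s. pdiff e h (p(e := s, e' := b + k)) - pdiff e h (p(e := s, e' := b))"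
  have "DERIV ?g s :> ?g' s" for s
    using DERIV_diff[OF DERIV_pdiff_smooth[OF h, of "p(e' := b + k)" e s]
        DERIV_pdiff_smooth[OF h, of "p(e' := b)" e s]] ne
    by (simp add: fun_upd_twist)
  then obtain s where s: "a < s" "s < a + k" "?g (a + k) - ?g a = k * ?g' s"
    using MVT2[of a "a + k" ?g ?g'] k by auto
  obtain t where t: "b < t" "t < b + k" "?g' s = k * pdiff e' (pdiff e h) (p(e := s, e' := t))"
    using MVT2[of b "b + k" "\<lambda>t. pdiff e h (p(e := s, e' := t))"
        "\<lambda>t. pdiff e' (pdiff e h) (p(e := s, e' := t))"] k
      DERIV_pdiff_smooth[OF smooth_pdiff[OF h]] by auto
  show ?thesis
    using s t by (intro exI[of _ s] exI[of _ t]) (simp add: algebra_simps)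
qed

text \<open>In the product topology the plane through \<open>p\<close> in the two directions is
  parametrised continuously, coordinate by coordinate, so the continuity contained in
  \<open>smooth\<close> restricts to it.\<close>

lemma tendsto_plane:
  fixes x y :: "nat \<Rightarrow> real"
  assumes "smooth h" "x \<longlonglongrightarrow> p e" "y \<longlonglongrightarrow> p e'" 
  shows "(\<lambda>n. h (p(e := x n, e' := y n))) \<longlonglongrightarrow> h p"
proof -
  let ?F = "\<lambda>z :: real \<times> real. h (p(e := fst z, e' := snd z))"
  have "continuous_on UNIV (\<lambda>z :: real \<times> real. p(e := fst z, e' := snd z))"
  proof (rule continuous_on_coordinatewise_then_product)
    fix i
    show "continuous_on UNIV (\<lambda>z :: real \<times> real. (p(e := fst z, e' := snd z)) i)"
      by (cases "i = e'"; cases "i = e") (auto intro!: continuous_intros)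
  qed
  then have "continuous_on UNIV ?F"
    by (rule continuous_on_compose2[OF smooth_continuous[OF assms(1)]]) auto
  then have "isCont ?F (p e, p e')"
    by (simp add: continuous_on_eq_continuous_at)
  then have "(\<lambda>n. ?F (x n, y n)) \<longlonglongrightarrow> ?F (p e, p e')"
    by (rule isCont_tendsto_compose) (intro tendsto_Pair assms)
  then show ?thesis by simp
qed

lemma pdiff_commute:
  assumes h: "smooth h"
  shows "pdiff e (pdiff e' h) = pdiff e' (pdiff e h)"
proof (cases "e = e'")
  case ne: False
  show ?thesis
  proof
    fix p
    define k where "k n = inverse (real (Suc n))" for n
    have k: "0 < k n" for n by (simp add: k_def)
    have k0: "k \<longlonglongrightarrow> 0" unfolding k_def by (rule LIMSEQ_inverse_real_of_nat)
    have squeeze: "x \<longlonglongrightarrow> a" if "\<And>n. a < x n \<and> x n < a + k n" for x and a :: real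
    proof (rule tendsto_sandwich[of "\<lambda>n. a" x _ "\<lambda>n. a + k n"])
      show "(\<lambda>n. a + k n) \<longlonglongrightarrow> a" using tendsto_add[OF tendsto_const k0, of a] by simp
    qed (use that in \<open>auto intro!: always_eventually less_imp_le\<close>)
    let ?D = "\<lambda>n. h (p(e := p e + k n, e' := p e' + k n)) - h (p(e := p e + k n, e' := p e'))
      - h (p(e := p e, e' := p e' + k n)) + h (p(e := p e, e' := p e'))"
    have "\<exists>s t. p e < s \<and> s < p e + k n \<and> p e' < t \<and> t < p e' + k n \<and>
      ?D n = k n * k n * pdiff e' (pdiff e h) (p(e := s, e' := t))" for n
      using second_difference[OF h ne k] .
    then obtain s t where st: "\<And>n. p e < s n \<and> s n < p e + k n" "\<And>n. p e' < t n \<and> t n < p e' + k n"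
      "\<And>n. ?D n = k n * k n * pdiff e' (pdiff e h) (p(e := s n, e' := t n))" by metis
    \<comment> \<open>The same difference \<open>?D n\<close> with the two directions exchanged
      yields a second intermediate point.\<close>
    have "\<exists>t s. p e' < t \<and> t < p e' + k n \<and> p e < s \<and> s < p e + k n \<and>
      ?D n = k n * k n * pdiff e (pdiff e' h) (p(e' := t, e := s))" for n
      using second_difference[OF h ne[symmetric] k, of "p e'" n "p e" p] ne
      by (simp add: fun_upd_twist algebra_simps)
    then obtain t' s' where st': "\<And>n. p e' < t' n \<and> t' n < p e' + k n"
      "\<And>n. p e < s' n \<and> s' n < p e + k n"
      "\<And>n. ?D n = k n * k n * pdiff e (pdiff e' h) (p(e' := t' n, e := s' n))" by metis
    have "pdiff e' (pdiff e h) (p(e := s n, e' := t n)) = pdiff e (pdiff e' h) (p(e' := t' n, e := s' n))" for n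
      using st(3)[of n] st'(3)[of n] k[of n] by auto
    moreover have "(\<lambda>n. pdiff e' (pdiff e h) (p(e := s n, e' := t n))) \<longlonglongrightarrow> pdiff e' (pdiff e h) p"
      using h squeeze st by (intro tendsto_plane smooth_pdiff) auto
    moreover have "(\<lambda>n. pdiff e (pdiff e' h) (p(e' := t' n, e := s' n))) \<longlonglongrightarrow> pdiff e (pdiff e' h) p"
      using h squeeze st' by (intro tendsto_plane smooth_pdiff) auto
    ultimately show "pdiff e (pdiff e' h) p = pdiff e' (pdiff e h) p"
      using LIMSEQ_unique by fastforce
  qed
qed simp

section \<open>The algebra of superfunctions and its partial derivatives\<close>

lemma sum_closed:
  fixes X :: "'a::comm_monoid_add set"
  assumes "0 \<in> X" "\<And>x y. x \<in> X \<Longrightarrow> y \<in> X \<Longrightarrow> x + y \<in> X" "\<And>i. i \<in> I \<Longrightarrow> f i \<in> X"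
  shows "(\<Sum>i\<in>I. f i) \<in> X"
  using assms(3) by (induction I rule: infinite_finite_induct) (auto simp: assms(1,2))

text \<open>A relative version of \<open>sum_hom\<close>: additivity of \<open>deriv\<close> needs
  differentiability, so partial derivatives and everything built from them are treated as additive
  on \<open>Cinf A\<close> only.\<close>

lemma sum_hom_on:
  fixes F :: "'a::comm_monoid_add \<Rightarrow> 'b::comm_monoid_add"
  assumes "0 \<in> X" "\<And>x y. x \<in> X \<Longrightarrow> y \<in> X \<Longrightarrow> x + y \<in> X"
    and "F 0 = 0" "\<And>x y. x \<in> X \<Longrightarrow> y \<in> X \<Longrightarrow> F (x + y) = F x + F y"
    and "\<And>i. i \<in> I \<Longrightarrow> f i \<in> X"
  shows "F (\<Sum>i\<in>I. f i) = (\<Sum>i\<in>I. F (f i))"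
  using assms(5)
  by (induction I rule: infinite_finite_induct) (auto simp: assms(1-4) sum_closed[OF assms(1,2)])

lemma CinfI:
  assumes "B \<subseteq> A" "finite B"
    "\<And>p q S. (\<And>e. Inl e \<in> B \<Longrightarrow> p e = q e) \<Longrightarrow> f p S = f q S"
    "\<And>p S. f p S \<noteq> 0 \<Longrightarrow> Inr ` S \<subseteq> B"
    "\<And>S. smooth (\<lambda>p. f p S)"
  shows "f \<in> Cinf A"
  unfolding Cinf_def depends_only_def mem_Collect_eq using assms by metis

lemma Cinf_smooth: "f \<in> Cinf A \<Longrightarrow> smooth (\<lambda>p. f p S)"
  by (simp add: Cinf_def)

lemma CinfE:
  assumes "f \<in> Cinf A"
  obtains B where "B \<subseteq> A" "finite B" "depends_only B f"
  using assms unfolding Cinf_def by blast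

lemma depends_only_eq:
  "depends_only B f \<Longrightarrow> (\<And>e. Inl e \<in> B \<Longrightarrow> p e = q e) \<Longrightarrow> f p S = f q S"
  unfolding depends_only_def by blast

lemma depends_only_supp: "depends_only B f \<Longrightarrow> f p S \<noteq> 0 \<Longrightarrow> Inr ` S \<subseteq> B"
  unfolding depends_only_def by blast

lemma Cinf_mono: "f \<in> Cinf A \<Longrightarrow> A \<subseteq> A' \<Longrightarrow> f \<in> Cinf A'"
  unfolding Cinf_def by blast

text \<open>Only finitely many odd coordinates occur, so every monomial is a finite product. Where
  \<open>card\<close> or the product degenerates on infinite sets, this makes both sides of an
  identity vanish.\<close>

lemma Cinf_infinite:
  assumes "f \<in> Cinf A" "infinite S"
  shows "f p S = 0"
proof (rule ccontr)
  assume nz: "f p S \<noteq> 0"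
  obtain B where "finite B" "depends_only B f"
    using assms(1) by (rule CinfE)
  then have "Inr ` S \<subseteq> B" using depends_only_supp[of B f p S] nz by simp
  then have "finite (Inr ` S :: coord set)" using \<open>finite B\<close> finite_subset by blast
  then show False using assms(2) by (simp add: finite_image_iff)
qed

text \<open>The factor may vary with the monomial but not with the point; this covers
  \<open>cmul\<close>, \<open>sinv\<close> and \<open>spart\<close> at once.\<close>

lemma Cinf_pointwise:
  assumes "f \<in> Cinf A" "\<And>S. \<exists>c. \<forall>p. g p S = c * f p S"
  shows "g \<in> Cinf A"
proof -
  obtain c where g: "g p S = c S * f p S" for p S using assms(2) by metis
  obtain B where B0: "B \<subseteq> A" "finite B" "depends_only B f"
    using assms(1) by (rule CinfE)
  note B = B0(1,2) depends_only_eq[OF B0(3)] depends_only_supp[OF B0(3)]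
  show ?thesis
  proof (rule CinfI[OF B(1,2)])
    show "g p S = g q S" if "\<And>e. Inl e \<in> B \<Longrightarrow> p e = q e" for p q S
      using B(3)[of p q S] that by (simp add: g)
    show "Inr ` S \<subseteq> B" if "g p S \<noteq> 0" for p S
      using that by (intro B(4)[of p S]) (auto simp: g)
    show "smooth (\<lambda>p. g p S)" for S
      unfolding g by (intro smooth_mult smooth_const Cinf_smooth[OF assms(1)])
  qed
qed

lemma Cinf_zero [simp]: "0 \<in> Cinf A"
  by (rule CinfI[of "{}"]) (simp_all add: zero_fun_def)

lemma Cinf_sconst [simp]: "sconst c \<in> Cinf A"
  by (rule CinfI[of "{}"]) (auto simp: sconst_def split: if_splits)

lemma Cinf_coord_fun:
  assumes "z \<in> A"
  shows "coord_fun z \<in> Cinf A"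
proof (cases z)
  case (Inl e)
  show ?thesis
  proof (rule CinfI[of "{z}"])
    show "smooth (\<lambda>p. coord_fun z p S)" for S by (cases "S = {}") (simp_all add: Inl)
  qed (use assms in \<open>auto simp: Inl split: if_splits\<close>)
next
  case (Inr o')
  show ?thesis
  proof (rule CinfI[of "{z}"])
    show "smooth (\<lambda>p. coord_fun z p S)" for S by (simp add: Inr)
  qed (use assms in \<open>auto simp: Inr split: if_splits\<close>)
qed

lemma Cinf_cmul: "f \<in> Cinf A \<Longrightarrow> cmul c f \<in> Cinf A"
  by (erule Cinf_pointwise) (auto simp: cmul_def)

lemma Cinf_sinv: "f \<in> Cinf A \<Longrightarrow> sinv m f \<in> Cinf A"
  by (erule Cinf_pointwise) (auto simp: sinv_def)

lemma Cinf_spart: 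
  assumes "f \<in> Cinf A"
  shows "spart e f \<in> Cinf A"
proof (rule Cinf_pointwise[OF assms])
  fix S :: "ocoord set"
  show "\<exists>c. \<forall>p. spart e f p S = c * f p S"
    by (intro exI[of _ "if card S mod 2 = e then 1 else 0"]) (simp add: spart_def)
qed

lemma Cinf_add:
  assumes "f \<in> Cinf A" "g \<in> Cinf A"
  shows "f + g \<in> Cinf A"
proof -
  obtain B where B0: "B \<subseteq> A" "finite B" "depends_only B f"
    using assms(1) by (rule CinfE)
  note B = B0(1,2) depends_only_eq[OF B0(3)] depends_only_supp[OF B0(3)]
  obtain C where C0: "C \<subseteq> A" "finite C" "depends_only C g"
    using assms(2) by (rule CinfE)
  note C = C0(1,2) depends_only_eq[OF C0(3)] depends_only_supp[OF C0(3)]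
  show ?thesis
  proof (rule CinfI[of "B \<union> C"])
    show "(f + g) p S = (f + g) q S" if "\<And>e. Inl e \<in> B \<union> C \<Longrightarrow> p e = q e" for p q S
      using B(3)[of p q S] C(3)[of p q S] that by simp
    show "Inr ` S \<subseteq> B \<union> C" if "(f + g) p S \<noteq> 0" for p S
    proof -
      have "f p S \<noteq> 0 \<or> g p S \<noteq> 0" using that by auto
      then show ?thesis using B(4)[of p S] C(4)[of p S] by blast
    qed
    show "smooth (\<lambda>p. (f + g) p S)" for S
      unfolding plus_fun_apply by (intro smooth_add Cinf_smooth[OF assms(1)] Cinf_smooth[OF assms(2)])
  qed (use B0 C0 in auto)
qed

lemma Cinf_minus: 
  assumes "f \<in> Cinf A" 
  shows "- f \<in> Cinf A"
  using Cinf_cmul[OF assms, of "- 1"] by (simp add: cmul_minus_one)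

lemma Cinf_diff: "f \<in> Cinf A \<Longrightarrow> g \<in> Cinf A \<Longrightarrow> f - g \<in> Cinf A"
  using Cinf_add[OF _ Cinf_minus, of f A g] by simp

lemma Cinf_sum: "(\<And>i. i \<in> I \<Longrightarrow> f i \<in> Cinf A) \<Longrightarrow> (\<Sum>i\<in>I. f i) \<in> Cinf A"
  by (rule sum_closed) (auto intro: Cinf_add)

lemma Cinf_smult:
  assumes "f \<in> Cinf A" "g \<in> Cinf A"
  shows "f \<star> g \<in> Cinf A"
proof -
  obtain B where B0: "B \<subseteq> A" "finite B" "depends_only B f"
    using assms(1) by (rule CinfE)
  note B = B0(1,2) depends_only_eq[OF B0(3)] depends_only_supp[OF B0(3)]
  obtain C where C0: "C \<subseteq> A" "finite C" "depends_only C g"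
    using assms(2) by (rule CinfE)
  note C = C0(1,2) depends_only_eq[OF C0(3)] depends_only_supp[OF C0(3)]
  show ?thesis
  proof (rule CinfI[of "B \<union> C"])
    show "(f \<star> g) p S = (f \<star> g) q S" if "\<And>e. Inl e \<in> B \<union> C \<Longrightarrow> p e = q e" for p q S
    proof -
      have "f p T = f q T" "g p T = g q T" for T
        using B(3)[of p q T] C(3)[of p q T] that by auto
      then show ?thesis by (simp add: smult_def)
    qed
    show "Inr ` S \<subseteq> B \<union> C" if nz: "(f \<star> g) p S \<noteq> 0" for p S
    proof -
      from nz obtain T where "T \<in> Pow S" "mono_sign T (S - T) * f p T * g p (S - T) \<noteq> 0"
        unfolding smult_def by (rule sum.not_neutral_contains_not_neutral)
      then have "Inr ` T \<subseteq> B" "Inr ` (S - T) \<subseteq> C" "S = T \<union> (S - T)"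
        using B(4)[of p T] C(4)[of p "S - T"] by auto
      then show ?thesis by blast
    qed
    show "smooth (\<lambda>p. (f \<star> g) p S)" for S
      unfolding smult_def
      by (intro smooth_sum smooth_mult smooth_const Cinf_smooth[OF assms(1)] Cinf_smooth[OF assms(2)])
  qed (use B0 C0 in auto)
qed

lemma sconst_smult [simp]:
  assumes "f \<in> Cinf A"
  shows "sconst c \<star> f = cmul c f"
proof (intro ext)
  fix p S
  show "(sconst c \<star> f) p S = cmul c f p S"
  proof (cases "finite S")
    case True
    have "(sconst c \<star> f) p S
        = (\<Sum>T\<in>{{}}. mono_sign T (S - T) * sconst c p T * f p (S - T))"
      unfolding smult_def by (rule sum.mono_neutral_right) (auto simp: True sconst_def)
    then show ?thesis by (simp add: sconst_def cmul_def)
  qed (simp add: smult_infinite cmul_def Cinf_infinite[OF assms])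
qed

lemma sconst_0 [simp]: "sconst 0 = 0"
  by (simp add: sconst_def fun_eq_iff)

lemma has_parity_sconst [simp]: "has_parity 0 (sconst c)"
  by (auto simp: has_parity_iff sconst_def)

section \<open>Left partial derivatives on \<open>Cinf\<close>\<close>

lemma pdiff_eq_0:
  assumes "\<And>p s. h (p(e := s)) = h p"
  shows "pdiff e h = (\<lambda>p. 0)"
  by (rule pdiff_eqI) (simp add: assms)

text \<open>All three claims come from one finite set \<open>B\<close> of coordinates on which
  \<open>f\<close> depends: a derivative by a coordinate outside \<open>B\<close> is 0.\<close>

lemma Cinf_pd_outside:
  assumes "f \<in> Cinf A" 
  shows "pd z f \<in> Cinf A" and "z \<notin> A \<Longrightarrow> pd z f = 0" and "finite {z. pd z f \<noteq> 0}"
proof -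
  obtain B where B0: "B \<subseteq> A" "finite B" "depends_only B f"
    using assms(1) by (rule CinfE)
  note B = B0(1,2) depends_only_eq[OF B0(3)] depends_only_supp[OF B0(3)]
  have out: "pd z f = 0" if "z \<notin> B" for z
  proof (cases z)
    case (Inl e)
    have "pdiff e (\<lambda>q. f q S) = (\<lambda>p. 0)" for S
      using that by (intro pdiff_eq_0 B(3)) (auto simp: Inl)
    then show ?thesis by (simp add: Inl fun_eq_iff)
  next
    case (Inr o')
    have "f p (insert o' S) = 0" for p S
      using B(4)[of p "insert o' S"] that Inr by auto
    then show ?thesis by (simp add: Inr fun_eq_iff)
  qed
  then show "z \<notin> A \<Longrightarrow> pd z f = 0" using B(1) by blast
  have "{z. pd z f \<noteq> 0} \<subseteq> B" using out by auto
  then show "finite {z. pd z f \<noteq> 0}" using B(2) finite_subset by blast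
  show "pd z f \<in> Cinf A"
  proof (cases "z \<in> B")
    case True
    \<comment> \<open>The set \<open>B\<close> serves again: as \<open>z\<close> lies in
      \<open>B\<close>, points that agree on \<open>B\<close> also agree in the coordinate at which
      an even derivative is evaluated.\<close>
    show ?thesis
    proof (rule CinfI[OF B(1,2)])
      show "pd z f p S = pd z f q S" if pq: "\<And>e. Inl e \<in> B \<Longrightarrow> p e = q e" for p q S
      proof (cases z)
        case (Inl e)
        have "f (p(e := s)) S = f (q(e := s)) S" for s
          by (rule B(3)) (use pq in auto)
        moreover have "p e = q e" using pq True Inl by auto
        ultimately show ?thesis by (simp add: Inl pdiff_def)
      next
        case (Inr o')
        have "f p (insert o' S) = f q (insert o' S)" by (rule B(3)) (use pq in auto)
        then show ?thesis by (simp add: Inr)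
      qed
      show "Inr ` S \<subseteq> B" if nz: "pd z f p S \<noteq> 0" for p S
      proof (cases z)
        case (Inl e)
        have "\<not> (\<forall>p. f p S = 0)"
        proof
          assume "\<forall>p. f p S = 0"
          then have "pdiff e (\<lambda>q. f q S) = (\<lambda>p. 0)" by simp
          then show False using nz by (simp add: Inl)
        qed
        then show ?thesis using B(4) by blast
      next
        case (Inr o')
        then have "f p (insert o' S) \<noteq> 0" using nz by (auto split: if_splits)
        then show ?thesis using B(4)[of p "insert o' S"] by auto
      qed
      show "smooth (\<lambda>p. pd z f p S)" for S
      proof (cases z)
        case (Inl e)
        show ?thesis using smooth_pdiff[OF Cinf_smooth[OF assms], of e S] by (simp add: Inl)
      next
        case (Inr o')
        show ?thesis
        proof (cases "o' \<in> S")
          case False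
          then show ?thesis unfolding Inr pd.simps if_not_P[OF False]
            by (intro smooth_mult smooth_const Cinf_smooth[OF assms])
        qed (simp add: Inr)
      qed
    qed
  qed (simp add: out)
qed

lemmas Cinf_pd = Cinf_pd_outside(1)
lemmas pd_outside = Cinf_pd_outside(2)
lemmas finite_pd = Cinf_pd_outside(3)

lemma pd_zero [simp]: "pd z 0 = 0"
  by (cases z) (simp_all add: fun_eq_iff)

lemma pd_add:
  assumes "f \<in> Cinf A" "g \<in> Cinf B"
  shows "pd z (f + g) = pd z f + pd z g"
proof (cases z)
  case (Inl e)
  show ?thesis using pdiff_add[OF Cinf_smooth[OF assms(1)] Cinf_smooth[OF assms(2)]]
    by (simp add: Inl fun_eq_iff)
qed (simp add: fun_eq_iff algebra_simps)

lemma pd_cmul: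
  assumes "f \<in> Cinf A"
  shows "pd z (cmul c f) = cmul c (pd z f)"
proof (cases z)
  case (Inl e)
  show ?thesis using pdiff_cmult[OF Cinf_smooth[OF assms]]
    by (simp add: Inl fun_eq_iff cmul_def)
qed (simp add: fun_eq_iff cmul_def)

lemma pd_sum:
  assumes "\<And>i. i \<in> I \<Longrightarrow> f i \<in> Cinf A"
  shows "pd z (\<Sum>i\<in>I. f i) = (\<Sum>i\<in>I. pd z (f i))"
  by (rule sum_hom_on[of "Cinf A" "pd z"]) (auto simp: assms pd_add intro: Cinf_add)

lemma pd_sconst [simp]: "pd z (sconst c) = 0"
  by (cases z) (auto simp: sconst_def fun_eq_iff)

lemma pd_coord_fun: "pd z (coord_fun z') = sconst (if z = z' then 1 else 0)"
proof (intro ext)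
  fix p S
  show "pd z (coord_fun z') p S = sconst (if z = z' then 1 else 0) p S"
  proof (cases z')
    case (Inl e)
    show ?thesis
      by (cases z; cases "S = {}") (auto simp: Inl sconst_def pdiff_coord)
  next
    case (Inr o')
    show ?thesis
      by (cases z) (auto simp: Inr sconst_def insert_eq_iff)
  qed
qed

text \<open>An odd derivative lowers the degree of a monomial by one, which is the source of the
  sign. On an infinite set \<open>card\<close> is 0, and the identity holds there because
  \<open>f\<close> vanishes.\<close>

lemma pd_sinv:
  assumes "f \<in> Cinf A"
  shows "pd z (sinv m f) = cmul ((- 1) ^ (m * cpar z)) (sinv m (pd z f))"
proof (cases z)
  case (Inl e)
  show ?thesis using pdiff_cmult[OF Cinf_smooth[OF assms]]
    by (simp add: Inl fun_eq_iff cmul_def sinv_def)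
next
  case (Inr o')
  show ?thesis
  proof (intro ext)
    fix p S
    show "pd z (sinv m f) p S = cmul ((- 1) ^ (m * cpar z)) (sinv m (pd z f)) p S"
    proof (cases "finite S")
      case True
      then show ?thesis
        by (auto simp: Inr sinv_def cmul_def power_add algebra_simps)
    next
      case False
      then show ?thesis
        by (simp add: Inr sinv_def cmul_def Cinf_infinite[OF assms])
    qed
  qed
qed

lemma cpar_less_2 [simp]: "cpar z < 2"
  by (cases z) auto

text \<open>Homogeneity as an eigenvalue condition for the sign automorphism, a form that is easy to
  carry through a derivative.\<close>

lemma has_parity_sinv_iff:
  assumes "e < 2"
  shows "has_parity e f \<longleftrightarrow> sinv 1 f = cmul ((- 1) ^ e) f"
proof
  assume s: "sinv 1 f = cmul ((- 1) ^ e) f"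
  show "has_parity e f"
    unfolding has_parity_def spart_eq_sinv[OF assms] s
    by (simp add: flip: power_add) (simp add: cmul_def fun_eq_iff)
qed (simp add: sinv_parity)

lemma has_parity_pd:
  assumes "f \<in> Cinf A" "has_parity e f" "d = (e + cpar z) mod 2"
  shows "has_parity d (pd z f)"
proof -
  have "sinv 1 (pd z f) = cmul ((- 1) ^ cpar z) (pd z (sinv 1 f))"
    using pd_sinv[OF assms(1), of z 1] by (simp flip: power_add)
  also have "\<dots> = cmul ((- 1) ^ d) (pd z f)"
    using neg_one_power_mod_2[of 1 "e + cpar z"]
    by (simp add: sinv_parity[OF assms(2)] pd_cmul[OF assms(1)] assms(3) power_add mult.commute)
  finally show ?thesis using assms(3) by (subst has_parity_sinv_iff) auto
qed

lemma pd_spart: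
  assumes "f \<in> Cinf A" "e < 2"
  shows "pd z (spart e f) = spart ((e + cpar z) mod 2) (pd z f)"
proof -
  have *: "(e + cpar z) mod 2 < 2" by simp
  have sgn: "(- 1 :: real) ^ ((e + cpar z) mod 2) = (- 1) ^ e * (- 1) ^ cpar z"
    using neg_one_power_mod_2[of 1 "e + cpar z"] by (simp add: power_add)
  show ?thesis
    unfolding spart_eq_sinv[OF assms(2)] spart_eq_sinv[OF *] sgn
    by (simp add: pd_cmul[OF Cinf_add[OF assms(1) Cinf_cmul[OF Cinf_sinv[OF assms(1)]]]]
        pd_add[OF assms(1) Cinf_cmul[OF Cinf_sinv[OF assms(1)]]]
        pd_cmul[OF Cinf_sinv[OF assms(1)]] pd_sinv[OF assms(1)])
qed

section \<open>The graded Leibniz rule and homogeneous ideals\<close>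

lemma mono_sign_singleton: "mono_sign {o'} S = (- 1) ^ card {s \<in> S. s < o'}"
proof -
  have "{(a, b). a \<in> {o'} \<and> b \<in> S \<and> b < a} = Pair o' ` {s \<in> S. s < o'}" by auto
  moreover have "card (Pair o' ` {s \<in> S. s < o'}) = card {s \<in> S. s < o'}"
    by (rule card_image) (simp add: inj_on_def)
  ultimately show ?thesis by (simp add: mono_sign_def)
qed

lemma mono_sign_insert_left:
  assumes "finite T" "finite U" "o' \<notin> T"
  shows "mono_sign (insert o' T) U = mono_sign {o'} U * mono_sign T U"
  using mono_sign_Un_left[of "{o'}" T U] assms by simp

text \<open>The factor \<open>(- 1) ^ card T\<close> is the cost of moving \<open>o'\<close> from
  the right of \<open>T\<close> to its left; in the Leibniz rule it becomes the
  \<open>sinv 1\<close> on the first factor.\<close>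

lemma mono_sign_insert_right:
  assumes "finite T" "finite U" "o' \<notin> T" "o' \<notin> U"
  shows "mono_sign T (insert o' U) = (- 1) ^ card T * mono_sign {o'} T * mono_sign T U"
  using mono_sign_Un_right[of T "{o'}" U] mono_sign_commute[of T "{o'}"] assms by simp

lemma sum_Pow_insert:
  fixes h :: "'a set \<Rightarrow> real"
  assumes "finite R" "a \<notin> R"
  shows "(\<Sum>T\<in>Pow (insert a R). h T) = (\<Sum>T\<in>Pow R. h T + h (insert a T))"
proof -
  have "inj_on (insert a) (Pow R)" using assms by (intro inj_onI) (auto simp: insert_ident)
  moreover have "Pow R \<inter> insert a ` Pow R = {}" using assms by auto
  ultimately show ?thesis
    by (simp add: Pow_insert sum.union_disjoint assms sum.reindex sum.distrib)
qed

lemma pd_Inr: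
  "pd (Inr o') f p S = (if o' \<in> S then 0 else mono_sign {o'} S * f p (insert o' S))"
  by (simp add: mono_sign_singleton)

lemma pd_Inr_smult:
  assumes "f \<in> Cinf A" "g \<in> Cinf B"
  shows "pd (Inr o') (f \<star> g) = pd (Inr o') f \<star> g + sinv 1 f \<star> pd (Inr o') g"
proof (intro ext)
  fix p and S :: "ocoord set"
  let ?L = "pd (Inr o') (f \<star> g) p S"
  let ?M = "(pd (Inr o') f \<star> g + sinv 1 f \<star> pd (Inr o') g) p S"
  show "?L = ?M"
  proof (cases "finite S")
    case False
    then show ?thesis by (simp add: smult_infinite)
  next
    case fin: True
    show ?thesis
    proof (cases "o' \<in> S")
      case True
      \<comment> \<open>The left side is 0 here. On the right, the surviving term for
        \<open>T\<close> differentiates \<open>f\<close> and leaves \<open>o'\<close> in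
        \<open>g\<close>, the one for \<open>insert o' T\<close> differentiates \<open>g\<close> and
        leaves \<open>o'\<close> in \<open>f\<close>; they are opposite to each other.\<close>
      define R where "R = S - {o'}"
      have R: "S = insert o' R" "finite R" "o' \<notin> R" using True fin by (auto simp: R_def)
      have "(\<Sum>T\<in>Pow R.
          (mono_sign T (S - T) * pd (Inr o') f p T * g p (S - T)
          + mono_sign (insert o' T) (S - insert o' T) * pd (Inr o') f p (insert o' T) * g p (S - insert o' T))
        + (mono_sign T (S - T) * sinv 1 f p T * pd (Inr o') g p (S - T)
          + mono_sign (insert o' T) (S - insert o' T) * sinv 1 f p (insert o' T) * pd (Inr o') g p (S - insert o' T)))
        = 0" (is "(\<Sum>T\<in>_. ?h T) = 0")
      proof (rule sum.neutral, rule ballI)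
        fix T assume T: "T \<in> Pow R"
        then have fT: "finite T" "finite (R - T)" "o' \<notin> T" "o' \<notin> R - T"
          using R finite_subset by auto
        have d: "S - T = insert o' (R - T)" "S - insert o' T = R - T" using T R by auto
        show "?h T = 0"
          unfolding d mono_sign_insert_left[OF fT(1-3)] mono_sign_insert_right[OF fT] pd_Inr
          using fT by (simp add: sinv_def mult_ac)
      qed
      then have "?M = 0"
        using fin R by (simp add: smult_def sum_Pow_insert sum.distrib)
      then show ?thesis using True by simp
    next
      case False
      \<comment> \<open>Sorting the subsets of \<open>insert o' S\<close> by the factor that
        receives \<open>o'\<close> produces the two terms of the Leibniz rule.\<close>
      have "?L = mono_sign {o'} S * (\<Sum>T\<in>Pow S.
           mono_sign T (insert o' S - T) * f p T * g p (insert o' S - T)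
           + mono_sign (insert o' T) (insert o' S - insert o' T) * f p (insert o' T) * g p (insert o' S - insert o' T))"
        (is "_ = _ * (\<Sum>T\<in>_. ?h T)")
        using False fin by (simp add: smult_def sum_Pow_insert mono_sign_singleton)
      also have "\<dots> = (\<Sum>T\<in>Pow S.
          mono_sign T (S - T) * pd (Inr o') f p T * g p (S - T)
          + mono_sign T (S - T) * sinv 1 f p T * pd (Inr o') g p (S - T))"
        (is "_ = (\<Sum>T\<in>_. ?k T)")
        unfolding sum_distrib_left
      proof (rule sum.cong[OF refl])
        fix T assume T: "T \<in> Pow S"
        then have fT: "finite T" "finite (S - T)" "o' \<notin> T" "o' \<notin> S - T"
          using fin False finite_subset by auto
        have d: "insert o' S - T = insert o' (S - T)" "insert o' S - insert o' T = S - T"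
          using T False by auto
        have "T \<union> (S - T) = S" using T by auto
        then have s: "mono_sign {o'} S = mono_sign {o'} T * mono_sign {o'} (S - T)"
          using mono_sign_Un_right[of "{o'}" T "S - T"] fT by auto
        show "mono_sign {o'} S * ?h T = ?k T"
          unfolding d s mono_sign_insert_left[OF fT(1-3)] mono_sign_insert_right[OF fT] pd_Inr
          using fT by (simp add: sinv_def distrib_left mult_ac)
      qed
      also have "\<dots> = ?M" by (simp add: smult_def sum.distrib)
      finally show ?thesis .
    qed
  qed
qed

lemma pd_smult:
  assumes "f \<in> Cinf A" "g \<in> Cinf B"
  shows "pd z (f \<star> g) = pd z f \<star> g + sinv (cpar z) f \<star> pd z g"
proof (cases z)
  case (Inr o')
  then show ?thesis using pd_Inr_smult[OF assms] by simp
next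
  case (Inl e)
  show ?thesis
  proof (intro ext)
    fix p S
    have "pd z (f \<star> g) p S
        = pdiff e (\<lambda>q. \<Sum>T\<in>Pow S. mono_sign T (S - T) * (f q T * g q (S - T))) p"
      by (simp add: Inl smult_def mult.assoc)
    also have "\<dots> = (\<Sum>T\<in>Pow S. mono_sign T (S - T) *
        (pdiff e (\<lambda>q. f q T) p * g p (S - T) + f p T * pdiff e (\<lambda>q. g q (S - T)) p))"
      using Cinf_smooth[OF assms(1)] Cinf_smooth[OF assms(2)]
      by (simp add: pdiff_sum pdiff_cmult pdiff_mult smooth_mult)
    also have "\<dots> = (pd z f \<star> g + sinv (cpar z) f \<star> pd z g) p S"
      by (simp add: Inl smult_def algebra_simps sum.distrib)
    finally show "pd z (f \<star> g) p S = (pd z f \<star> g + sinv (cpar z) f \<star> pd z g) p S" .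
  qed
qed

text \<open>Two even derivatives commute by \<open>pdiff_commute\<close>. An odd derivative only
  selects coefficients and multiplies them by constant signs, so it commutes with an even one. For
  two odd coordinates the sign is that of their transposition.\<close>

lemma pd_commute:
  assumes "f \<in> Cinf A"
  shows "pd z (pd z' f) = cmul ((- 1) ^ (cpar z * cpar z')) (pd z' (pd z f))"
proof -
  have mixed: "pd (Inl e) (pd (Inr o') f) = pd (Inr o') (pd (Inl e) f)" for e o'
  proof (intro ext)
    fix p S
    show "pd (Inl e) (pd (Inr o') f) p S = pd (Inr o') (pd (Inl e) f) p S"
      by (cases "o' \<in> S") (simp_all add: pdiff_cmult Cinf_smooth[OF assms])
  qed
  show ?thesis
  proof (cases z; cases z')
    fix e e' assume "z = Inl e" "z' = Inl e'"
    then show ?thesis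
      using pdiff_commute[OF Cinf_smooth[OF assms]] by (simp add: fun_eq_iff)
  next
    fix e o' assume "z = Inl e" "z' = Inr o'"
    then show ?thesis by (simp only: mixed) simp
  next
    fix e o' assume "z = Inr o'" "z' = Inl e"
    then show ?thesis by (simp only: mixed) simp
  next
    fix o1 o2 assume z: "z = Inr o1" "z' = Inr o2"
    have "pd (Inr o1) (pd (Inr o2) f) p S = - pd (Inr o2) (pd (Inr o1) f) p S" for p S
    \<comment> \<open>In every other case both sides are 0.\<close>
    proof (cases "finite S \<and> o1 \<noteq> o2 \<and> o1 \<notin> S \<and> o2 \<notin> S")
      case True
      then have "mono_sign {o2} (insert o1 S) = mono_sign {o2} {o1} * mono_sign {o2} S"
        "mono_sign {o1} (insert o2 S) = mono_sign {o1} {o2} * mono_sign {o1} S"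
        using mono_sign_Un_right[of "{o2}" "{o1}" S] mono_sign_Un_right[of "{o1}" "{o2}" S] by auto
      moreover have "mono_sign {o1} {o2} = - mono_sign {o2} {o1}"
        using mono_sign_commute[of "{o1}" "{o2}"] True by simp
      ultimately show ?thesis using True
        by (auto simp: pd_Inr insert_commute[of o1 o2] mult_ac simp del: pd.simps)
    next
      case False
      then consider "infinite S" | "o1 = o2" | "o1 \<in> S" | "o2 \<in> S" by blast
      then show ?thesis
        by cases (simp_all add: Cinf_infinite[OF assms])
    qed
    then show ?thesis by (simp add: z cmul_minus_one fun_eq_iff del: pd.simps)
  qed
qed

section \<open>Ideals generated by homogeneous superfunctions\<close>

lemma gen_ideal_mono: "C \<subseteq> C' \<Longrightarrow> gen_ideal C P \<subseteq> gen_ideal C' P"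
proof
  fix f assume "C \<subseteq> C'" "f \<in> gen_ideal C P"
  from this(2,1) show "f \<in> gen_ideal C' P"
    by induction (blast intro: gen_ideal.intros)+
qed

text \<open>\<open>gen_ideal\<close> is built from left multiples only. With homogeneous generators
  it is two-sided and stable under \<open>sinv\<close> and \<open>spart\<close>, as sign rules and
  parity components in the quotient require. The locale serves once for the jet space and once for
  the covering.\<close>

locale homogeneous_ideal =
  fixes A :: "coord set" and P :: "superfun set"
  assumes gen_Cinf: "f \<in> P \<Longrightarrow> f \<in> Cinf A"
    and gen_parity: "f \<in> P \<Longrightarrow> \<exists>e<2. has_parity e f"
begin

abbreviation "I \<equiv> gen_ideal (Cinf A) P"

lemma ideal_Cinf: "f \<in> I \<Longrightarrow> f \<in> Cinf A"
proof (induction rule: gen_ideal.induct)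
  case zero
  show ?case by (rule Cinf_zero)
next
  case (step h f g)
  show ?case by (rule Cinf_add[OF Cinf_smult[OF step(1) gen_Cinf[OF step(2)]] step(4)])
qed

lemma ideal_zero [simp]: "0 \<in> I"
  by (rule gen_ideal.zero)

lemma ideal_add: "f \<in> I \<Longrightarrow> g \<in> I \<Longrightarrow> f + g \<in> I"
proof (induction rule: gen_ideal.induct)
  case zero
  then show ?case by (simp only: add_0)
next
  case (step h f g')
  then show ?case unfolding add.assoc by (intro gen_ideal.step)
qed

lemma ideal_sum: "(\<And>i. i \<in> J \<Longrightarrow> f i \<in> I) \<Longrightarrow> (\<Sum>i\<in>J. f i) \<in> I"
  by (rule sum_closed) (auto intro: ideal_add)

lemma ideal_product: "h \<in> Cinf A \<Longrightarrow> f \<in> P \<Longrightarrow> h \<star> f \<in> I"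
  using gen_ideal.step[OF _ _ gen_ideal.zero, of h "Cinf A" f P] by simp

lemma ideal_generator: 
  assumes "f \<in> P"
  shows "f \<in> I"
  using ideal_product[of "sconst 1", OF _ assms] gen_Cinf[OF assms] by simp

text \<open>The induction shared by several closure properties below: an additive operation has to
  be checked only on left multiples of generators.\<close>

lemma ideal_image:
  assumes "f \<in> I" and "F 0 = 0"
    and "\<And>f g. f \<in> Cinf A \<Longrightarrow> g \<in> Cinf A \<Longrightarrow> F (f + g) = F f + F g"
    and "\<And>h f. h \<in> Cinf A \<Longrightarrow> f \<in> P \<Longrightarrow> F (h \<star> f) \<in> I"
  shows "F f \<in> I"
  using assms(1)
proof (induction rule: gen_ideal.induct)
  case zero
  show ?case unfolding assms(2) by (rule ideal_zero)
next
  case (step h f g)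
  have "F (h \<star> f + g) = F (h \<star> f) + F g"
    by (rule assms(3)[OF Cinf_smult[OF step(1) gen_Cinf[OF step(2)]] ideal_Cinf[OF step(3)]])
  also have "\<dots> \<in> I"
    by (rule ideal_add[OF assms(4)[OF step(1,2)] step(4)])
  finally show ?case .
qed

lemma ideal_smult_left: "f \<in> I \<Longrightarrow> h \<in> Cinf A \<Longrightarrow> h \<star> f \<in> I"
  by (rule ideal_image[of f "\<lambda>f. h \<star> f"])
    (auto simp: smult_add_right simp flip: smult_assoc intro: ideal_product Cinf_smult)

lemma ideal_cmul: "f \<in> I \<Longrightarrow> cmul c f \<in> I"
  using ideal_smult_left[of f "sconst c"] ideal_Cinf[of f] by simp

lemma ideal_minus: "f \<in> I \<Longrightarrow> - f \<in> I"
  using ideal_cmul[of f "- 1"] by (simp add: cmul_minus_one)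

lemma ideal_diff: "f \<in> I \<Longrightarrow> g \<in> I \<Longrightarrow> f - g \<in> I"
  using ideal_add[of f "- g"] ideal_minus[of g] by simp

lemma ideal_sinv: "f \<in> I \<Longrightarrow> sinv m f \<in> I"
proof (rule ideal_image[of f "sinv m"])
  fix h f assume h: "h \<in> Cinf A" "f \<in> P"
  obtain e where "has_parity e f" using gen_parity[OF h(2)] by blast
  then show "sinv m (h \<star> f) \<in> I"
    unfolding sinv_smult by (simp add: sinv_parity ideal_cmul ideal_product h Cinf_sinv)
qed auto

lemma ideal_spart:
  assumes "f \<in> I" "e < 2"
  shows "spart e f \<in> I"
  unfolding spart_eq_sinv[OF assms(2)] by (intro ideal_cmul ideal_add ideal_sinv assms(1))

text \<open>A homogeneous generator of parity \<open>e\<close> can be carried to the right of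
  \<open>h\<close>, at the price of replacing \<open>h\<close> by \<open>sinv e h\<close>.\<close>

lemma ideal_smult_right:
  assumes "f \<in> I" and h: "h \<in> Cinf A"
  shows "f \<star> h \<in> I"
proof (rule ideal_image[OF assms(1), of "\<lambda>f. f \<star> h"])
  fix k f assume k: "k \<in> Cinf A" "f \<in> P"
  obtain e where e: "has_parity e f" using gen_parity[OF k(2)] by blast
  have "f \<star> h = sinv e h \<star> f"
    using smult_commute[OF e, of "sinv e h"] by (simp add: sinv_even)
  then have "k \<star> f \<star> h = (k \<star> sinv e h) \<star> f" by (simp add: smult_assoc)
  then show "k \<star> f \<star> h \<in> I" using k h by (simp add: ideal_product Cinf_smult Cinf_sinv)
qed (auto simp: smult_add_left)

text \<open>By the Leibniz rule, \<open>D\<close> sends a multiple of a generator to a multiple of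
  that generator plus a multiple of its image, so only the images of the generators matter.\<close>

lemma ideal_derivation:
  assumes "f \<in> I" and "D 0 = 0"
    and "\<And>f g. f \<in> Cinf A \<Longrightarrow> g \<in> Cinf A \<Longrightarrow> D (f + g) = D f + D g"
    and "\<And>h. h \<in> Cinf A \<Longrightarrow> D h \<in> Cinf A"
    and "\<And>h f. h \<in> Cinf A \<Longrightarrow> f \<in> Cinf A \<Longrightarrow> D (h \<star> f) = D h \<star> f + sinv e h \<star> D f"
    and "\<And>f. f \<in> P \<Longrightarrow> D f \<in> I"
  shows "D f \<in> I"
proof (rule ideal_image[OF assms(1-3)])
  fix h f assume h: "h \<in> Cinf A" "f \<in> P"
  have "D (h \<star> f) = D h \<star> f + sinv e h \<star> D f" by (rule assms(5)[OF h(1) gen_Cinf[OF h(2)]])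
  moreover have "D h \<star> f + sinv e h \<star> D f \<in> I"
    by (intro ideal_add ideal_product ideal_smult_left assms(4,6) Cinf_sinv h)
  ultimately show "D (h \<star> f) \<in> I" by simp
qed

end

section \<open>Total derivatives and vertical vector fields\<close>

declare pd.simps [simp del]

lemma smult_sconst [simp]:
  assumes "f \<in> Cinf A"
  shows "f \<star> sconst c = cmul c f"
  using smult_commute[of 0 "sconst c" f] sconst_smult[OF assms] by simp

lemma jet_shift_deps: "z \<in> jet_deps \<E> \<Longrightarrow> jet_shift v z \<in> jet_deps \<E>"
  by (cases v) (auto simp: jet_deps_def)

lemma cpar_jet_shift [simp]: "cpar (jet_shift v z) = cpar z"
  by (induction v z rule: jet_shift.induct) auto

text \<open>In \<open>Dtot\<close> the range of summation depends on the function. Comparing the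
  values on several functions needs a common range, for which any finite set of jets carrying all
  nonzero derivatives will do.\<close>

lemma Dtot_eq:
  assumes "finite Z" "Z \<subseteq> jet_deps \<E>" "\<And>z. z \<in> jet_deps \<E> \<Longrightarrow> z \<notin> Z \<Longrightarrow> pd z f = 0"
  shows "Dtot \<E> v f = pd (Inl (Base v)) f + (\<Sum>z\<in>Z. coord_fun (jet_shift v z) \<star> pd z f)"
  unfolding Dtot_def
  by (rule arg_cong2[of _ _ _ _ "(+)", OF refl], rule sum.mono_neutral_left) (use assms in auto)

definition jet_support :: "zsystem \<Rightarrow> superfun \<Rightarrow> coord set"
  where "jet_support \<E> f = {z \<in> jet_deps \<E>. pd z f \<noteq> 0}"

lemma jet_support_finite: "f \<in> Cinf A \<Longrightarrow> finite (jet_support \<E> f)"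
  unfolding jet_support_def using finite_pd finite_subset by (metis (no_types, lifting) Collect_mono_iff)

lemma jet_support_deps: "jet_support \<E> f \<subseteq> jet_deps \<E>"
  by (auto simp: jet_support_def)

lemma jet_support_zero: "z \<in> jet_deps \<E> \<Longrightarrow> z \<notin> jet_support \<E> f \<Longrightarrow> pd z f = 0"
  by (auto simp: jet_support_def)

lemma Dtot_zero [simp]: "Dtot \<E> v 0 = 0"
  using Dtot_eq[of "{}" \<E> 0 v] by simp

lemma Dtot_add:
  assumes "f \<in> Cinf A" "g \<in> Cinf B"
  shows "Dtot \<E> v (f + g) = Dtot \<E> v f + Dtot \<E> v g"
proof -
  let ?Z = "jet_support \<E> f \<union> jet_support \<E> g"
  have Z: "finite ?Z" "?Z \<subseteq> jet_deps \<E>"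
    using assms jet_support_finite jet_support_deps by blast+
  note pd = pd_add[OF assms]
  have "Dtot \<E> v h = pd (Inl (Base v)) h + (\<Sum>z\<in>?Z. coord_fun (jet_shift v z) \<star> pd z h)"
    if "h \<in> {f, g, f + g}" for h
    by (rule Dtot_eq[OF Z]) (use that pd in \<open>auto simp: jet_support_def\<close>)
  then show ?thesis by (simp add: pd smult_add_right sum.distrib)
qed

lemma Dtot_cmul:
  assumes "f \<in> Cinf A"
  shows "Dtot \<E> v (cmul c f) = cmul c (Dtot \<E> v f)"
proof -
  note Z = jet_support_finite[OF assms] jet_support_deps jet_support_zero
  have "Dtot \<E> v (cmul c f)
      = pd (Inl (Base v)) (cmul c f) + (\<Sum>z\<in>jet_support \<E> f. coord_fun (jet_shift v z) \<star> pd z (cmul c f))"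
    by (rule Dtot_eq[OF Z(1,2)]) (simp add: pd_cmul[OF assms] Z(3))
  then show ?thesis
    by (simp add: Dtot_eq[OF Z] pd_cmul[OF assms] cmul_sum cmul_add_right)
qed

lemma Dtot_minus: "f \<in> Cinf A \<Longrightarrow> Dtot \<E> v (- f) = - Dtot \<E> v f"
  using Dtot_cmul[of f A \<E> v "- 1"] by (simp add: cmul_minus_one)

lemma Dtot_diff: "f \<in> Cinf A \<Longrightarrow> g \<in> Cinf B \<Longrightarrow> Dtot \<E> v (f - g) = Dtot \<E> v f - Dtot \<E> v g"
  using Dtot_add[OF _ Cinf_minus, of f A g B \<E> v] by (simp add: Dtot_minus)

lemma Dtot_sum:
  assumes "\<And>i. i \<in> I \<Longrightarrow> f i \<in> Cinf A"
  shows "Dtot \<E> v (\<Sum>i\<in>I. f i) = (\<Sum>i\<in>I. Dtot \<E> v (f i))"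
  by (rule sum_hom_on[of "Cinf A" "Dtot \<E> v"]) (auto simp: assms Dtot_add intro: Cinf_add)

lemma Dtot_Cinf:
  assumes "f \<in> Cinf A" "jet_deps \<E> \<subseteq> A"
  shows "Dtot \<E> v f \<in> Cinf A"
  unfolding Dtot_def
  by (intro Cinf_add Cinf_sum Cinf_smult Cinf_pd[OF assms(1)] Cinf_coord_fun)
    (use assms jet_shift_deps in auto)

lemma Dtot_has_parity:
  assumes "f \<in> Cinf A" "has_parity e f" "e < 2"
  shows "has_parity e (Dtot \<E> v f)"
  unfolding Dtot_def
proof (intro has_parity_add has_parity_sum)
  show "has_parity e (pd (Inl (Base v)) f)"
    using has_parity_pd[OF assms(1,2), of e "Inl (Base v)"] assms(3) by simp
  fix z
  show "has_parity e (coord_fun (jet_shift v z) \<star> pd z f)"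
    by (rule has_parity_smult[OF has_parity_coord_fun has_parity_pd[OF assms(1,2) refl]])
      (use assms(3) in \<open>simp; presburger\<close>)
qed

lemma Dtot_spart:
  assumes "f \<in> Cinf A" "e < 2"
  shows "Dtot \<E> v (spart e f) = spart e (Dtot \<E> v f)"
proof -
  note Z = jet_support_finite[OF assms(1)] jet_support_deps jet_support_zero
  have "spart e (coord_fun (jet_shift v z) \<star> pd z f) = coord_fun (jet_shift v z) \<star> pd z (spart e f)" for z
    using spart_smult_left[OF has_parity_coord_fun _ assms(2), of "jet_shift v z" "pd z f"]
    by (simp add: pd_spart[OF assms])
  moreover have "spart e (pd (Inl (Base v)) f) = pd (Inl (Base v)) (spart e f)"
    using assms(2) pd_spart[OF assms, of "Inl (Base v)"] by simp
  moreover have "Dtot \<E> v (spart e f)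
      = pd (Inl (Base v)) (spart e f) + (\<Sum>z\<in>jet_support \<E> f. coord_fun (jet_shift v z) \<star> pd z (spart e f))"
    by (rule Dtot_eq[OF Z(1,2)]) (simp add: pd_spart[OF assms] Z(3))
  ultimately show ?thesis
    by (simp add: Dtot_eq[OF Z] spart_sum)
qed

lemma Dtot_smult:
  assumes "f \<in> Cinf A" "g \<in> Cinf B"
  shows "Dtot \<E> v (f \<star> g) = Dtot \<E> v f \<star> g + f \<star> Dtot \<E> v g"
proof -
  let ?Z = "jet_support \<E> f \<union> jet_support \<E> g"
  have Z: "finite ?Z" "?Z \<subseteq> jet_deps \<E>"
    using assms jet_support_finite jet_support_deps by blast+
  note pd = pd_smult[OF assms]
  have D: "Dtot \<E> v h = pd (Inl (Base v)) h + (\<Sum>z\<in>?Z. coord_fun (jet_shift v z) \<star> pd z h)"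
    if "h \<in> {f, g, f \<star> g}" for h
    by (rule Dtot_eq[OF Z]) (use that pd in \<open>auto simp: jet_support_def\<close>)
  \<comment> \<open>The sign with which the left derivative passes \<open>f\<close> is undone by
    carrying the jet coordinate, which has the same parity, past \<open>f\<close>. This is why
    \<open>Dtot\<close> is an even derivation.\<close>
  have "coord_fun (jet_shift v z) \<star> pd z (f \<star> g)
      = (coord_fun (jet_shift v z) \<star> pd z f) \<star> g + f \<star> (coord_fun (jet_shift v z) \<star> pd z g)" for z
    using smult_commute[OF has_parity_coord_fun, of f "jet_shift v z"]
    by (simp add: pd smult_add_right flip: smult_assoc)
  then show ?thesis
    using pd[of "Inl (Base v)"]
    by (simp add: D sum.distrib smult_add_left smult_add_right smult_sum_left smult_sum_right)
qed

text \<open>The coefficients of \<open>Dtot\<close> are jet coordinates, which \<open>pd w\<close>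
  kills; the sign for passing such a coordinate cancels the sign for exchanging the two partial
  derivatives.\<close>

lemma pd_Dtot:
  assumes "f \<in> Cinf A" "w \<notin> jet_coords \<E>"
  shows "pd w (Dtot \<E> v f) = Dtot \<E> v (pd w f)"
proof -
  note Z = jet_support_finite[OF assms(1)] jet_support_deps jet_support_zero
  note comm = pd_commute[OF assms(1)]
  have out: "pd w (coord_fun (jet_shift v z)) = 0" if "z \<in> jet_support \<E> f" for z
    using that jet_shift_deps[of z \<E> v] assms(2) jet_support_deps[of \<E> f]
    by (auto simp: pd_coord_fun jet_coords_def)
  have "pd w (coord_fun (jet_shift v z) \<star> pd z f) = coord_fun (jet_shift v z) \<star> pd z (pd w f)"
    if "z \<in> jet_support \<E> f" for z
    using pd_smult[OF Cinf_coord_fun[of "jet_shift v z" UNIV] Cinf_pd[OF assms(1)], of w z] out[OF that]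
    by (simp add: comm[of w z] sinv_parity[OF has_parity_coord_fun] flip: power_add)
  moreover have "pd w (\<Sum>z\<in>jet_support \<E> f. coord_fun (jet_shift v z) \<star> pd z f)
      = (\<Sum>z\<in>jet_support \<E> f. pd w (coord_fun (jet_shift v z) \<star> pd z f))"
    by (rule pd_sum[of _ _ UNIV])
      (intro Cinf_smult Cinf_coord_fun Cinf_mono[OF Cinf_pd[OF assms(1)]], auto)
  moreover have "Dtot \<E> v (pd w f) = pd (Inl (Base v)) (pd w f)
      + (\<Sum>z\<in>jet_support \<E> f. coord_fun (jet_shift v z) \<star> pd z (pd w f))"
    by (rule Dtot_eq[OF Z(1,2)]) (simp add: comm[of _ w] Z(3))
  moreover have Dv: "Dtot \<E> v f = pd (Inl (Base v)) f
      + (\<Sum>z\<in>jet_support \<E> f. coord_fun (jet_shift v z) \<star> pd z f)"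
    by (rule Dtot_eq[OF Z])
  have "pd w (Dtot \<E> v f) = pd w (pd (Inl (Base v)) f)
      + pd w (\<Sum>z\<in>jet_support \<E> f. coord_fun (jet_shift v z) \<star> pd z f)"
    unfolding Dv
    by (rule pd_add[of _ UNIV _ UNIV])
      (intro Cinf_sum Cinf_smult Cinf_coord_fun Cinf_mono[OF Cinf_pd[OF assms(1)]], auto)+
  ultimately show ?thesis using comm[of w "Inl (Base v)"] by simp
qed

lemma Dtot_coord_fun:
  assumes "z \<in> jet_deps \<E>"
  shows "Dtot \<E> v (coord_fun z) = coord_fun (jet_shift v z)"
proof -
  have "Dtot \<E> v (coord_fun z) = pd (Inl (Base v)) (coord_fun z)
      + (\<Sum>z'\<in>{z}. coord_fun (jet_shift v z') \<star> pd z' (coord_fun z))"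
    by (rule Dtot_eq) (use assms in \<open>auto simp: pd_coord_fun\<close>)
  moreover have "z \<noteq> Inl (Base v)" using assms by (auto simp: jet_deps_def)
  ultimately show ?thesis
    by (simp add: pd_coord_fun smult_sconst[OF Cinf_coord_fun[of "jet_shift v z" UNIV]])
qed

section \<open>The generators of the differential ideal\<close>

lemma prolongation_homogeneous:
  assumes "zgraded_system \<E>" "f \<in> prolongation \<E>"
  shows "f \<in> Cinf (jet_coords \<E>) \<and> (\<exists>e<2. has_parity e f)"
proof -
  obtain vs F where f: "f = foldr (Dtot \<E>) vs F" "F \<in> eqns \<E>"
    using assms(2) by (auto simp: prolongation_def)
  then obtain e where F: "F \<in> Cinf (jet_coords \<E>)" "e < 2" "has_parity e F"
    using assms(1) unfolding zgraded_system_def by blast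
  have "foldr (Dtot \<E>) vs F \<in> Cinf (jet_coords \<E>) \<and> has_parity e (foldr (Dtot \<E>) vs F)"
  proof (induction vs)
    case (Cons v vs)
    then show ?case using F(2) by (auto simp: jet_coords_def intro!: Dtot_Cinf Dtot_has_parity)
  qed (use F in simp)
  then show ?thesis using F(2) f(1) by blast
qed

lemma Dtot_prolongation:
  assumes "f \<in> prolongation \<E>"
  shows "Dtot \<E> v f \<in> prolongation \<E>"
proof -
  obtain vs F where "f = foldr (Dtot \<E>) vs F" "F \<in> eqns \<E>"
    using assms by (auto simp: prolongation_def)
  then have "Dtot \<E> v f = foldr (Dtot \<E>) (v # vs) F \<and> F \<in> eqns \<E>" by simp
  then show ?thesis unfolding prolongation_def by blast
qed

section \<open>Vertical vector fields in components\<close>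

definition vert :: "matalg \<Rightarrow> (nat \<Rightarrow> superfun) \<Rightarrow> vfield"
  where "vert G c f = (\<Sum>l\<in>{1..topidx G}. c l \<star> pd (wcoord G l) f)"

lemma wcoord_inject: "wcoord G l = wcoord G l' \<longleftrightarrow> l = l'"
  by (auto simp: wcoord_def split: if_splits)

lemma wcoord_jet: "wcoord G l \<notin> jet_coords \<E>"
  by (auto simp: wcoord_def jet_coords_def jet_deps_def)

lemma vert_zero [simp]: "vert G c 0 = 0"
  by (simp add: vert_def)

lemma vert_add:
  "f \<in> Cinf A \<Longrightarrow> g \<in> Cinf B \<Longrightarrow> vert G c (f + g) = vert G c f + vert G c g"
  by (simp add: vert_def pd_add smult_add_right sum.distrib)

lemma vert_cmul: "f \<in> Cinf A \<Longrightarrow> vert G c (cmul r f) = cmul r (vert G c f)"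
  by (simp add: vert_def pd_cmul cmul_sum)

lemma vert_minus: "f \<in> Cinf A \<Longrightarrow> vert G c (- f) = - vert G c f"
  using vert_cmul[of f A G c "- 1"] by (simp add: cmul_minus_one)

lemma vert_diff:
  "f \<in> Cinf A \<Longrightarrow> g \<in> Cinf B \<Longrightarrow> vert G c (f - g) = vert G c f - vert G c g"
  using vert_add[OF _ Cinf_minus, of f A g B G c] by (simp add: vert_minus)

lemma vert_sum:
  assumes "\<And>i. i \<in> I \<Longrightarrow> f i \<in> Cinf A"
  shows "vert G c (\<Sum>i\<in>I. f i) = (\<Sum>i\<in>I. vert G c (f i))"
  by (rule sum_hom_on[of "Cinf A" "vert G c"]) (auto simp: assms vert_add intro: Cinf_add)

lemma vert_Cinf:
  assumes "f \<in> Cinf A" "\<And>l. l \<in> {1..topidx G} \<Longrightarrow> c l \<in> Cinf A"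
  shows "vert G c f \<in> Cinf A"
  unfolding vert_def by (intro Cinf_sum Cinf_smult Cinf_pd assms)

lemma vert_cong: "(\<And>l. l \<in> {1..topidx G} \<Longrightarrow> c l = d l) \<Longrightarrow> vert G c f = vert G d f"
  by (simp add: vert_def)

lemma vert_lincomb: "vert G (\<lambda>l. \<Sum>k\<in>K. g k \<star> c k l) f = (\<Sum>k\<in>K. g k \<star> vert G (c k) f)"
  unfolding vert_def smult_sum_left smult_sum_right smult_assoc by (rule sum.swap)

definition vert_parity :: "matalg \<Rightarrow> nat \<Rightarrow> (nat \<Rightarrow> superfun) \<Rightarrow> bool"
  where "vert_parity G e c \<longleftrightarrow>
    (\<forall>l\<in>{1..topidx G}. has_parity ((e + cpar (wcoord G l)) mod 2) (c l))"

lemma sinv_vert_parity: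
  assumes "vert_parity G e c" "l \<in> {1..topidx G}"
  shows "sinv m (c l) = cmul ((- 1) ^ (m * (e + cpar (wcoord G l)))) (c l)"
  using assms sinv_parity[of "(e + cpar (wcoord G l)) mod 2" "c l" m]
  by (simp add: vert_parity_def neg_one_power_mod_2)

lemma smult_vert_parity:
  assumes "vert_parity G e c" "l \<in> {1..topidx G}"
  shows "f \<star> c l = c l \<star> sinv (e + cpar (wcoord G l)) f"
proof -
  have "sinv ((e + cpar (wcoord G l)) mod 2) f = sinv (e + cpar (wcoord G l)) f"
    by (rule sinv_cong) presburger
  then show ?thesis
    using assms smult_commute[of "(e + cpar (wcoord G l)) mod 2" "c l" f]
    by (simp add: vert_parity_def)
qed

text \<open>Carrying \<open>f\<close> past the coefficient costs
  \<open>sinv (e + cpar (wcoord G l))\<close>, carrying it past the derivative costs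
  \<open>sinv (cpar (wcoord G l))\<close>; together only \<open>sinv e\<close> remains.\<close>

lemma vert_smult:
  assumes "f \<in> Cinf A" "g \<in> Cinf B" "vert_parity G e c"
  shows "vert G c (f \<star> g) = vert G c f \<star> g + sinv e f \<star> vert G c g"
proof -
  have "c l \<star> pd (wcoord G l) (f \<star> g)
      = (c l \<star> pd (wcoord G l) f) \<star> g + sinv e f \<star> (c l \<star> pd (wcoord G l) g)"
    if "l \<in> {1..topidx G}" for l
  proof -
    have "sinv e f \<star> c l = c l \<star> sinv (cpar (wcoord G l)) f"
    proof -
      have "sinv (e + cpar (wcoord G l) + e) f = sinv (cpar (wcoord G l)) f"
        by (rule sinv_cong) presburger
      then show ?thesis
        using smult_vert_parity[OF assms(3) that, of "sinv e f"] by simp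
    qed
    then show ?thesis
      by (simp add: pd_smult[OF assms(1,2)] smult_add_right flip: smult_assoc)
  qed
  then show ?thesis
    by (simp add: vert_def sum.distrib smult_sum_left smult_sum_right)
qed

lemma vert_coord_fun:
  assumes "l \<in> {1..topidx G}" "c l \<in> Cinf A"
  shows "vert G c (coord_fun (wcoord G l)) = c l"
proof -
  have "vert G c (coord_fun (wcoord G l)) = (\<Sum>l'\<in>{1..topidx G}. if l' = l then c l else 0)"
    unfolding vert_def
    by (rule sum.cong) (auto simp: pd_coord_fun wcoord_inject smult_sconst[OF assms(2)])
  also have "\<dots> = c l" using assms(1) by simp
  finally show ?thesis .
qed

lemma vert_coord_fun_outside:
  assumes "z \<notin> wcoord G ` {1..topidx G}"
  shows "vert G c (coord_fun z) = 0"
  unfolding vert_def by (rule sum.neutral) (use assms in \<open>auto simp: pd_coord_fun\<close>)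

lemma parity_cancel: "((e + n) mod 2 + (n + c) mod 2) mod 2 = (e + c) mod (2::nat)"
proof -
  have "((e + n) mod 2 + (n + c) mod 2) mod 2 = (e + n + (n + c)) mod 2" by (rule mod_add_eq)
  also have "e + n + (n + c) = e + c + n * 2" by simp
  also have "\<dots> mod 2 = (e + c) mod 2" by (rule mod_mult_self1)
  finally show ?thesis .
qed

text \<open>A derivative shifts the parity of a homogeneous argument by that of its coordinate, so
  the projection falls on the coefficient with a parity independent of the argument, by
  \<open>parity_cancel\<close>.\<close>

lemma op_part_vert:
  assumes "f \<in> Cinf A" "e < 2"
  shows "op_part e (vert G c) f = vert G (\<lambda>l. spart ((e + cpar (wcoord G l)) mod 2) (c l)) f"
proof -
  have "spart ((e + \<eta>) mod 2) (c l \<star> pd (wcoord G l) (spart \<eta> f))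
      = spart ((e + cpar (wcoord G l)) mod 2) (c l) \<star> pd (wcoord G l) (spart \<eta> f)"
    if "\<eta> < 2" for \<eta> l
  proof -
    have "((e + \<eta>) mod 2 + (\<eta> + cpar (wcoord G l)) mod 2) mod 2 = (e + cpar (wcoord G l)) mod 2"
      by (rule parity_cancel)
    then show ?thesis
      using spart_smult_right[OF has_parity_pd[OF Cinf_spart[OF assms(1)] has_parity_spart refl],
          of \<eta> "wcoord G l" "(e + \<eta>) mod 2" "c l"] by simp
  qed
  then have "op_part e (vert G c) f
      = (\<Sum>\<eta><2. vert G (\<lambda>l. spart ((e + cpar (wcoord G l)) mod 2) (c l)) (spart \<eta> f))"
    unfolding op_part_def vert_def by (intro sum.cong[OF refl]) (simp add: spart_sum)
  also have "\<dots> = vert G (\<lambda>l. spart ((e + cpar (wcoord G l)) mod 2) (c l)) (\<Sum>\<eta><2. spart \<eta> f)"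
    by (rule vert_sum[symmetric]) (rule Cinf_spart[OF assms(1)])
  finally show ?thesis by (simp flip: spart_decompose)
qed

text \<open>The coordinate form of the rule that the Lie derivative along a vertical field commutes
  with the differential.\<close>

lemma pd_vert:
  assumes "f \<in> Cinf A" "\<And>l. l \<in> {1..topidx G} \<Longrightarrow> c l \<in> Cinf A" "vert_parity G e c"
  shows "pd z (vert G c f) = vert G (\<lambda>l. pd z (c l)) f + cmul ((- 1) ^ (e * cpar z)) (vert G c (pd z f))"
proof -
  have "pd z (c l \<star> pd (wcoord G l) f)
      = pd z (c l) \<star> pd (wcoord G l) f + cmul ((- 1) ^ (e * cpar z)) (c l \<star> pd (wcoord G l) (pd z f))"
    if l: "l \<in> {1..topidx G}" for l
  proof -
    \<comment> \<open>The parity of the fibre coordinate enters once from passing \<open>c l\<close>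
      and once from exchanging the derivatives, and so drops out.\<close>
    have "(- 1 :: real) ^ (cpar z * (e + cpar (wcoord G l))) * (- 1) ^ (cpar z * cpar (wcoord G l))
        = (- 1) ^ (e * cpar z)"
      by (simp add: add_mult_distrib2 mult.commute minus_one_power_iff flip: power_add)
    then show ?thesis
      by (simp add: pd_smult[OF assms(2)[OF l] Cinf_pd[OF assms(1)]] pd_commute[OF assms(1), of z]
          sinv_vert_parity[OF assms(3) l] mult.commute)
  qed
  moreover have "pd z (vert G c f) = (\<Sum>l\<in>{1..topidx G}. pd z (c l \<star> pd (wcoord G l) f))"
    unfolding vert_def by (rule pd_sum[of _ _ A]) (intro Cinf_smult assms Cinf_pd)
  ultimately show ?thesis by (simp add: vert_def sum.distrib cmul_sum)
qed

section \<open>The commutators of the realisation\<close>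

lemma cpar_wcoord [simp]: "cpar (wcoord G l) = ipar G l"
  by (simp add: wcoord_def ipar_def)

lemma ipar_0 [simp]: "ipar G 0 = 0"
  by (simp add: ipar_def)

lemma ipar_cases: "ipar G i = 0 \<or> ipar G i = 1"
  by (simp add: ipar_def)

lemma ipar_less_2 [simp]: "ipar G i < 2"
  by (simp add: ipar_def)

text \<open>Writing \<open>dvec\<close>, and then \<open>realisation\<close>, as \<open>vert\<close>
  of explicit components makes the parity and Leibniz facts for vertical fields available.\<close>

definition dcoef :: "matalg \<Rightarrow> real \<Rightarrow> nat \<Rightarrow> nat \<Rightarrow> superfun"
  where "dcoef G \<mu> j l = (if j = 0 then cmul (- 1 / \<mu>) (coord_fun (wcoord G l))
    else sconst (if j = l then 1 else 0))"

definition rcoef :: "matalg \<Rightarrow> real \<Rightarrow> rmat \<Rightarrow> nat \<Rightarrow> superfun"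
  where "rcoef G \<mu> M l = (\<Sum>i\<le>topidx G. \<Sum>j\<le>topidx G. cmul (M i j) (wvec G \<mu> i \<star> dcoef G \<mu> j l))"

lemma vert_sconst_delta:
  assumes "f \<in> Cinf A" "j \<in> {1..topidx G}"
  shows "vert G (\<lambda>l. sconst (if j = l then 1 else 0)) f = pd (wcoord G j) f"
proof -
  have "vert G (\<lambda>l. sconst (if j = l then 1 else 0)) f
      = (\<Sum>l\<in>{1..topidx G}. if l = j then pd (wcoord G j) f else 0)"
    unfolding vert_def by (rule sum.cong) (auto simp: sconst_smult[OF Cinf_pd[OF assms(1)]])
  then show ?thesis using assms(2) by simp
qed

lemma dvec_eq_vert:
  assumes "f \<in> Cinf A" "j \<le> topidx G"
  shows "dvec G \<mu> j f = vert G (dcoef G \<mu> j) f"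
proof (cases "j = 0")
  case True
  then show ?thesis by (simp add: dvec_def vert_def dcoef_def cmul_sum)
next
  case False
  have "vert G (dcoef G \<mu> j) f = vert G (\<lambda>l. sconst (if j = l then 1 else 0)) f"
    by (rule vert_cong) (simp add: dcoef_def False)
  also have "\<dots> = pd (wcoord G j) f"
    by (rule vert_sconst_delta[OF assms(1)]) (use False assms(2) in auto)
  finally show ?thesis using False by (simp add: dvec_def)
qed

lemma realisation_eq_vert:
  assumes "f \<in> Cinf A"
  shows "realisation G \<mu> M f = vert G (rcoef G \<mu> M) f"
proof -
  have "realisation G \<mu> M f
      = (\<Sum>i\<le>topidx G. \<Sum>j\<le>topidx G. \<Sum>l\<in>{1..topidx G}.
          cmul (M i j) (wvec G \<mu> i \<star> dcoef G \<mu> j l \<star> pd (wcoord G l) f))"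
    unfolding realisation_def
    by (intro sum.cong refl) (simp add: dvec_eq_vert[OF assms] vert_def smult_sum_right cmul_sum smult_assoc)
  also have "\<dots> = (\<Sum>i\<le>topidx G. \<Sum>l\<in>{1..topidx G}. \<Sum>j\<le>topidx G.
          cmul (M i j) (wvec G \<mu> i \<star> dcoef G \<mu> j l \<star> pd (wcoord G l) f))"
    by (rule sum.cong[OF refl], rule sum.swap)
  also have "\<dots> = (\<Sum>l\<in>{1..topidx G}. \<Sum>i\<le>topidx G. \<Sum>j\<le>topidx G.
          cmul (M i j) (wvec G \<mu> i \<star> dcoef G \<mu> j l \<star> pd (wcoord G l) f))"
    by (rule sum.swap)
  also have "\<dots> = vert G (rcoef G \<mu> M) f"
    by (simp add: vert_def rcoef_def smult_sum_left)
  finally show ?thesis .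
qed

lemma has_parity_wvec: "has_parity (ipar G i) (wvec G \<mu> i)"
  using has_parity_coord_fun[of "wcoord G i"] by (simp add: wvec_def)

lemma vert_parity_dcoef: "vert_parity G (ipar G j) (dcoef G \<mu> j)"
  unfolding vert_parity_def
proof
  fix l assume "l \<in> {1..topidx G}"
  show "has_parity ((ipar G j + cpar (wcoord G l)) mod 2) (dcoef G \<mu> j l)"
    using has_parity_coord_fun[of "wcoord G l"]
    by (cases "j = l") (auto simp: dcoef_def intro!: has_parity_cmul)
qed

lemma mat_part_nonzero:
  assumes "mat_part G m M = M" "M i j \<noteq> 0"
  shows "(ipar G i + ipar G j) mod 2 = m"
  using fun_cong[OF fun_cong[OF assms(1), of i], of j] assms(2) 
  by (simp add: mat_part_def split: if_splits)

lemma vert_parity_rcoef: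
  assumes "mat_part G m M = M"
  shows "vert_parity G m (rcoef G \<mu> M)"
  unfolding vert_parity_def
proof
  fix l assume l: "l \<in> {1..topidx G}"
  have "has_parity ((m + cpar (wcoord G l)) mod 2) (cmul (M i j) (wvec G \<mu> i \<star> dcoef G \<mu> j l))"
    for i j
  proof (cases "M i j = 0")
    case False
    then have m: "m = (ipar G i + ipar G j) mod 2" using mat_part_nonzero[OF assms] by simp
    have "has_parity ((ipar G j + cpar (wcoord G l)) mod 2) (dcoef G \<mu> j l)"
      using vert_parity_dcoef l by (auto simp: vert_parity_def)
    from has_parity_smult[OF has_parity_wvec this refl] show ?thesis
      by (intro has_parity_cmul) (simp add: m mod_simps add.assoc)
  qed simp
  then show "has_parity ((m + cpar (wcoord G l)) mod 2) (rcoef G \<mu> M l)"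
    unfolding rcoef_def by (intro has_parity_sum)
qed

text \<open>The scalar identity behind \<open>wd_commutator\<close>. There \<open>a\<close>,
  \<open>b\<close>, \<open>c\<close>, \<open>d\<close> are the exchange signs of the index pairs
  (i,k), (j,k), (j,l), (l,i), and \<open>m\<close>, \<open>n\<close> are 1/\<mu> or 0 according to
  whether \<open>j\<close> and \<open>l\<close> are 0. The conditions on \<open>m\<close> and
  \<open>n\<close> hold because the index 0 is even.\<close>

lemma commutator_signs:
  fixes a b c d s :: real
  assumes "a * a = 1" "d * d = 1" "s = a * d * b * c" "m * (b - 1) = 0" "n * (s * a - b) = 0"
  shows "k * x - m * q + b * (c * y + (m * q - n * r)) - s * (l * z - n * (a * r) + d * (a * y))
    = k * x - s * l * z"
proof -
  have "s * (d * a) = (a * a) * (d * d) * (b * c)" unfolding assms(3) by (simp only: mult_ac)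
  then have "s * (d * (a * y)) = b * (c * y)" by (simp add: assms(1,2) flip: mult.assoc)
  moreover have "b * (m * q) = m * q" "s * (n * (a * r)) = b * (n * r)"
    using assms(4,5) by (auto simp: right_diff_distrib)
  ultimately show ?thesis by (simp only: right_diff_distrib distrib_left mult.assoc)
qed

lemma sum_swap3:
  "(\<Sum>a\<in>A. \<Sum>b\<in>B. \<Sum>d\<in>D. g a b d) = (\<Sum>d\<in>D. \<Sum>a\<in>A. \<Sum>b\<in>B. g a b d)"
proof -
  have "(\<Sum>a\<in>A. \<Sum>b\<in>B. \<Sum>d\<in>D. g a b d) = (\<Sum>a\<in>A. \<Sum>d\<in>D. \<Sum>b\<in>B. g a b d)"
    by (rule sum.cong[OF refl], rule sum.swap)
  also have "\<dots> = (\<Sum>d\<in>D. \<Sum>a\<in>A. \<Sum>b\<in>B. g a b d)" by (rule sum.swap)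
  finally show ?thesis .
qed

lemma sum_swap4:
  fixes h :: "'a \<Rightarrow> 'b \<Rightarrow> 'c \<Rightarrow> 'c2 \<Rightarrow> 'd::comm_monoid_add"
  shows "(\<Sum>a\<in>A. \<Sum>b\<in>B. \<Sum>c\<in>C. \<Sum>d\<in>D. h a b c d) = (\<Sum>c\<in>C. \<Sum>d\<in>D. \<Sum>a\<in>A. \<Sum>b\<in>B. h a b c d)"
proof -
  have "(\<Sum>a\<in>A. \<Sum>b\<in>B. \<Sum>c\<in>C. \<Sum>d\<in>D. h a b c d) = (\<Sum>c\<in>C. \<Sum>a\<in>A. \<Sum>b\<in>B. \<Sum>d\<in>D. h a b c d)"
    by (rule sum_swap3)
  also have "\<dots> = (\<Sum>c\<in>C. \<Sum>d\<in>D. \<Sum>a\<in>A. \<Sum>b\<in>B. h a b c d)"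
    by (rule sum.cong[OF refl], rule sum_swap3)
  finally show ?thesis .
qed

section \<open>The commutation relations of the operators w^i d_j\<close>

context
  fixes G :: matalg and \<mu> :: real and A :: "coord set"
  assumes \<mu>: "\<mu> \<noteq> 0" and fibre: "wcoord G ` {1..topidx G} \<subseteq> A"
begin

lemma Cinf_wcoord: "l \<in> {1..topidx G} \<Longrightarrow> coord_fun (wcoord G l) \<in> Cinf A"
  using fibre by (intro Cinf_coord_fun) auto

lemma Cinf_wvec: "i \<le> topidx G \<Longrightarrow> wvec G \<mu> i \<in> Cinf A"
  using Cinf_wcoord[of i] by (simp add: wvec_def)

lemma Cinf_dcoef: "l \<in> {1..topidx G} \<Longrightarrow> dcoef G \<mu> j l \<in> Cinf A"
  using Cinf_wcoord[of l] by (simp add: dcoef_def Cinf_cmul)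

lemma Cinf_rcoef: "l \<in> {1..topidx G} \<Longrightarrow> rcoef G \<mu> M l \<in> Cinf A"
  unfolding rcoef_def by (intro Cinf_sum Cinf_cmul Cinf_smult Cinf_wvec Cinf_dcoef) auto

lemma Cinf_dvec:
  assumes "f \<in> Cinf A" "j \<le> topidx G"
  shows "dvec G \<mu> j f \<in> Cinf A"
  unfolding dvec_eq_vert[OF assms] by (rule vert_Cinf[OF assms(1) Cinf_dcoef])

lemma Cinf_realisation:
  assumes "f \<in> Cinf A" 
  shows "realisation G \<mu> M f \<in> Cinf A"
  unfolding realisation_eq_vert[OF assms] by (rule vert_Cinf[OF assms Cinf_rcoef])

lemma dvec_sum:
  assumes "\<And>i. i \<in> I \<Longrightarrow> f i \<in> Cinf A" "j \<le> topidx G"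
  shows "dvec G \<mu> j (\<Sum>i\<in>I. f i) = (\<Sum>i\<in>I. dvec G \<mu> j (f i))"
proof -
  have "dvec G \<mu> j (\<Sum>i\<in>I. f i) = vert G (dcoef G \<mu> j) (\<Sum>i\<in>I. f i)"
    by (rule dvec_eq_vert[OF Cinf_sum[OF assms(1)] assms(2)])
  also have "\<dots> = (\<Sum>i\<in>I. vert G (dcoef G \<mu> j) (f i))" by (rule vert_sum[OF assms(1)])
  also have "\<dots> = (\<Sum>i\<in>I. dvec G \<mu> j (f i))"
    by (rule sum.cong[OF refl]) (simp add: dvec_eq_vert[OF assms(1) assms(2)])
  finally show ?thesis .
qed

lemma dvec_cmul:
  assumes "f \<in> Cinf A" "j \<le> topidx G"
  shows "dvec G \<mu> j (cmul c f) = cmul c (dvec G \<mu> j f)"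
  by (simp add: dvec_eq_vert[OF _ assms(2)] Cinf_cmul[OF assms(1)] assms(1) vert_cmul[OF assms(1)]
      dvec_eq_vert[OF Cinf_cmul[OF assms(1)] assms(2)] dvec_eq_vert[OF assms])

lemma dvec_smult:
  assumes "f \<in> Cinf A" "g \<in> Cinf A" "j \<le> topidx G"
  shows "dvec G \<mu> j (f \<star> g) = dvec G \<mu> j f \<star> g + sinv (ipar G j) f \<star> dvec G \<mu> j g"
  unfolding dvec_eq_vert[OF Cinf_smult[OF assms(1,2)] assms(3)] dvec_eq_vert[OF assms(1,3)]
    dvec_eq_vert[OF assms(2,3)]
  by (rule vert_smult[OF assms(1,2) vert_parity_dcoef])

text \<open>The Euler field in \<open>dvec\<close> at index 0 disturbs the duality. For
  \<open>i = j = 0\<close> the two terms cancel, in accordance with the constant first entry \<mu>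
  of \<open>wvec\<close>.\<close>

lemma dvec_wvec:
  assumes "i \<le> topidx G" "j \<le> topidx G"
  shows "dvec G \<mu> j (wvec G \<mu> i)
    = sconst (if j = i then 1 else 0) - (if j = 0 then cmul (1 / \<mu>) (wvec G \<mu> i) else 0)"
proof (cases "i = 0")
  case True
  have "cmul (1 / \<mu>) (sconst \<mu>) = sconst 1"
    using \<mu> by (auto simp: cmul_def sconst_def fun_eq_iff)
  then show ?thesis using True by (simp add: wvec_def dvec_def)
next
  case False
  then have i: "i \<in> {1..topidx G}" using assms by auto
  have "dvec G \<mu> j (wvec G \<mu> i) = dcoef G \<mu> j i"
    unfolding dvec_eq_vert[OF Cinf_wvec[OF assms(1)] assms(2)]
    using vert_coord_fun[of i G "dcoef G \<mu> j", OF i Cinf_dcoef[OF i]] False by (simp add: wvec_def)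
  then show ?thesis using False by (auto simp: dcoef_def wvec_def simp flip: cmul_minus_left)
qed

text \<open>The commutator of a fibre derivative with the Euler field is that derivative itself; the
  factor -1/\<mu> rescales it.\<close>

lemma pd_dvec_0:
  assumes "f \<in> Cinf A" "k \<in> {1..topidx G}"
  shows "pd (wcoord G k) (dvec G \<mu> 0 f) = dvec G \<mu> 0 (pd (wcoord G k) f) - cmul (1 / \<mu>) (pd (wcoord G k) f)"
proof -
  let ?W = "vert G (\<lambda>l. coord_fun (wcoord G l))"
  have W: "dvec G \<mu> 0 g = cmul (- 1 / \<mu>) (?W g)" for g by (simp add: dvec_def vert_def)
  have "vert_parity G 0 (\<lambda>l. coord_fun (wcoord G l))"
    using has_parity_coord_fun[of "wcoord G _"] by (simp add: vert_parity_def)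
  from pd_vert[OF assms(1) Cinf_wcoord this, of "wcoord G k"]
  have "pd (wcoord G k) (?W f)
      = vert G (\<lambda>l. pd (wcoord G k) (coord_fun (wcoord G l))) f + ?W (pd (wcoord G k) f)"
    by simp
  also have "vert G (\<lambda>l. pd (wcoord G k) (coord_fun (wcoord G l))) f = pd (wcoord G k) f"
    using vert_sconst_delta[OF assms] by (simp add: pd_coord_fun wcoord_inject)
  finally have "pd (wcoord G k) (?W f) = pd (wcoord G k) f + ?W (pd (wcoord G k) f)" .
  moreover have "pd (wcoord G k) (cmul (- 1 / \<mu>) (?W f)) = cmul (- 1 / \<mu>) (pd (wcoord G k) (?W f))"
    by (rule pd_cmul[OF vert_Cinf[OF assms(1) Cinf_wcoord]])
  ultimately show ?thesis
    unfolding W by (simp add: cmul_add_right cmul_minus_left)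
qed

text \<open>Derivatives by fibre coordinates supercommute; the terms in 1/\<mu> come from the Euler
  field at index 0 and cancel each other when both indices are 0.\<close>

lemma dvec_commute:
  assumes "f \<in> Cinf A" "j \<le> topidx G" "k \<le> topidx G"
  shows "dvec G \<mu> j (dvec G \<mu> k f) = cmul ((- 1) ^ (ipar G j * ipar G k)) (dvec G \<mu> k (dvec G \<mu> j f))
    + (cmul (if j = 0 then 1 / \<mu> else 0) (dvec G \<mu> k f) - cmul (if k = 0 then 1 / \<mu> else 0) (dvec G \<mu> j f))"
proof -
  have d: "dvec G \<mu> i g = pd (wcoord G i) g" if "i \<noteq> 0" for i g using that by (simp add: dvec_def)
  consider "j = 0" "k = 0" | "j = 0" "k \<noteq> 0" | "j \<noteq> 0" "k = 0" | "j \<noteq> 0" "k \<noteq> 0" by blast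
  then show ?thesis
  proof cases
    case 2
    then have "k \<in> {1..topidx G}" using assms by auto
    from pd_dvec_0[OF assms(1) this] show ?thesis using 2 by (simp add: d)
  next
    case 3
    then have "j \<in> {1..topidx G}" using assms by auto
    from pd_dvec_0[OF assms(1) this] show ?thesis using 3 by (simp add: d)
  next
    case 4
    then show ?thesis using pd_commute[OF assms(1), of "wcoord G j" "wcoord G k"] by (simp add: d)
  qed simp
qed

abbreviation wd :: "nat \<Rightarrow> nat \<Rightarrow> vfield"
  where "wd i j f \<equiv> wvec G \<mu> i \<star> dvec G \<mu> j f"

lemma wd_wd:
  assumes "f \<in> Cinf A" "i \<le> topidx G" "j \<le> topidx G" "k \<le> topidx G" "l \<le> topidx G"
  shows "wd i j (wd k l f) = cmul (if j = k then 1 else 0) (wd i l f)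
    - cmul (if j = 0 then 1 / \<mu> else 0) (wvec G \<mu> i \<star> (wvec G \<mu> k \<star> dvec G \<mu> l f))
    + cmul ((- 1) ^ (ipar G j * ipar G k)) (wvec G \<mu> i \<star> (wvec G \<mu> k \<star> dvec G \<mu> j (dvec G \<mu> l f)))"
proof -
  have c: "dvec G \<mu> l f \<in> Cinf A" by (rule Cinf_dvec[OF assms(1,5)])
  show ?thesis
    by (simp add: dvec_smult[OF Cinf_wvec[OF assms(4)] c assms(3)] dvec_wvec[OF assms(4,3)]
        smult_add_right smult_diff_left smult_diff_right sconst_smult[OF c]
        sinv_parity[OF has_parity_wvec])
qed

text \<open>The relations of the matrix units of gl. After the second-order terms have been brought
  to the same order, the 1/\<mu> terms of \<open>dvec_wvec\<close> cancel those of
  \<open>dvec_commute\<close>.\<close>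

lemma wd_commutator:
  assumes "f \<in> Cinf A" "i \<le> topidx G" "j \<le> topidx G" "k \<le> topidx G" "l \<le> topidx G"
    and s: "s = (- 1) ^ ((ipar G i + ipar G j) * (ipar G k + ipar G l))"
  shows "wd i j (wd k l f) - cmul s (wd k l (wd i j f))
    = cmul (if j = k then 1 else 0) (wd i l f) - cmul (s * (if l = i then 1 else 0)) (wd k j f)"
proof -
  let ?Q = "\<lambda>g. wvec G \<mu> i \<star> (wvec G \<mu> k \<star> g)"
  have Q: "wvec G \<mu> k \<star> (wvec G \<mu> i \<star> g) = cmul ((- 1) ^ (ipar G i * ipar G k)) (?Q g)" for g
  proof -
    have "wvec G \<mu> k \<star> wvec G \<mu> i = wvec G \<mu> i \<star> sinv (ipar G i) (wvec G \<mu> k)"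
      by (rule smult_commute[OF has_parity_wvec])
    then show ?thesis by (simp add: sinv_parity[OF has_parity_wvec] flip: smult_assoc)
  qed
  have c: "?Q (dvec G \<mu> j (dvec G \<mu> l f)) = cmul ((- 1) ^ (ipar G j * ipar G l)) (?Q (dvec G \<mu> l (dvec G \<mu> j f)))
    + (cmul (if j = 0 then 1 / \<mu> else 0) (?Q (dvec G \<mu> l f)) - cmul (if l = 0 then 1 / \<mu> else 0) (?Q (dvec G \<mu> j f)))"
    unfolding dvec_commute[OF assms(1,3,5)] by (simp add: smult_add_right smult_diff_right)
  have E1: "wd i j (wd k l f) = cmul (if j = k then 1 else 0) (wd i l f)
      - cmul (if j = 0 then 1 / \<mu> else 0) (?Q (dvec G \<mu> l f))
      + cmul ((- 1) ^ (ipar G j * ipar G k)) (cmul ((- 1) ^ (ipar G j * ipar G l)) (?Q (dvec G \<mu> l (dvec G \<mu> j f)))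
        + (cmul (if j = 0 then 1 / \<mu> else 0) (?Q (dvec G \<mu> l f)) - cmul (if l = 0 then 1 / \<mu> else 0) (?Q (dvec G \<mu> j f))))"
    unfolding wd_wd[OF assms(1,2,3,4,5)] c ..
  have E2: "wd k l (wd i j f) = cmul (if l = i then 1 else 0) (wd k j f)
      - cmul (if l = 0 then 1 / \<mu> else 0) (cmul ((- 1) ^ (ipar G i * ipar G k)) (?Q (dvec G \<mu> j f)))
      + cmul ((- 1) ^ (ipar G l * ipar G i)) (cmul ((- 1) ^ (ipar G i * ipar G k)) (?Q (dvec G \<mu> l (dvec G \<mu> j f))))"
    unfolding wd_wd[OF assms(1,4,5,2,3)] Q ..
  have sgn: "s = (- 1) ^ (ipar G i * ipar G k) * (- 1) ^ (ipar G l * ipar G i)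
      * (- 1) ^ (ipar G j * ipar G k) * (- 1) ^ (ipar G j * ipar G l)"
    unfolding s by (simp add: algebra_simps power_add)
  have "wd i j (wd k l f) p S - s * wd k l (wd i j f) p S
    = (if j = k then 1 else 0) * wd i l f p S - s * (if l = i then 1 else 0) * wd k j f p S" for p S
    unfolding E1 E2 cmul_def plus_fun_apply minus_apply
    by (rule commutator_signs[OF _ _ sgn]) (auto simp: sgn minus_one_power_iff)
  then show ?thesis by (simp add: fun_eq_iff cmul_def)
qed

lemma sum_delta_mat_mul:
  "(\<Sum>i\<le>n. \<Sum>j\<le>n. \<Sum>k\<le>n. \<Sum>l\<le>n. cmul (M i j * N k l * (if j = k then 1 else 0)) (F i l))
    = (\<Sum>i\<le>n. \<Sum>l\<le>n. cmul (\<Sum>j\<le>n. M i j * N j l) (F i l))" for n :: nat and M N :: rmat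
proof (rule sum.cong[OF refl])
  fix i
  have "(\<Sum>k\<le>n. \<Sum>l\<le>n. cmul (M i j * N k l * (if j = k then 1 else 0)) (F i l))
      = (\<Sum>l\<le>n. cmul (M i j * N j l) (F i l))" if "j \<le> n" for j
  proof -
    have "(\<Sum>k\<le>n. \<Sum>l\<le>n. cmul (M i j * N k l * (if j = k then 1 else 0)) (F i l))
      = (\<Sum>k\<le>n. if k = j then \<Sum>l\<le>n. cmul (M i j * N j l) (F i l) else 0)"
      by (rule sum.cong) auto
    also have "\<dots> = (\<Sum>l\<le>n. cmul (M i j * N j l) (F i l))" using that by simp
    finally show ?thesis .
  qed
  then have "(\<Sum>j\<le>n. \<Sum>k\<le>n. \<Sum>l\<le>n. cmul (M i j * N k l * (if j = k then 1 else 0)) (F i l))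
      = (\<Sum>j\<le>n. \<Sum>l\<le>n. cmul (M i j * N j l) (F i l))"
    by (rule sum.cong[OF refl]) simp
  also have "\<dots> = (\<Sum>l\<le>n. \<Sum>j\<le>n. cmul (M i j * N j l) (F i l))" by (rule sum.swap)
  finally show "(\<Sum>j\<le>n. \<Sum>k\<le>n. \<Sum>l\<le>n. cmul (M i j * N k l * (if j = k then 1 else 0)) (F i l))
      = (\<Sum>l\<le>n. cmul (\<Sum>j\<le>n. M i j * N j l) (F i l))" by (simp add: sum_cmul)
qed

lemma realisation_realisation:
  assumes "f \<in> Cinf A"
  shows "realisation G \<mu> M (realisation G \<mu> N f)
    = (\<Sum>i\<le>topidx G. \<Sum>j\<le>topidx G. \<Sum>k\<le>topidx G. \<Sum>l\<le>topidx G. cmul (M i j * N k l) (wd i j (wd k l f)))"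
proof -
  have C: "wd k l f \<in> Cinf A" if "k \<le> topidx G" "l \<le> topidx G" for k l
    using that by (intro Cinf_smult Cinf_wvec Cinf_dvec assms)
  have "wd i j (realisation G \<mu> N f) = (\<Sum>k\<le>topidx G. \<Sum>l\<le>topidx G. cmul (N k l) (wd i j (wd k l f)))"
    if "j \<le> topidx G" for i j
  proof -
    have "dvec G \<mu> j (realisation G \<mu> N f)
        = (\<Sum>k\<le>topidx G. dvec G \<mu> j (\<Sum>l\<le>topidx G. cmul (N k l) (wd k l f)))"
      unfolding realisation_def
      by (rule dvec_sum) (use that in \<open>auto intro!: Cinf_sum Cinf_cmul C\<close>)
    also have "\<dots> = (\<Sum>k\<le>topidx G. \<Sum>l\<le>topidx G. cmul (N k l) (dvec G \<mu> j (wd k l f)))"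
    proof (rule sum.cong[OF refl])
      fix k assume k: "k \<in> {..topidx G}"
      have "dvec G \<mu> j (\<Sum>l\<le>topidx G. cmul (N k l) (wd k l f))
          = (\<Sum>l\<le>topidx G. dvec G \<mu> j (cmul (N k l) (wd k l f)))"
        by (rule dvec_sum) (use that k in \<open>auto intro!: Cinf_cmul C\<close>)
      also have "\<dots> = (\<Sum>l\<le>topidx G. cmul (N k l) (dvec G \<mu> j (wd k l f)))"
        using k that by (intro sum.cong refl dvec_cmul C) auto
      finally show "dvec G \<mu> j (\<Sum>l\<le>topidx G. cmul (N k l) (wd k l f))
        = (\<Sum>l\<le>topidx G. cmul (N k l) (dvec G \<mu> j (wd k l f)))" .
    qed
    finally show ?thesis by (simp add: smult_sum_right)
  qed
  then show ?thesis
    unfolding realisation_def[of G \<mu> M] by (intro sum.cong refl) (simp add: cmul_sum)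
qed

lemma realisation_commutator:
  assumes f: "f \<in> Cinf A" and M: "mat_part G m M = M" and N: "mat_part G n N = N"
  shows "realisation G \<mu> M (realisation G \<mu> N f)
      - cmul ((- 1) ^ (m * n)) (realisation G \<mu> N (realisation G \<mu> M f))
    = realisation G \<mu> (mat_mul G M N - scale_mat ((- 1) ^ (m * n)) (mat_mul G N M)) f"
proof -
  let ?s = "(- 1 :: real) ^ (m * n)"
  let ?K = "{..topidx G}"
  have "realisation G \<mu> N (realisation G \<mu> M f)
      = (\<Sum>k\<in>?K. \<Sum>l\<in>?K. \<Sum>i\<in>?K. \<Sum>j\<in>?K. cmul (N k l * M i j) (wd k l (wd i j f)))"
    by (rule realisation_realisation[OF f])
  also have "\<dots> = (\<Sum>i\<in>?K. \<Sum>j\<in>?K. \<Sum>k\<in>?K. \<Sum>l\<in>?K. cmul (N k l * M i j) (wd k l (wd i j f)))"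
    by (rule sum_swap4)
  finally have NM: "realisation G \<mu> N (realisation G \<mu> M f)
      = (\<Sum>i\<in>?K. \<Sum>j\<in>?K. \<Sum>k\<in>?K. \<Sum>l\<in>?K. cmul (M i j * N k l) (wd k l (wd i j f)))"
    by (simp add: mult.commute)
  \<comment> \<open>Homogeneity of \<open>M\<close> and \<open>N\<close> makes the sign of
    \<open>wd_commutator\<close> equal to \<open>?s\<close> wherever both entries are nonzero; zero
    entries contribute nothing.\<close>
  have pairwise: "cmul (M i j * N k l) (wd i j (wd k l f)) - cmul ?s (cmul (M i j * N k l) (wd k l (wd i j f)))
      = cmul (M i j * N k l * (if j = k then 1 else 0)) (wd i l f)
        - cmul ?s (cmul (N k l * M i j * (if l = i then 1 else 0)) (wd k j f))"
    if ij: "i \<in> ?K" "j \<in> ?K" "k \<in> ?K" "l \<in> ?K" for i j k l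
  proof (cases "M i j * N k l = 0")
    case False
    then have p: "(ipar G i + ipar G j) mod 2 = m" "(ipar G k + ipar G l) mod 2 = n"
      using mat_part_nonzero[OF M] mat_part_nonzero[OF N] by auto
    have "?s = (- 1) ^ ((ipar G i + ipar G j) * (ipar G k + ipar G l))"
      unfolding p[symmetric] neg_one_power_mod_2
      using neg_one_power_mod_2[of "ipar G k + ipar G l" "ipar G i + ipar G j"]
      by (simp only: mult.commute)
    then have "wd i j (wd k l f) - cmul ?s (wd k l (wd i j f))
      = cmul (if j = k then 1 else 0) (wd i l f) - cmul (?s * (if l = i then 1 else 0)) (wd k j f)"
      using ij by (intro wd_commutator[OF f]) auto
    then have "cmul (M i j * N k l) (wd i j (wd k l f) - cmul ?s (wd k l (wd i j f)))
      = cmul (M i j * N k l) (cmul (if j = k then 1 else 0) (wd i l f) - cmul (?s * (if l = i then 1 else 0)) (wd k j f))"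
      by simp
    then show ?thesis by (simp only: cmul_diff_right cmul_cmul mult_ac)
  next
    case True
    then have "N k l * M i j = 0" by (simp only: mult.commute)
    then show ?thesis using True by (simp only: cmul_zero mult_zero_left)
  qed
  have "realisation G \<mu> M (realisation G \<mu> N f) - cmul ?s (realisation G \<mu> N (realisation G \<mu> M f))
    = (\<Sum>i\<in>?K. \<Sum>j\<in>?K. \<Sum>k\<in>?K. \<Sum>l\<in>?K.
        cmul (M i j * N k l) (wd i j (wd k l f)) - cmul ?s (cmul (M i j * N k l) (wd k l (wd i j f))))"
    unfolding realisation_realisation[OF f, of M N] NM cmul_sum by (simp only: sum_subtractf)
  also have "\<dots> = (\<Sum>i\<in>?K. \<Sum>j\<in>?K. \<Sum>k\<in>?K. \<Sum>l\<in>?K.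
        cmul (M i j * N k l * (if j = k then 1 else 0)) (wd i l f)
        - cmul ?s (cmul (N k l * M i j * (if l = i then 1 else 0)) (wd k j f)))"
    by (intro sum.cong refl pairwise)
  also have "\<dots> = (\<Sum>i\<in>?K. \<Sum>j\<in>?K. \<Sum>k\<in>?K. \<Sum>l\<in>?K.
        cmul (M i j * N k l * (if j = k then 1 else 0)) (wd i l f))
      - cmul ?s (\<Sum>i\<in>?K. \<Sum>j\<in>?K. \<Sum>k\<in>?K. \<Sum>l\<in>?K.
        cmul (N k l * M i j * (if l = i then 1 else 0)) (wd k j f))"
    by (simp only: sum_subtractf cmul_sum)
  also have "(\<Sum>i\<in>?K. \<Sum>j\<in>?K. \<Sum>k\<in>?K. \<Sum>l\<in>?K.
        cmul (N k l * M i j * (if l = i then 1 else 0)) (wd k j f))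
      = (\<Sum>k\<in>?K. \<Sum>l\<in>?K. \<Sum>i\<in>?K. \<Sum>j\<in>?K.
        cmul (N k l * M i j * (if l = i then 1 else 0)) (wd k j f))"
    by (rule sum_swap4)
  also have "(\<Sum>i\<in>?K. \<Sum>j\<in>?K. \<Sum>k\<in>?K. \<Sum>l\<in>?K.
        cmul (M i j * N k l * (if j = k then 1 else 0)) (wd i l f))
      - cmul ?s (\<Sum>k\<in>?K. \<Sum>l\<in>?K. \<Sum>i\<in>?K. \<Sum>j\<in>?K.
        cmul (N k l * M i j * (if l = i then 1 else 0)) (wd k j f))
    = realisation G \<mu> (mat_mul G M N - scale_mat ((- 1) ^ (m * n)) (mat_mul G N M)) f"
    unfolding sum_delta_mat_mul
    by (simp add: realisation_def mat_mul_def scale_mat_def cmul_diff_left sum_subtractf cmul_sum)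
  finally show ?thesis .
qed

end

section \<open>Structure constants and matrix-valued forms\<close>

text \<open>For odd \<open>m\<close>, \<open>sinv m\<close> is twice the even projection minus the
  identity, and \<open>Dtot\<close> commutes with that projection.\<close>

lemma Dtot_sinv:
  assumes "f \<in> Cinf A"
  shows "Dtot \<E> v (sinv m f) = sinv m (Dtot \<E> v f)"
proof (cases "even m")
  case True
  then show ?thesis by (simp add: sinv_even)
next
  case False
  have s: "sinv m g = cmul 2 (spart 0 g) - g" for g
  proof -
    have "sinv m g = sinv 1 g" using False by (intro sinv_cong) simp
    then show ?thesis unfolding spart_eq_sinv[OF pos2] by (simp add: fun_eq_iff cmul_def field_simps)
  qed
  show ?thesis unfolding s
    using Dtot_diff[OF Cinf_cmul[OF Cinf_spart[OF assms]] assms]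
    by (simp add: Dtot_cmul[OF Cinf_spart[OF assms]] Dtot_spart[OF assms pos2])
qed

lemma mat_mul_zero [simp]: "mat_mul G 0 N = 0" "mat_mul G M 0 = 0"
  by (simp_all add: mat_mul_def fun_eq_iff)

lemma scale_mat_zero [simp]: "scale_mat c 0 = 0" "scale_mat 0 M = 0"
  by (simp_all add: scale_mat_def fun_eq_iff)

lemma mat_part_homogeneous:
  assumes "mat_part G m M = M"
  shows "mat_part G e M = (if e = m then M else 0)"
proof (intro ext)
  fix i j
  show "mat_part G e M i j = (if e = m then M else 0) i j"
    using mat_part_nonzero[OF assms, of i j] by (auto simp: mat_part_def)
qed

lemma mat_bracket_homogeneous:
  assumes "mat_part G m M = M" "mat_part G n N = N" "m < 2" "n < 2"
  shows "mat_bracket G M N = mat_mul G M N - scale_mat ((- 1) ^ (m * n)) (mat_mul G N M)"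
proof -
  have "m = 0 \<or> m = 1" "n = 0 \<or> n = 1" using assms(3,4) by auto
  then show ?thesis
    unfolding mat_bracket_def mat_part_homogeneous[OF assms(1)] mat_part_homogeneous[OF assms(2)]
    by (elim disjE) (simp_all add: sum_lessThan_2)
qed

lemma mat_bracket_nonzero:
  assumes "mat_part G m M = M" "mat_part G n N = N" "m < 2" "n < 2"
    and nz: "mat_bracket G M N i j \<noteq> 0"
  shows "(ipar G i + ipar G j) mod 2 = (m + n) mod 2"
proof -
  have prod: "(ipar G i + ipar G j) mod 2 = (m + n) mod 2"
    if "mat_part G m M = M" "mat_part G n N = N" "mat_mul G M N i j \<noteq> 0" for M N m n
  proof -
    from that(3) obtain k where k: "M i k * N k j \<noteq> 0"
      unfolding mat_mul_def by (rule sum.not_neutral_contains_not_neutral)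
    then have "(ipar G i + ipar G k) mod 2 = m" "(ipar G k + ipar G j) mod 2 = n"
      using mat_part_nonzero[OF that(1)] mat_part_nonzero[OF that(2)] by auto
    then show ?thesis
      using parity_cancel[of "ipar G i" "ipar G k" "ipar G j"] by simp
  qed
  have "mat_mul G M N i j \<noteq> 0 \<or> mat_mul G N M i j \<noteq> 0"
    using nz by (auto simp: mat_bracket_homogeneous[OF assms(1-4)] scale_mat_def)
  then show ?thesis
    using prod[OF assms(1,2)] prod[OF assms(2,1)] by (auto simp: add.commute)
qed

lemma sum_mat_eval: "(\<Sum>k\<in>K. scale_mat (c k) (e k)) i j = (\<Sum>k\<in>K. c k * e k i j)"
  by (simp add: sum_fun_eval scale_mat_def)

text \<open>The parity rule for the constants is what later allows signs to be distributed over the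
  coefficients of a bracket.\<close>

lemma structure_constants:
  assumes "lie_subsuperalgebra G" "homogeneous_basis G"
  obtains c where "\<And>x y i j. x < gdim G \<Longrightarrow> y < gdim G \<Longrightarrow>
      mat_bracket G (gbasis G x) (gbasis G y) i j = (\<Sum>n<gdim G. c x y n * gbasis G n i j)"
    "\<And>x y n. n < gdim G \<Longrightarrow> c x y n \<noteq> 0 \<Longrightarrow> bpar G n = (bpar G x + bpar G y) mod 2"
proof -
  have hom: "gbasis G x \<in> alg G" "bpar G x < 2" "mat_part G (bpar G x) (gbasis G x) = gbasis G x"
    if "x < gdim G" for x
    using assms(2) that unfolding homogeneous_basis_def by blast+
  have "\<exists>c. mat_bracket G (gbasis G x) (gbasis G y) = (\<Sum>n<gdim G. scale_mat (c n) (gbasis G n))"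
    if "x < gdim G" "y < gdim G" for x y
    using assms hom(1)[OF that(1)] hom(1)[OF that(2)]
    unfolding lie_subsuperalgebra_def homogeneous_basis_def by blast
  then obtain d where d: "\<And>x y. x < gdim G \<Longrightarrow> y < gdim G \<Longrightarrow>
      mat_bracket G (gbasis G x) (gbasis G y) = (\<Sum>n<gdim G. scale_mat (d x y n) (gbasis G n))"
    by metis
  \<comment> \<open>Discarding the coefficients of the wrong parity changes no matrix entry: at
    position (i, j) only basis elements of parity \<open>ipar G i + ipar G j\<close> modulo 2 are
    nonzero, and the bracket is homogeneous too.\<close>
  define c where "c x y n = (if bpar G n = (bpar G x + bpar G y) mod 2 then d x y n else 0)" for x y n
  show thesis
  proof (rule that)
    show "bpar G n = (bpar G x + bpar G y) mod 2" if "c x y n \<noteq> 0" for x y n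
      using that by (auto simp: c_def split: if_splits)
    fix x y i j assume xy: "x < gdim G" "y < gdim G"
    let ?p = "(bpar G x + bpar G y) mod 2"
    show "mat_bracket G (gbasis G x) (gbasis G y) i j = (\<Sum>n<gdim G. c x y n * gbasis G n i j)"
    proof (cases "(ipar G i + ipar G j) mod 2 = ?p")
      case True
      have "d x y n * gbasis G n i j = c x y n * gbasis G n i j" if "n < gdim G" for n
        using mat_part_nonzero[OF hom(3)[OF that], of i j] True
        by (cases "gbasis G n i j = 0") (auto simp: c_def)
      then show ?thesis unfolding d[OF xy] sum_mat_eval by (intro sum.cong) auto
    next
      case False
      then have "mat_bracket G (gbasis G x) (gbasis G y) i j = 0"
        using mat_bracket_nonzero[OF hom(3)[OF xy(1)] hom(3)[OF xy(2)] hom(2)[OF xy(1)] hom(2)[OF xy(2)]]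
        by blast
      moreover have "c x y n * gbasis G n i j = 0" if "n < gdim G" for n
        using mat_part_nonzero[OF hom(3)[OF that], of i j] False
        by (cases "gbasis G n i j = 0") (auto simp: c_def)
      ultimately show ?thesis by (metis (mono_tags, lifting) lessThan_iff sum.neutral)
    qed
  qed
qed

text \<open>By Gaussian elimination on the coefficient vectors.\<close>

lemma independent_cancel:
  fixes e :: "nat \<Rightarrow> rmat" and f :: "nat \<Rightarrow> superfun"
  assumes add: "\<And>f g. f \<in> V \<Longrightarrow> g \<in> V \<Longrightarrow> f + g \<in> V"
    and cmul: "\<And>c f. f \<in> V \<Longrightarrow> cmul c f \<in> V"
    and indep: "\<And>c. (\<Sum>k<n. scale_mat (c k) (e k)) = 0 \<Longrightarrow> \<forall>k<n. c k = 0"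
    and comb: "\<And>i j. (\<Sum>k<n. cmul (e k i j) (f k)) \<in> V"
    and "k < n"
  shows "f k \<in> V"
  using indep comb \<open>k < n\<close>
proof (induction n arbitrary: e k)
  case (Suc n)
  have "e n \<noteq> 0"
  proof
    assume "e n = 0"
    then have "(\<Sum>k<Suc n. scale_mat (if k = n then 1 else 0) (e k)) = 0"
      by (intro sum.neutral) (auto simp: scale_mat_def fun_eq_iff)
    from Suc.prems(1)[OF this] show False by auto
  qed
  then obtain i0 j0 where nz: "e n i0 j0 \<noteq> 0" by (auto simp: fun_eq_iff)
  \<comment> \<open>Subtracting multiples of \<open>e n\<close> makes every \<open>e' k\<close>
    vanish at the pivot (i0, j0).\<close>
  define r where "r k = e k i0 j0 / e n i0 j0" for k
  define e' where "e' k = e k - scale_mat (r k) (e n)" for k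
  have below: "f k \<in> V" if "k < n" for k
  proof (rule Suc.IH[of e'])
    show "\<forall>k<n. c k = 0" if c: "(\<Sum>k<n. scale_mat (c k) (e' k)) = 0" for c
    proof -
      \<comment> \<open>The last coefficient collects the multiples of \<open>e n\<close> hidden in
        the \<open>e' k\<close>, so a relation among the \<open>e' k\<close> becomes one among the
        \<open>e k\<close>.\<close>
      define c' where "c' k = (if k < n then c k else - (\<Sum>k<n. c k * r k))" for k
      have "(\<Sum>k<Suc n. scale_mat (c' k) (e k)) i j = (\<Sum>k<n. scale_mat (c k) (e' k)) i j" for i j
        unfolding sum_mat_eval
        by (simp add: c'_def e'_def scale_mat_def right_diff_distrib sum_subtractf
            sum_distrib_right mult.assoc)
      then have "(\<Sum>k<Suc n. scale_mat (c' k) (e k)) = 0" using c by (simp add: fun_eq_iff)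
      from Suc.prems(1)[OF this] show ?thesis unfolding c'_def by (metis less_SucI)
    qed
    show "(\<Sum>k<n. cmul (e' k i j) (f k)) \<in> V" for i j
    proof -
      \<comment> \<open>From the combination at (i, j) one subtracts \<open>E\<close> times the
        combination at the pivot, which removes the term with \<open>f n\<close>.\<close>
      define E where "E = e n i j / e n i0 j0"
      have E: "E * e n i0 j0 = e n i j" using nz by (simp add: E_def)
      have "(\<Sum>k<n. cmul (e' k i j) (f k)) p S = ((\<Sum>k<Suc n. cmul (e k i j) (f k))
          + cmul (- E) (\<Sum>k<Suc n. cmul (e k i0 j0) (f k))) p S" for p S
      proof -
        have "(\<Sum>k<n. cmul (e' k i j) (f k)) p S
            = (\<Sum>k<n. e k i j * f k p S - E * (e k i0 j0 * f k p S))"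
          unfolding sum_fun_eval cmul_def
          by (rule sum.cong[OF refl]) (simp add: e'_def scale_mat_def r_def E_def left_diff_distrib)
        also have "\<dots> = (\<Sum>k<n. e k i j * f k p S) - E * (\<Sum>k<n. e k i0 j0 * f k p S)"
          by (simp add: sum_subtractf sum_distrib_left)
        also have "\<dots> = (\<Sum>k<Suc n. e k i j * f k p S) - E * (\<Sum>k<Suc n. e k i0 j0 * f k p S)"
          by (simp add: distrib_left E flip: mult.assoc)
        also have "\<dots> = ((\<Sum>k<Suc n. cmul (e k i j) (f k))
          + cmul (- E) (\<Sum>k<Suc n. cmul (e k i0 j0) (f k))) p S"
          unfolding plus_fun_apply cmul_def sum_fun_eval by (simp only: mult_minus_left diff_conv_add_uminus)
        finally show ?thesis .
      qed
      then have "(\<Sum>k<n. cmul (e' k i j) (f k)) = (\<Sum>k<Suc n. cmul (e k i j) (f k))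
          + cmul (- E) (\<Sum>k<Suc n. cmul (e k i0 j0) (f k))"
        by (intro ext)
      also have "\<dots> \<in> V" by (rule add[OF Suc.prems(2) cmul[OF Suc.prems(2)]])
      finally show ?thesis .
    qed
  qed (rule that)
  show ?case
  proof (cases "k = n")
    case True
    have zero: "0 \<in> V" using cmul[OF Suc.prems(2), of 0] by simp
    have s: "(\<Sum>k<n. cmul (- e k i0 j0) (f k)) \<in> V"
      by (rule sum_closed[OF zero add]) (auto intro: cmul below)
    \<comment> \<open>The combination at the pivot, solved for its last term.\<close>
    have "f n = cmul (1 / e n i0 j0) ((\<Sum>k<Suc n. cmul (e k i0 j0) (f k)) + (\<Sum>k<n. cmul (- e k i0 j0) (f k)))"
      using nz by (simp add: fun_eq_iff sum_fun_eval cmul_def sum_negf)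
    also have "\<dots> \<in> V" by (rule cmul[OF add[OF Suc.prems(2) s]])
    finally show ?thesis unfolding True .
  qed (use below Suc.prems(3) in auto)
qed simp

section \<open>Products, brackets and differentials of matrix-valued horizontal forms\<close>

lemma rho_eval: "rho G \<gamma> i j S = (\<Sum>k<gdim G. cmul (gbasis G k i j) (sinv (bpar G k) (\<gamma> k S)))"
  by (simp add: rho_def)

text \<open>Selecting the component by the independent variable lets one argument treat x and t
  together; it serves for the coefficients of the connection and for the fibre velocities.\<close>

definition acomp :: "(nat \<Rightarrow> superfun) \<Rightarrow> (nat \<Rightarrow> superfun) \<Rightarrow> indep \<Rightarrow> nat \<Rightarrow> superfun"
  where "acomp a b v = (case v of Xvar \<Rightarrow> a | Tvar \<Rightarrow> b)"

lemma hone_eval: "hone (a k) (b k) {v} = acomp a b v k"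
  by (cases v) (auto simp: hone_def acomp_def)

lemma finite_indep_set [simp]: "finite (S :: indep set)"
proof -
  have "S \<subseteq> {Xvar, Tvar}" using indep.exhaust by blast
  then show ?thesis using finite_subset by blast
qed

lemma hone_card: "card S \<noteq> 1 \<Longrightarrow> hone f g S = 0"
  by (auto simp: hone_def)

lemma alpha_form_eval:
  assumes "k < gdim G"
  shows "alpha_form G a b k {v} = acomp a b v k" "card S \<noteq> 1 \<Longrightarrow> alpha_form G a b k S = 0"
  using assms by (simp_all add: alpha_form_def hone_eval hone_card)

lemma zero_curvature_acomp:
  assumes "zero_curvature \<E> G a b" "k < gdim G"
  shows "acomp a b v k \<in> Cinf (jet_coords \<E>)" "has_parity (bpar G k) (acomp a b v k)"
  using assms unfolding zero_curvature_def acomp_def by (cases v; simp)+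

lemma hwedge_eq_0:
  assumes "\<And>S'. S' \<subseteq> S \<Longrightarrow> \<omega> S' = 0 \<or> \<theta> (S - S') = 0"
  shows "hwedge \<omega> \<theta> S = 0"
  unfolding hwedge_def
proof (rule sum.neutral, rule ballI)
  fix S' assume "S' \<in> Pow S"
  then show "cmul (mono_sign S' (S - S')) (\<omega> S' \<star> \<theta> (S - S')) = 0"
    using assms[of S'] by auto
qed

lemma hwedge_singleton:
  "hwedge \<omega> \<theta> {v} = \<omega> {} \<star> \<theta> {v} + \<omega> {v} \<star> \<theta> {}"
proof -
  have "Pow {v} = {{}, {v}}" by auto
  then show ?thesis by (simp add: hwedge_def)
qed

lemma dh_singleton: "dh \<E> \<omega> {v} = Dtot \<E> v (\<omega> {})"
  by (simp add: dh_def)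

lemma mf_prod_zero: "mf_prod G 0 \<tau> = 0" "mf_prod G \<sigma> 0 = 0"
  by (simp_all add: mf_prod_def fun_eq_iff hwedge_def sum_fun_eval smult_def cmul_def sinv_def)

lemma mf_prod_eval:
  "mf_prod G \<sigma> \<tau> i j S
    = (\<Sum>k\<le>topidx G. hwedge (\<lambda>S. sinv (ipar G k + ipar G j) (\<sigma> i k S)) (\<tau> k j) S)"
  by (simp add: mf_prod_def sum_fun_eval)

lemma hwedge_add: "hwedge (\<lambda>S. \<omega> S + \<omega>' S) \<theta> S = hwedge \<omega> \<theta> S + hwedge \<omega>' \<theta> S"
  "hwedge \<omega> (\<lambda>S. \<theta> S + \<theta>' S) S = hwedge \<omega> \<theta> S + hwedge \<omega> \<theta>' S"
  by (simp_all add: hwedge_def smult_add_left smult_add_right cmul_add_right sum.distrib)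

lemma mf_prod_add_left: "mf_prod G (\<sigma> + \<sigma>') \<tau> = mf_prod G \<sigma> \<tau> + mf_prod G \<sigma>' \<tau>"
proof (intro ext)
  fix i j S p T
  have "mf_prod G (\<sigma> + \<sigma>') \<tau> i j S = mf_prod G \<sigma> \<tau> i j S + mf_prod G \<sigma>' \<tau> i j S"
    unfolding mf_prod_eval plus_fun_apply[of \<sigma>] plus_fun_apply[of "\<sigma> _"] plus_fun_apply[of "\<sigma> _ _"]
      sinv_add hwedge_add sum.distrib ..
  then show "mf_prod G (\<sigma> + \<sigma>') \<tau> i j S p T = (mf_prod G \<sigma> \<tau> + mf_prod G \<sigma>' \<tau>) i j S p T"
    by simp
qed

lemma mf_prod_add_right: "mf_prod G \<tau> (\<sigma> + \<sigma>') = mf_prod G \<tau> \<sigma> + mf_prod G \<tau> \<sigma>'"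
proof (intro ext)
  fix i j S p T
  have "(\<sigma> + \<sigma>') k j = (\<lambda>S. \<sigma> k j S + \<sigma>' k j S)" for k
    by (simp add: fun_eq_iff)
  then have "mf_prod G \<tau> (\<sigma> + \<sigma>') i j S = mf_prod G \<tau> \<sigma> i j S + mf_prod G \<tau> \<sigma>' i j S"
    unfolding mf_prod_eval by (simp only: hwedge_add sum.distrib)
  then show "mf_prod G \<tau> (\<sigma> + \<sigma>') i j S p T = (mf_prod G \<tau> \<sigma> + mf_prod G \<tau> \<sigma>') i j S p T"
    by simp
qed

lemma mf_part_decompose: "mf_part G 0 \<sigma> + mf_part G 1 \<sigma> = \<sigma>"
proof (intro ext)
  fix i j S p T
  have "(ipar G i + ipar G j) mod 2 = 0 \<and> (1 + ipar G i + ipar G j) mod 2 = 1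
    \<or> (ipar G i + ipar G j) mod 2 = 1 \<and> (1 + ipar G i + ipar G j) mod 2 = 0"
    using ipar_cases[of G i] ipar_cases[of G j] by (elim disjE) simp_all
  then show "(mf_part G 0 \<sigma> + mf_part G 1 \<sigma>) i j S p T = \<sigma> i j S p T"
    by (auto simp: mf_part_def spart_def)
qed

text \<open>With \<alpha> even and the second degree 0 both sign factors are 1, and the parity parts
  of the second argument add up again.\<close>

lemma mf_bracket_even:
  assumes "mf_part G 0 \<alpha> = \<alpha>" "mf_part G 1 \<alpha> = 0"
  shows "mf_bracket G 1 0 \<alpha> \<sigma> = mf_prod G \<alpha> \<sigma> - mf_prod G \<sigma> \<alpha>"
proof -
  have sc: "mf_scale 1 \<tau> = \<tau>" "mf_scale c 0 = 0" for \<tau> c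
    by (simp_all add: mf_scale_def fun_eq_iff cmul_def)
  have "mf_bracket G 1 0 \<alpha> \<sigma>
      = mf_prod G \<alpha> (mf_part G 0 \<sigma>) + mf_prod G \<alpha> (mf_part G 1 \<sigma>)
        - (mf_prod G (mf_part G 0 \<sigma>) \<alpha> + mf_prod G (mf_part G 1 \<sigma>) \<alpha>)"
    unfolding mf_bracket_def sum_lessThan_2 assms mf_prod_zero
    by (simp only: sc mult_zero_left mult_zero_right power_0 mult_1_left diff_zero add_0_right add_0
        algebra_simps)
  then show ?thesis
    by (simp only: mf_prod_add_left[symmetric] mf_prod_add_right[symmetric] mf_part_decompose)
qed


lemma Cinf_hwedge:
  assumes "\<And>S. \<omega> S \<in> Cinf A" "\<And>S. \<theta> S \<in> Cinf A"
  shows "hwedge \<omega> \<theta> S \<in> Cinf A"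
  unfolding hwedge_def by (intro Cinf_sum Cinf_cmul Cinf_smult assms)

lemma mforms_card: "\<sigma> \<in> mforms \<E> G q \<Longrightarrow> card S \<noteq> q \<Longrightarrow> \<sigma> i j S = 0"
  unfolding mforms_def by blast

lemma mforms_index: "\<sigma> \<in> mforms \<E> G q \<Longrightarrow> \<not> (i \<le> topidx G \<and> j \<le> topidx G) \<Longrightarrow> \<sigma> i j S = 0"
  unfolding mforms_def by blast

lemma mforms_Cinf: "\<sigma> \<in> mforms \<E> G q \<Longrightarrow> \<sigma> i j S \<in> Cinf (jet_coords \<E>)"
  unfolding mforms_def by blast

lemma hwedge_degree:
  assumes "\<And>S. card S \<noteq> r \<Longrightarrow> \<omega> S = 0" "\<And>S. card S \<noteq> s \<Longrightarrow> \<theta> S = 0" "card S \<noteq> r + s"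
  shows "hwedge \<omega> \<theta> S = 0"
proof (rule hwedge_eq_0)
  fix S' assume "S' \<subseteq> S"
  then have "card S = card S' + card (S - S')"
    by (simp add: card_Diff_subset card_mono)
  then have "card S' \<noteq> r \<or> card (S - S') \<noteq> s" using assms(3) by auto
  then show "\<omega> S' = 0 \<or> \<theta> (S - S') = 0" using assms(1,2) by blast
qed

lemma mf_prod_mforms:
  assumes "\<sigma> \<in> mforms \<E> G r" "\<tau> \<in> mforms \<E> G s"
  shows "mf_prod G \<sigma> \<tau> \<in> mforms \<E> G (r + s)"
  unfolding mforms_def mem_Collect_eq
proof (intro allI conjI impI)
  fix i j S
  show "mf_prod G \<sigma> \<tau> i j S \<in> Cinf (jet_coords \<E>)"
    unfolding mf_prod_eval
    by (intro Cinf_sum Cinf_hwedge Cinf_sinv mforms_Cinf[OF assms(1)] mforms_Cinf[OF assms(2)])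
  assume out: "\<not> (i \<le> topidx G \<and> j \<le> topidx G \<and> card S = r + s)"
  have "hwedge (\<lambda>S. sinv (ipar G k + ipar G j) (\<sigma> i k S)) (\<tau> k j) S = 0" for k
  proof (cases "i \<le> topidx G \<and> j \<le> topidx G")
    case True
    then show ?thesis using out
      by (intro hwedge_degree[of r _ s]) (auto simp: mforms_card[OF assms(1)] mforms_card[OF assms(2)])
  next
    case False
    then show ?thesis
      using mforms_index[OF assms(1), of i k] mforms_index[OF assms(2), of k j]
      by (intro hwedge_eq_0) auto
  qed
  then show "mf_prod G \<sigma> \<tau> i j S = 0" unfolding mf_prod_eval by (intro sum.neutral ballI)
qed

lemma mf_dh_mforms:
  assumes "\<sigma> \<in> mforms \<E> G 0"
  shows "mf_dh \<E> \<sigma> \<in> mforms \<E> G 1"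
  unfolding mforms_def mem_Collect_eq mf_dh_def dh_def
proof (intro allI conjI impI)
  fix i j S
  show "(\<Sum>v\<in>S. cmul (mono_sign {v} (S - {v})) (Dtot \<E> v (\<sigma> i j (S - {v})))) \<in> Cinf (jet_coords \<E>)"
    by (intro Cinf_sum Cinf_cmul Dtot_Cinf mforms_Cinf[OF assms]) (auto simp: jet_coords_def)
  assume out: "\<not> (i \<le> topidx G \<and> j \<le> topidx G \<and> card S = 1)"
  have "\<sigma> i j (S - {v}) = 0" if "v \<in> S" for v
  proof (cases "i \<le> topidx G \<and> j \<le> topidx G")
    case True
    then have "card (S - {v}) \<noteq> 0" using out that card_Suc_Diff1[of S v] by auto
    then show ?thesis by (rule mforms_card[OF assms])
  qed (rule mforms_index[OF assms])
  then show "(\<Sum>v\<in>S. cmul (mono_sign {v} (S - {v})) (Dtot \<E> v (\<sigma> i j (S - {v})))) = 0"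
    by (intro sum.neutral ballI) simp
qed

lemma mforms_diff:
  assumes "\<sigma> \<in> mforms \<E> G q" "\<tau> \<in> mforms \<E> G q"
  shows "\<sigma> - \<tau> \<in> mforms \<E> G q"
  unfolding mforms_def mem_Collect_eq
proof (intro allI conjI impI)
  fix i j S
  have d: "(\<sigma> - \<tau>) i j S = \<sigma> i j S - \<tau> i j S" by simp
  show "(\<sigma> - \<tau>) i j S \<in> Cinf (jet_coords \<E>)"
    unfolding d by (intro Cinf_diff mforms_Cinf[OF assms(1)] mforms_Cinf[OF assms(2)])
  assume "\<not> (i \<le> topidx G \<and> j \<le> topidx G \<and> card S = q)"
  then have "\<sigma> i j S = 0" "\<tau> i j S = 0"
    using assms unfolding mforms_def by blast+
  then show "(\<sigma> - \<tau>) i j S = 0" unfolding d by simp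
qed

lemma partial_alpha_mforms:
  assumes "\<alpha> \<in> mforms \<E> G 1" "mf_part G 0 \<alpha> = \<alpha>" "mf_part G 1 \<alpha> = 0" "\<sigma> \<in> mforms \<E> G 0"
  shows "partial_alpha \<E> G 0 \<alpha> \<sigma> \<in> mforms \<E> G 1"
  unfolding partial_alpha_def mf_bracket_even[OF assms(2,3)]
  using mf_dh_mforms[OF assms(4)] mf_prod_mforms[OF assms(1,4)] mf_prod_mforms[OF assms(4,1)]
  by (simp add: mforms_diff)

lemma partial_alpha_singleton:
  assumes "\<alpha> \<in> mforms \<E> G 1" "mf_part G 0 \<alpha> = \<alpha>" "mf_part G 1 \<alpha> = 0"
  shows "partial_alpha \<E> G 0 \<alpha> \<sigma> i j {v} = Dtot \<E> v (\<sigma> i j {})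
    - ((\<Sum>k\<le>topidx G. sinv (ipar G k + ipar G j) (\<alpha> i k {v}) \<star> \<sigma> k j {})
      - (\<Sum>k\<le>topidx G. sinv (ipar G k + ipar G j) (\<sigma> i k {}) \<star> \<alpha> k j {v}))"
proof -
  have "\<alpha> i j {} = 0" for i j by (rule mforms_card[OF assms(1)]) simp
  then show ?thesis
    unfolding partial_alpha_def mf_bracket_even[OF assms(2,3)] minus_apply mf_prod_eval
      hwedge_singleton mf_dh_def dh_singleton by simp
qed

section \<open>The representation and the covariant differential\<close>

lemma gforms_Cinf: "\<gamma> \<in> gforms \<E> G q \<Longrightarrow> \<gamma> k S \<in> Cinf (jet_coords \<E>)"
  unfolding gforms_def by blast

lemma gforms_zero: "\<gamma> \<in> gforms \<E> G q \<Longrightarrow> \<not> (k < gdim G \<and> card S = q) \<Longrightarrow> \<gamma> k S = 0"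
  unfolding gforms_def by blast

text \<open>The structure constants are fixed once, with their parity rule, so that matrices and
  vector fields expand their brackets with the same coefficients.\<close>

locale matrix_data =
  fixes \<E> :: zsystem and G :: matalg and a b :: "nat \<Rightarrow> superfun" and c :: "nat \<Rightarrow> nat \<Rightarrow> nat \<Rightarrow> real"
  assumes graded: "zgraded_system \<E>"
    and subalgebra: "lie_subsuperalgebra G" and basis: "homogeneous_basis G"
    and zcr: "zero_curvature \<E> G a b"
    and bracket_basis: "\<And>x y i j. x < gdim G \<Longrightarrow> y < gdim G \<Longrightarrow>
      mat_bracket G (gbasis G x) (gbasis G y) i j = (\<Sum>n<gdim G. c x y n * gbasis G n i j)"
    and c_parity: "\<And>x y n. n < gdim G \<Longrightarrow> c x y n \<noteq> 0 \<Longrightarrow> bpar G n = (bpar G x + bpar G y) mod 2"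
begin

sublocale J: homogeneous_ideal "jet_coords \<E>" "prolongation \<E>"
  by unfold_locales (use prolongation_homogeneous[OF graded] in blast)+

lemmas jet_ideal_add = J.ideal_add[folded jet_ideal_def]
  and jet_ideal_zero = J.ideal_zero[folded jet_ideal_def]
  and jet_ideal_diff = J.ideal_diff[folded jet_ideal_def]
  and jet_ideal_minus = J.ideal_minus[folded jet_ideal_def]
  and jet_ideal_cmul = J.ideal_cmul[folded jet_ideal_def]
  and jet_ideal_sum = J.ideal_sum[folded jet_ideal_def]
  and jet_ideal_sinv = J.ideal_sinv[folded jet_ideal_def]
  and jet_ideal_smult_left = J.ideal_smult_left[folded jet_ideal_def]
  and jet_ideal_smult_right = J.ideal_smult_right[folded jet_ideal_def]

abbreviation "av v k \<equiv> acomp a b v k"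

lemma av_Cinf: "k < gdim G \<Longrightarrow> av v k \<in> Cinf (jet_coords \<E>)"
  and av_parity: "k < gdim G \<Longrightarrow> has_parity (bpar G k) (av v k)"
  using zero_curvature_acomp[OF zcr] by blast+

lemma basis_part: "k < gdim G \<Longrightarrow> mat_part G (bpar G k) (gbasis G k) = gbasis G k"
  and bpar_less: "k < gdim G \<Longrightarrow> bpar G k < 2"
  and basis_alg: "k < gdim G \<Longrightarrow> gbasis G k \<in> alg G"
  using basis unfolding homogeneous_basis_def by blast+

lemma basis_nonzero_parity:
  "k < gdim G \<Longrightarrow> gbasis G k i j \<noteq> 0 \<Longrightarrow> (ipar G i + ipar G j) mod 2 = bpar G k"
  using mat_part_nonzero[OF basis_part] .

lemma basis_index:
  assumes "k < gdim G" "\<not> (i \<le> topidx G \<and> j \<le> topidx G)"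
  shows "gbasis G k i j = 0"
  using basis_alg[OF assms(1)] subalgebra assms(2)
  unfolding lie_subsuperalgebra_def gl_def by blast

lemma jet_ideal_Dtot:
  assumes "f \<in> jet_ideal \<E>"
  shows "Dtot \<E> v f \<in> jet_ideal \<E>"
  unfolding jet_ideal_def
proof (rule J.ideal_derivation[of f "Dtot \<E> v" 0])
  show "f \<in> J.I" using assms unfolding jet_ideal_def .
  show "Dtot \<E> v (f + g) = Dtot \<E> v f + Dtot \<E> v g"
    if "f \<in> Cinf (jet_coords \<E>)" "g \<in> Cinf (jet_coords \<E>)" for f g
    using that by (rule Dtot_add)
  show "Dtot \<E> v h \<in> Cinf (jet_coords \<E>)" if "h \<in> Cinf (jet_coords \<E>)" for h
    using that by (rule Dtot_Cinf) (auto simp: jet_coords_def)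
  show "Dtot \<E> v (h \<star> f) = Dtot \<E> v h \<star> f + sinv 0 h \<star> Dtot \<E> v f"
    if "h \<in> Cinf (jet_coords \<E>)" "f \<in> Cinf (jet_coords \<E>)" for h f
    using Dtot_smult[OF that] by simp
  show "Dtot \<E> v f \<in> J.I" if "f \<in> prolongation \<E>" for f
    using that by (intro J.ideal_generator Dtot_prolongation)
qed simp

lemma mf_eq_refl: "mf_eq \<E> \<sigma> \<sigma>"
  by (simp add: mf_eq_def jet_ideal_zero)

lemma mf_eq_sym:
  assumes "mf_eq \<E> \<sigma> \<tau>"
  shows "mf_eq \<E> \<tau> \<sigma>"
  unfolding mf_eq_def
proof (intro allI)
  fix i j S
  have "- (\<sigma> i j S - \<tau> i j S) \<in> jet_ideal \<E>"
    using assms unfolding mf_eq_def by (blast intro: jet_ideal_minus)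
  then show "\<tau> i j S - \<sigma> i j S \<in> jet_ideal \<E>" by (simp only: minus_diff_eq)
qed

lemma mf_eq_trans:
  assumes "mf_eq \<E> \<sigma> \<tau>" "mf_eq \<E> \<tau> \<upsilon>"
  shows "mf_eq \<E> \<sigma> \<upsilon>"
  unfolding mf_eq_def
proof (intro allI)
  fix i j S
  have "(\<sigma> i j S - \<tau> i j S) + (\<tau> i j S - \<upsilon> i j S) \<in> jet_ideal \<E>"
    using assms unfolding mf_eq_def by (blast intro: jet_ideal_add)
  then show "\<sigma> i j S - \<upsilon> i j S \<in> jet_ideal \<E>" by (simp only: diff_add_cancel add_diff_eq)
qed

lemma rho_mforms:
  assumes "\<gamma> \<in> gforms \<E> G q"
  shows "rho G \<gamma> \<in> mforms \<E> G q"
  unfolding mforms_def mem_Collect_eq rho_eval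
proof (intro allI conjI impI)
  fix i j S
  show "(\<Sum>k<gdim G. cmul (gbasis G k i j) (sinv (bpar G k) (\<gamma> k S))) \<in> Cinf (jet_coords \<E>)"
    by (intro Cinf_sum Cinf_cmul Cinf_sinv gforms_Cinf[OF assms])
  assume out: "\<not> (i \<le> topidx G \<and> j \<le> topidx G \<and> card S = q)"
  have "cmul (gbasis G k i j) (sinv (bpar G k) (\<gamma> k S)) = 0" if "k < gdim G" for k
  proof (cases "card S = q")
    case True
    then have "gbasis G k i j = 0" using out basis_index[OF that] by blast
    then show ?thesis by simp
  next
    case False
    then have "\<gamma> k S = 0" by (intro gforms_zero[OF assms]) simp
    then show ?thesis by simp
  qed
  then show "(\<Sum>k<gdim G. cmul (gbasis G k i j) (sinv (bpar G k) (\<gamma> k S))) = 0"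
    by (intro sum.neutral) auto
qed

lemma rho_diff: "rho G \<gamma> i j S - rho G \<gamma>' i j S
    = (\<Sum>k<gdim G. cmul (gbasis G k i j) (sinv (bpar G k) (\<gamma> k S - \<gamma>' k S)))"
  unfolding rho_eval sinv_diff cmul_diff_right sum_subtractf ..

lemma rho_cong: "gf_eq \<E> \<gamma> \<gamma>' \<Longrightarrow> mf_eq \<E> (rho G \<gamma>) (rho G \<gamma>')"
  unfolding mf_eq_def gf_eq_def rho_diff
  by (intro allI jet_ideal_sum jet_ideal_cmul jet_ideal_sinv) blast

text \<open>Each matrix entry of the difference gives one linear combination in the ideal.
  \<open>independent_cancel\<close> with the ideal as \<open>V\<close> isolates the coefficients, up
  to a \<open>sinv\<close> that is its own inverse.\<close>

lemma rho_injective: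
  assumes "\<gamma> \<in> gforms \<E> G q" "\<gamma>' \<in> gforms \<E> G q" "mf_eq \<E> (rho G \<gamma>) (rho G \<gamma>')"
  shows "gf_eq \<E> \<gamma> \<gamma>'"
  unfolding gf_eq_def
proof (intro allI)
  fix k S
  show "\<gamma> k S - \<gamma>' k S \<in> jet_ideal \<E>"
  proof (cases "k < gdim G")
    case True
    have "sinv (bpar G k) (\<gamma> k S - \<gamma>' k S) \<in> jet_ideal \<E>"
    proof (rule independent_cancel[where e = "gbasis G" and f = "\<lambda>k. sinv (bpar G k) (\<gamma> k S - \<gamma>' k S)"
          and n = "gdim G"])
      show "\<forall>k<gdim G. d k = 0" if "(\<Sum>k<gdim G. scale_mat (d k) (gbasis G k)) = 0" for d
        using basis that unfolding homogeneous_basis_def by blast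
      show "(\<Sum>k<gdim G. cmul (gbasis G k i j) (sinv (bpar G k) (\<gamma> k S - \<gamma>' k S))) \<in> jet_ideal \<E>" for i j
        using assms(3) unfolding mf_eq_def rho_diff by blast
    qed (use jet_ideal_add jet_ideal_cmul True in auto)
    from jet_ideal_sinv[OF this, of "bpar G k"]
    show ?thesis unfolding sinv_sinv by (simp only: sinv_even even_add)
  next
    case False
    then have "\<gamma> k S = 0" "\<gamma>' k S = 0"
      using gforms_zero[OF assms(1)] gforms_zero[OF assms(2)] by blast+
    then show ?thesis using jet_ideal_zero by simp
  qed
qed

lemma rho_rho_image: "\<gamma> \<in> gforms \<E> G q \<Longrightarrow> rho G \<gamma> \<in> rho_image \<E> G q"
  unfolding rho_image_def using rho_mforms mf_eq_refl by blast

lemma rho_inverse_props: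
  assumes "\<sigma> \<in> rho_image \<E> G q"
  shows "rho_inverse \<E> G q \<sigma> \<in> gforms \<E> G q" "mf_eq \<E> (rho G (rho_inverse \<E> G q \<sigma>)) \<sigma>"
proof -
  have "\<exists>\<gamma>. \<gamma> \<in> gforms \<E> G q \<and> mf_eq \<E> (rho G \<gamma>) \<sigma>"
    using assms unfolding rho_image_def by blast
  from someI_ex[OF this] show "rho_inverse \<E> G q \<sigma> \<in> gforms \<E> G q"
    "mf_eq \<E> (rho G (rho_inverse \<E> G q \<sigma>)) \<sigma>" unfolding rho_inverse_def by blast+
qed

text \<open>Since the preimage is unique modulo the ideal, any preimage at hand may replace the
  chosen one.\<close>

lemma rho_inverse_eq:
  assumes "\<gamma> \<in> gforms \<E> G q" "\<sigma> \<in> rho_image \<E> G q" "mf_eq \<E> (rho G \<gamma>) \<sigma>"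
  shows "gf_eq \<E> (rho_inverse \<E> G q \<sigma>) \<gamma>"
  by (rule rho_injective[OF rho_inverse_props(1)[OF assms(2)] assms(1)
        mf_eq_trans[OF rho_inverse_props(2)[OF assms(2)] mf_eq_sym[OF assms(3)]]])

section \<open>The connection form and the covariant differential on matrices\<close>

abbreviation "\<alpha> \<equiv> rho G (alpha_form G a b)"

lemma alpha_form_gforms: "alpha_form G a b \<in> gforms \<E> G 1"
  unfolding gforms_def mem_Collect_eq
proof (intro allI conjI impI)
  fix k S
  show zero: "alpha_form G a b k S = 0" if "\<not> (k < gdim G \<and> card S = 1)"
    using that by (auto simp: alpha_form_def hone_card)
  show "alpha_form G a b k S \<in> Cinf (jet_coords \<E>)"
  proof (cases "k < gdim G \<and> card S = 1")
    case True
    then obtain v where "S = {v}" by (auto simp: card_1_singleton_iff)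
    then show ?thesis using True alpha_form_eval(1)[of k G a b v] av_Cinf by simp
  next
    case False
    show ?thesis unfolding zero[OF False] by (rule Cinf_zero)
  qed
qed

lemma alpha_mforms: "\<alpha> \<in> mforms \<E> G 1"
  by (rule rho_mforms[OF alpha_form_gforms])

lemma alpha_eval: "\<alpha> i j {v} = (\<Sum>k<gdim G. cmul (gbasis G k i j) (sinv (bpar G k) (av v k)))"
  unfolding rho_eval by (rule sum.cong[OF refl]) (simp add: alpha_form_eval)

text \<open>Where an entry of a basis matrix is nonzero, its index parity is
  \<open>bpar G k\<close>, which is also the parity of the coefficient; hence the form is
  even.\<close>

lemma alpha_part: "mf_part G e \<alpha> = (if e mod 2 = 0 then \<alpha> else 0)"
proof (intro ext)
  fix i j S p T
  have "has_parity ((ipar G i + ipar G j) mod 2) (\<alpha> i j S)"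
  proof (cases "card S = 1")
    case True
    then obtain v where S: "S = {v}" by (auto simp: card_1_singleton_iff)
    have "has_parity ((ipar G i + ipar G j) mod 2) (cmul (gbasis G k i j) (sinv (bpar G k) (av v k)))"
      if "k < gdim G" for k
    proof (cases "gbasis G k i j = 0")
      case False
      then show ?thesis
        using basis_nonzero_parity[OF that, of i j] av_parity[OF that]
        by (auto intro!: has_parity_cmul has_parity_sinv)
    qed simp
    then show ?thesis unfolding S alpha_eval by (intro has_parity_sum) auto
  next
    case False
    show ?thesis unfolding mforms_card[OF alpha_mforms False] by (rule has_parity_zero)
  qed
  note spart_parity[OF this, of "(e + ipar G i + ipar G j) mod 2"]
  moreover have "(e + ipar G i + ipar G j) mod 2 = (ipar G i + ipar G j) mod 2 \<longleftrightarrow> e mod 2 = 0"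
    by presburger
  ultimately show "mf_part G e \<alpha> i j S p T = (if e mod 2 = 0 then \<alpha> else 0) i j S p T"
    by (simp add: mf_part_def)
qed

lemma alpha_even: "mf_part G 0 \<alpha> = \<alpha>" "mf_part G 1 \<alpha> = 0"
  by (simp_all add: alpha_part)

lemmas partial_alpha_eval = partial_alpha_singleton[OF alpha_mforms alpha_even]
  and partial_alpha_closed = partial_alpha_mforms[OF alpha_mforms alpha_even]

lemma partial_alpha_cong:
  assumes "\<sigma> \<in> mforms \<E> G 0" "\<sigma>' \<in> mforms \<E> G 0" "mf_eq \<E> \<sigma> \<sigma>'"
  shows "mf_eq \<E> (partial_alpha \<E> G 0 \<alpha> \<sigma>) (partial_alpha \<E> G 0 \<alpha> \<sigma>')"
  unfolding mf_eq_def
proof (intro allI)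
  fix i j S
  show "partial_alpha \<E> G 0 \<alpha> \<sigma> i j S - partial_alpha \<E> G 0 \<alpha> \<sigma>' i j S \<in> jet_ideal \<E>"
  proof (cases "card S = 1")
    case True
    then obtain v where S: "S = {v}" by (auto simp: card_1_singleton_iff)
    let ?d = "\<lambda>i j. \<sigma> i j {} - \<sigma>' i j {}"
    let ?m = "\<lambda>k. ipar G k + ipar G j"
    have d: "?d i j \<in> jet_ideal \<E>" for i j using assms(3) unfolding mf_eq_def by blast
    have D: "Dtot \<E> v (?d i j) = Dtot \<E> v (\<sigma> i j {}) - Dtot \<E> v (\<sigma>' i j {})"
      by (rule Dtot_diff[OF mforms_Cinf[OF assms(1)] mforms_Cinf[OF assms(2)]])
    have "partial_alpha \<E> G 0 \<alpha> \<sigma> i j {v} - partial_alpha \<E> G 0 \<alpha> \<sigma>' i j {v}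
      = Dtot \<E> v (?d i j) - ((\<Sum>k\<le>topidx G. sinv (?m k) (\<alpha> i k {v}) \<star> ?d k j)
        - (\<Sum>k\<le>topidx G. sinv (?m k) (?d i k) \<star> \<alpha> k j {v}))"
      unfolding partial_alpha_eval D smult_diff_right sinv_diff smult_diff_left sum_subtractf
      by (simp only: diff_diff_eq2 diff_diff_eq add_diff_eq diff_add_eq algebra_simps)
    also have "\<dots> \<in> jet_ideal \<E>"
      by (intro jet_ideal_diff jet_ideal_Dtot jet_ideal_sum jet_ideal_smult_left jet_ideal_smult_right
          jet_ideal_sinv d Cinf_sinv mforms_Cinf[OF alpha_mforms])
    finally show ?thesis unfolding S .
  next
    case False
    show ?thesis
      unfolding mforms_card[OF partial_alpha_closed[OF assms(1)] False]
        mforms_card[OF partial_alpha_closed[OF assms(2)] False] diff_self by (rule jet_ideal_zero)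
  qed
qed

text \<open>The coefficients, in the basis \<open>e\<^sub>n\<close>, of \<open>D\<^sub>v \<gamma> - [\<alpha>\<^sub>v, \<gamma>]\<close>; the sign moves \<open>e\<^sub>x\<close> past \<open>\<gamma> y\<close>.\<close>

definition covd :: "gform \<Rightarrow> indep \<Rightarrow> nat \<Rightarrow> superfun"
  where "covd \<gamma> v n = Dtot \<E> v (\<gamma> n {})
    - (\<Sum>x<gdim G. \<Sum>y<gdim G. cmul (c x y n) (av v x \<star> sinv (bpar G x) (\<gamma> y {})))"

definition covd_form :: "gform \<Rightarrow> gform"
  where "covd_form \<gamma> n S = (if n < gdim G \<and> card S = 1 then covd \<gamma> (the_elem S) n else 0)"

lemma covd_Cinf:
  assumes "\<gamma> \<in> gforms \<E> G 0"
  shows "covd \<gamma> v n \<in> Cinf (jet_coords \<E>)"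
  unfolding covd_def
  by (intro Cinf_diff Cinf_sum Cinf_cmul Cinf_smult Cinf_sinv Dtot_Cinf av_Cinf gforms_Cinf[OF assms])
    (auto simp: jet_coords_def)

lemma covd_form_gforms:
  assumes "\<gamma> \<in> gforms \<E> G 0"
  shows "covd_form \<gamma> \<in> gforms \<E> G 1"
  unfolding gforms_def covd_form_def using covd_Cinf[OF assms] by auto

lemma covd_form_eval: "n < gdim G \<Longrightarrow> covd_form \<gamma> n {v} = covd \<gamma> v n"
  by (simp add: covd_form_def)

lemma mat_bracket_eval:
  assumes "x < gdim G" "y < gdim G"
  shows "mat_bracket G (gbasis G x) (gbasis G y) i j
    = (\<Sum>k\<le>topidx G. gbasis G x i k * gbasis G y k j)
      - (- 1) ^ (bpar G x * bpar G y) * (\<Sum>k\<le>topidx G. gbasis G y i k * gbasis G x k j)"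
  unfolding mat_bracket_homogeneous[OF basis_part[OF assms(1)] basis_part[OF assms(2)]
      bpar_less[OF assms(1)] bpar_less[OF assms(2)]]
  by (simp add: mat_mul_def scale_mat_def)

text \<open>An identity of representatives, without passing to the quotient: the sign rules of
  \<open>rho\<close>, \<open>mf_prod\<close> and \<open>covd\<close> match term by term.\<close>

lemma partial_alpha_rho:
  assumes \<gamma>: "\<gamma> \<in> gforms \<E> G 0"
  shows "partial_alpha \<E> G 0 \<alpha> (rho G \<gamma>) = rho G (covd_form \<gamma>)"
proof -
  have main: "partial_alpha \<E> G 0 \<alpha> (rho G \<gamma>) i j S = rho G (covd_form \<gamma>) i j S" for i j S
  proof (cases "card S = 1")
    case False
    show ?thesis
      unfolding mforms_card[OF partial_alpha_closed[OF rho_mforms[OF \<gamma>]] False]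
        mforms_card[OF rho_mforms[OF covd_form_gforms[OF \<gamma>]] False] ..
  next
    case True
    then obtain v where S: "S = {v}" by (auto simp: card_1_singleton_iff)
    let ?g = "\<lambda>y. \<gamma> y {}" and ?N = "{..<gdim G}" and ?K = "{..topidx G}"
    let ?B = "\<lambda>x y. sinv (bpar G x) (av v x) \<star> sinv (bpar G y) (?g y)"
    let ?s = "\<lambda>x y. (- 1 :: real) ^ (bpar G x * bpar G y)"
    \<comment> \<open>\<open>av v x\<close> is homogeneous of parity \<open>bpar G x\<close>, so the
      additional \<open>bpar G y\<close> acts as the scalar \<open>?s x y\<close>.\<close>
    have shift: "sinv (bpar G x + bpar G y) (av v x) = cmul (?s x y) (sinv (bpar G x) (av v x))"
      if "x \<in> ?N" for x y
      using sinv_parity[OF av_parity, of x "bpar G x + bpar G y" v] sinv_parity[OF av_parity, of x "bpar G x" v] that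
      by (simp add: power_add add_mult_distrib2 mult.commute)
    \<comment> \<open>Where the entry of the second factor is nonzero, the sign of
      \<open>mf_prod\<close> is the one for moving the coefficient \<open>av v x\<close> past the
      basis element with index \<open>y\<close>.\<close>
    have left: "sinv (ipar G k + ipar G j) (\<alpha> i k {v}) \<star> rho G \<gamma> k j {}
        = (\<Sum>x\<in>?N. \<Sum>y\<in>?N. cmul (?s x y * (gbasis G x i k * gbasis G y k j)) (?B x y))" for k
    proof -
      have F: "cmul (gbasis G x i k) (sinv (ipar G k + ipar G j + bpar G x) (av v x))
          \<star> cmul (gbasis G y k j) (sinv (bpar G y) (?g y))
          = cmul (?s x y * (gbasis G x i k * gbasis G y k j)) (?B x y)"
        if xy: "x \<in> ?N" "y \<in> ?N" for x y
      proof (cases "gbasis G y k j = 0")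
        case False
        then have p: "(ipar G k + ipar G j) mod 2 = bpar G y" using basis_nonzero_parity xy by auto
        have "sinv (ipar G k + ipar G j + bpar G x) (av v x) = sinv (bpar G x + bpar G y) (av v x)"
          unfolding p[symmetric] by (rule sinv_cong) presburger
        then show ?thesis using shift[OF xy(1), of y] by (simp add: mult_ac)
      qed simp
      show ?thesis
        unfolding alpha_eval unfolding rho_eval sinv_sum sinv_cmul sinv_sinv smult_sum_left
        unfolding smult_sum_right
        by (rule sum.cong[OF refl], rule sum.cong[OF refl], rule F)
    qed
    \<comment> \<open>Here the coefficients stand in the opposite order; exchanging them absorbs the
      sign of \<open>mf_prod\<close>.\<close>
    have right: "sinv (ipar G k + ipar G j) (rho G \<gamma> i k {}) \<star> \<alpha> k j {v}
        = (\<Sum>x\<in>?N. \<Sum>y\<in>?N. cmul (gbasis G y i k * gbasis G x k j) (?B x y))" for k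
    proof -
      have F: "cmul (gbasis G y i k) (sinv (ipar G k + ipar G j + bpar G y) (?g y))
          \<star> cmul (gbasis G x k j) (sinv (bpar G x) (av v x))
          = cmul (gbasis G y i k * gbasis G x k j) (?B x y)"
        if xy: "x \<in> ?N" "y \<in> ?N" for x y
      proof (cases "gbasis G x k j = 0")
        case False
        then have p: "(ipar G k + ipar G j) mod 2 = bpar G x" using basis_nonzero_parity xy by auto
        have "sinv (ipar G k + ipar G j + bpar G y) (?g y) \<star> sinv (bpar G x) (av v x)
            = sinv (bpar G x) (av v x) \<star> sinv (bpar G x) (sinv (ipar G k + ipar G j + bpar G y) (?g y))"
          using xy by (intro smult_commute has_parity_sinv av_parity) auto
        also have "sinv (bpar G x) (sinv (ipar G k + ipar G j + bpar G y) (?g y)) = sinv (bpar G y) (?g y)"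
          unfolding sinv_sinv p[symmetric] by (rule sinv_cong) presburger
        finally show ?thesis by (simp add: mult_ac)
      qed simp
      have "(\<Sum>y\<in>?N. \<Sum>x\<in>?N. cmul (gbasis G y i k) (sinv (ipar G k + ipar G j + bpar G y) (?g y))
          \<star> cmul (gbasis G x k j) (sinv (bpar G x) (av v x)))
        = (\<Sum>y\<in>?N. \<Sum>x\<in>?N. cmul (gbasis G y i k * gbasis G x k j) (?B x y))"
        by (rule sum.cong[OF refl], rule sum.cong[OF refl], rule F)
      also have "\<dots> = (\<Sum>x\<in>?N. \<Sum>y\<in>?N. cmul (gbasis G y i k * gbasis G x k j) (?B x y))"
        by (rule sum.swap)
      finally show ?thesis
        unfolding alpha_eval unfolding rho_eval sinv_sum sinv_cmul sinv_sinv smult_sum_left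
        unfolding smult_sum_right .
    qed
    have "(\<Sum>k\<in>?K. sinv (ipar G k + ipar G j) (\<alpha> i k {v}) \<star> rho G \<gamma> k j {})
        - (\<Sum>k\<in>?K. sinv (ipar G k + ipar G j) (rho G \<gamma> i k {}) \<star> \<alpha> k j {v})
      = (\<Sum>k\<in>?K. \<Sum>x\<in>?N. \<Sum>y\<in>?N. cmul (?s x y * (gbasis G x i k * gbasis G y k j)
          - gbasis G y i k * gbasis G x k j) (?B x y))"
      unfolding left right by (simp only: cmul_diff_left sum_subtractf)
    also have "\<dots> = (\<Sum>x\<in>?N. \<Sum>y\<in>?N. \<Sum>k\<in>?K. cmul (?s x y * (gbasis G x i k * gbasis G y k j)
          - gbasis G y i k * gbasis G x k j) (?B x y))"
      by (rule sum_swap3[symmetric])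
    also have "\<dots> = (\<Sum>x\<in>?N. \<Sum>y\<in>?N. cmul (?s x y * mat_bracket G (gbasis G x) (gbasis G y) i j) (?B x y))"
    proof (intro sum.cong refl)
      fix x y assume "x \<in> ?N" "y \<in> ?N"
      then have xy: "x < gdim G" "y < gdim G" by auto
      \<comment> \<open>\<open>?s x y\<close> is its own inverse, so factoring it out of the
        difference leaves the superbracket.\<close>
      have "(\<Sum>k\<in>?K. ?s x y * (gbasis G x i k * gbasis G y k j) - gbasis G y i k * gbasis G x k j)
          = ?s x y * mat_bracket G (gbasis G x) (gbasis G y) i j"
        unfolding mat_bracket_eval[OF xy]
        by (simp add: sum_subtractf sum_distrib_left right_diff_distrib minus_one_power_iff)
      then show "(\<Sum>k\<in>?K. cmul (?s x y * (gbasis G x i k * gbasis G y k j)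
          - gbasis G y i k * gbasis G x k j) (?B x y))
        = cmul (?s x y * mat_bracket G (gbasis G x) (gbasis G y) i j) (?B x y)"
        by (simp only: sum_cmul[symmetric])
    qed
    also have "\<dots> = (\<Sum>x\<in>?N. \<Sum>y\<in>?N. \<Sum>n\<in>?N. cmul (gbasis G n i j * c x y n * ?s x y) (?B x y))"
      by (intro sum.cong refl)
        (simp add: bracket_basis sum_distrib_left flip: sum_cmul, simp only: mult_ac)
    also have "\<dots> = (\<Sum>n\<in>?N. \<Sum>x\<in>?N. \<Sum>y\<in>?N. cmul (gbasis G n i j * c x y n * ?s x y) (?B x y))"
      by (rule sum_swap3)
    also have "\<dots> = (\<Sum>n\<in>?N. cmul (gbasis G n i j) (sinv (bpar G n)
        (\<Sum>x\<in>?N. \<Sum>y\<in>?N. cmul (c x y n) (av v x \<star> sinv (bpar G x) (?g y)))))"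
    proof (rule sum.cong[OF refl])
      fix n assume n: "n \<in> ?N"
      have F: "cmul (gbasis G n i j * c x y n * ?s x y) (?B x y)
        = cmul (gbasis G n i j) (sinv (bpar G n) (cmul (c x y n) (av v x \<star> sinv (bpar G x) (?g y))))"
        if xy: "x \<in> ?N" "y \<in> ?N" for x y
      \<comment> \<open>A nonzero structure constant determines the parity of the basis element with
        index \<open>n\<close>, so \<open>sinv (bpar G n)\<close> distributes over the two
        coefficients with exactly the required signs.\<close>
      proof (cases "c x y n = 0")
        case False
        then have p: "bpar G n = (bpar G x + bpar G y) mod 2" using c_parity n by auto
        have e1: "sinv (bpar G n) (av v x) = cmul (?s x y) (sinv (bpar G x) (av v x))"
          unfolding shift[OF xy(1), symmetric] p by (rule sinv_cong) presburger
        have e2: "sinv (bpar G n) (sinv (bpar G x) (?g y)) = sinv (bpar G y) (?g y)"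
          unfolding sinv_sinv p by (rule sinv_cong) presburger
        show ?thesis unfolding sinv_cmul sinv_smult e1 e2 by (simp add: mult_ac)
      qed simp
      show "(\<Sum>x\<in>?N. \<Sum>y\<in>?N. cmul (gbasis G n i j * c x y n * ?s x y) (?B x y))
        = cmul (gbasis G n i j) (sinv (bpar G n)
          (\<Sum>x\<in>?N. \<Sum>y\<in>?N. cmul (c x y n) (av v x \<star> sinv (bpar G x) (?g y))))"
        unfolding sinv_sum cmul_sum by (rule sum.cong[OF refl], rule sum.cong[OF refl], rule F)
    qed
    finally have br: "(\<Sum>k\<in>?K. sinv (ipar G k + ipar G j) (\<alpha> i k {v}) \<star> rho G \<gamma> k j {})
        - (\<Sum>k\<in>?K. sinv (ipar G k + ipar G j) (rho G \<gamma> i k {}) \<star> \<alpha> k j {v})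
      = (\<Sum>n\<in>?N. cmul (gbasis G n i j) (sinv (bpar G n)
        (\<Sum>x\<in>?N. \<Sum>y\<in>?N. cmul (c x y n) (av v x \<star> sinv (bpar G x) (?g y)))))" .
    have "Dtot \<E> v (rho G \<gamma> i j {}) = (\<Sum>n\<in>?N. Dtot \<E> v (cmul (gbasis G n i j) (sinv (bpar G n) (?g n))))"
      unfolding rho_eval by (intro Dtot_sum[of _ _ "jet_coords \<E>"] Cinf_cmul Cinf_sinv gforms_Cinf[OF \<gamma>])
    also have "\<dots> = (\<Sum>n\<in>?N. cmul (gbasis G n i j) (sinv (bpar G n) (Dtot \<E> v (?g n))))"
      by (rule sum.cong[OF refl])
        (simp add: Dtot_cmul[OF Cinf_sinv[OF gforms_Cinf[OF \<gamma>]]] Dtot_sinv[OF gforms_Cinf[OF \<gamma>]])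
    finally have "partial_alpha \<E> G 0 \<alpha> (rho G \<gamma>) i j {v}
      = (\<Sum>n\<in>?N. cmul (gbasis G n i j) (sinv (bpar G n) (covd \<gamma> v n)))"
      unfolding partial_alpha_eval br covd_def sinv_diff cmul_diff_right sum_subtractf by simp
    also have "\<dots> = rho G (covd_form \<gamma>) i j {v}"
      unfolding rho_eval by (rule sum.cong[OF refl]) (simp add: covd_form_eval)
    finally show ?thesis unfolding S .
  qed
  show ?thesis by (intro ext) (simp only: main)
qed

end

section \<open>Vector fields on the covering space\<close>

lemma vert_has_parity:
  assumes "f \<in> Cinf A" "has_parity d f" "vert_parity G e c"
  shows "has_parity ((e + d) mod 2) (vert G c f)"
  unfolding vert_def
proof (rule has_parity_sum)
  fix l assume "l \<in> {1..topidx G}"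
  then have c: "has_parity ((e + cpar (wcoord G l)) mod 2) (c l)"
    using assms(3) by (simp only: vert_parity_def)
  have "has_parity ((d + cpar (wcoord G l)) mod 2) (pd (wcoord G l) f)"
    by (rule has_parity_pd[OF assms(1,2) refl])
  from has_parity_smult[OF c this refl]
  show "has_parity ((e + d) mod 2) (c l \<star> pd (wcoord G l) f)"
    using parity_cancel[of e "ipar G l" d] by (simp add: add.commute[of d])
qed

lemma Dtot_outside:
  assumes "f \<in> Cinf B" "B \<inter> jet_coords \<E> = {}"
  shows "Dtot \<E> v f = 0"
proof -
  have "Dtot \<E> v f = pd (Inl (Base v)) f + (\<Sum>z\<in>{}. coord_fun (jet_shift v z) \<star> pd z f)"
    by (rule Dtot_eq) (use assms(2) in \<open>auto simp: jet_coords_def intro!: pd_outside[OF assms(1)]\<close>)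
  moreover have "pd (Inl (Base v)) f = 0"
    by (rule pd_outside[OF assms(1)]) (use assms(2) in \<open>auto simp: jet_coords_def\<close>)
  ultimately show ?thesis by simp
qed

lemma realisation_lincomb:
  assumes "\<And>i j. M i j = (\<Sum>n\<in>N. d n * e n i j)"
  shows "realisation G \<mu> M f = (\<Sum>n\<in>N. cmul (d n) (realisation G \<mu> (e n) f))"
proof -
  have "realisation G \<mu> M f = (\<Sum>i\<le>topidx G. \<Sum>j\<le>topidx G. \<Sum>n\<in>N.
      cmul (d n) (cmul (e n i j) (wvec G \<mu> i \<star> dvec G \<mu> j f)))"
    unfolding realisation_def assms sum_cmul by simp
  also have "\<dots> = (\<Sum>n\<in>N. \<Sum>i\<le>topidx G. \<Sum>j\<le>topidx G.
      cmul (d n) (cmul (e n i j) (wvec G \<mu> i \<star> dvec G \<mu> j f)))"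
    by (rule sum_swap3)
  finally show ?thesis unfolding realisation_def cmul_sum .
qed

lemma sconst_1_nonzero: "sconst 1 \<noteq> 0"
proof
  assume "sconst 1 = 0"
  then have "sconst 1 (\<lambda>e. 0) {} = 0" by simp
  then show False by (simp add: sconst_def)
qed

locale covering_data = matrix_data +
  fixes \<mu> :: real and wx wt :: "nat \<Rightarrow> superfun"
  assumes \<mu>_nonzero: "\<mu> \<noteq> 0"
    and covering: "covering \<E> G wx wt"
    and wx_velocity: "\<forall>l\<in>{1..topidx G}. wx l - fibre_velocity G \<mu> a l \<in> cov_ideal \<E> G"
    and wt_velocity: "\<forall>l\<in>{1..topidx G}. wt l - fibre_velocity G \<mu> b l \<in> cov_ideal \<E> G"
begin

abbreviation "W \<equiv> cov_coords \<E> G"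

lemma jet_coords_subset: "jet_coords \<E> \<subseteq> W"
  and jet_deps_subset: "jet_deps \<E> \<subseteq> W"
  and fibre_subset: "wcoord G ` {1..topidx G} \<subseteq> W"
  by (auto simp: cov_coords_def jet_coords_def)

lemma Cinf_jet: "f \<in> Cinf (jet_coords \<E>) \<Longrightarrow> f \<in> Cinf W"
  using Cinf_mono jet_coords_subset by blast

sublocale C: homogeneous_ideal "cov_coords \<E> G" "prolongation \<E>"
  by unfold_locales (use prolongation_homogeneous[OF graded] Cinf_jet in blast)+

lemmas cov_ideal_add = C.ideal_add[folded cov_ideal_def]
  and cov_ideal_zero = C.ideal_zero[folded cov_ideal_def]
  and cov_ideal_diff = C.ideal_diff[folded cov_ideal_def]
  and cov_ideal_minus = C.ideal_minus[folded cov_ideal_def]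
  and cov_ideal_cmul = C.ideal_cmul[folded cov_ideal_def]
  and cov_ideal_sum = C.ideal_sum[folded cov_ideal_def]
  and cov_ideal_spart = C.ideal_spart[folded cov_ideal_def]
  and cov_ideal_smult_left = C.ideal_smult_left[folded cov_ideal_def]
  and cov_ideal_smult_right = C.ideal_smult_right[folded cov_ideal_def]
  and cov_ideal_Cinf = C.ideal_Cinf[folded cov_ideal_def]

lemma jet_ideal_cov: "f \<in> jet_ideal \<E> \<Longrightarrow> f \<in> cov_ideal \<E> G"
  unfolding jet_ideal_def cov_ideal_def
  using gen_ideal_mono[of "Cinf (jet_coords \<E>)" "Cinf W"] Cinf_jet by blast

lemmas Cinf_rcoef_W = Cinf_rcoef[OF \<mu>_nonzero fibre_subset]
  and Cinf_realisation_W = Cinf_realisation[OF \<mu>_nonzero fibre_subset]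

text \<open>The generators involve no fibre variable, so fibre derivatives kill them.\<close>

lemma cov_ideal_pd_fibre:
  assumes "f \<in> cov_ideal \<E> G"
  shows "pd (wcoord G l) f \<in> cov_ideal \<E> G"
  unfolding cov_ideal_def
proof (rule C.ideal_derivation[of f "pd (wcoord G l)" "cpar (wcoord G l)"])
  show "f \<in> C.I" using assms unfolding cov_ideal_def .
  show "pd (wcoord G l) f \<in> C.I" if "f \<in> prolongation \<E>" for f
    using pd_outside[OF J.gen_Cinf[OF that] wcoord_jet] by simp
qed (auto simp: pd_add pd_smult Cinf_pd)

lemma cov_ideal_vert:
  assumes "f \<in> cov_ideal \<E> G" "\<And>l. l \<in> {1..topidx G} \<Longrightarrow> d l \<in> Cinf W"
  shows "vert G d f \<in> cov_ideal \<E> G"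
  unfolding vert_def
  by (intro cov_ideal_sum cov_ideal_smult_left cov_ideal_pd_fibre assms)

lemma cov_ideal_vert_coeff:
  assumes "f \<in> Cinf W" "\<And>l. l \<in> {1..topidx G} \<Longrightarrow> d l \<in> cov_ideal \<E> G"
  shows "vert G d f \<in> cov_ideal \<E> G"
  unfolding vert_def
  by (intro cov_ideal_sum cov_ideal_smult_right Cinf_pd assms)

lemma op_part_cong:
  assumes "\<And>g. g \<in> Cinf W \<Longrightarrow> \<Omega> g = \<Omega>' g" "g \<in> Cinf W"
  shows "op_part e \<Omega> g = op_part e \<Omega>' g"
  unfolding op_part_def using assms by (simp add: Cinf_spart)

definition vpart :: "nat \<Rightarrow> (nat \<Rightarrow> superfun) \<Rightarrow> nat \<Rightarrow> superfun"
  where "vpart e d l = spart ((e + cpar (wcoord G l)) mod 2) (d l)"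

lemma vert_parity_vpart: "vert_parity G e (vpart e d)"
  by (simp add: vert_parity_def vpart_def)

lemma vert_vpart: "vert G d f = (\<Sum>e<2. vert G (vpart e d) f)"
proof -
  have "d l = vpart 0 d l + vpart 1 d l" for l
    using ipar_cases[of G l] spart_decompose[of "d l"]
    by (auto simp: vpart_def sum_lessThan_2 add.commute)
  then have "d l \<star> pd (wcoord G l) f = vpart 0 d l \<star> pd (wcoord G l) f + vpart 1 d l \<star> pd (wcoord G l) f" for l
    by (metis smult_add_left)
  then show ?thesis unfolding vert_def sum_lessThan_2 sum.distrib[symmetric] by simp
qed

lemma op_part_vert_vpart:
  assumes "f \<in> Cinf W" "e < 2"
  shows "op_part e (vert G d) f = vert G (vpart e d) f"
  unfolding op_part_vert[OF assms] vpart_def ..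

text \<open>A vertical field is additive and satisfies the graded Leibniz rule exactly on
  representatives; the ideal matters only for its descent to the quotient.\<close>

lemma GT0I:
  assumes "\<And>g. g \<in> Cinf W \<Longrightarrow> \<Omega> g = vert G d g" "\<And>l. l \<in> {1..topidx G} \<Longrightarrow> d l \<in> Cinf W"
  shows "\<Omega> \<in> GT0 \<E> G"
  unfolding GT0_def mem_Collect_eq
proof (intro conjI ballI allI impI)
  fix g h assume g: "g \<in> Cinf W" and h: "h \<in> Cinf W"
  show "\<Omega> g \<in> Cinf W" unfolding assms(1)[OF g] by (rule vert_Cinf[OF g assms(2)])
  show "\<Omega> g - \<Omega> h \<in> cov_ideal \<E> G" if "g - h \<in> cov_ideal \<E> G"
    unfolding assms(1)[OF g] assms(1)[OF h] vert_diff[OF g h, symmetric]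
    by (rule cov_ideal_vert[OF that assms(2)])
  show "\<Omega> (g + h) - (\<Omega> g + \<Omega> h) \<in> cov_ideal \<E> G"
    unfolding assms(1)[OF g] assms(1)[OF h] assms(1)[OF Cinf_add[OF g h]] vert_add[OF g h] diff_self
    by (rule cov_ideal_zero)
  show "\<Omega> (cmul r g) - cmul r (\<Omega> g) \<in> cov_ideal \<E> G" for r
    unfolding assms(1)[OF g] assms(1)[OF Cinf_cmul[OF g]] vert_cmul[OF g] diff_self
    by (rule cov_ideal_zero)
  have op: "op_part e \<Omega> f = vert G (vpart e d) f" if "e \<in> {..<2}" "f \<in> Cinf W" for e f
  proof -
    have "op_part e \<Omega> f = op_part e (vert G d) f" by (rule op_part_cong[OF assms(1) that(2)])
    then show ?thesis using op_part_vert_vpart[OF that(2), of e d] that(1) by simp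
  qed
  have "(\<Sum>e<2. op_part e \<Omega> g \<star> h + sinv e g \<star> op_part e \<Omega> h) = (\<Sum>e<2. vert G (vpart e d) (g \<star> h))"
    by (rule sum.cong[OF refl]) (simp add: op g h vert_smult[OF g h vert_parity_vpart])
  also have "\<dots> = \<Omega> (g \<star> h)" unfolding assms(1)[OF Cinf_smult[OF g h]] by (rule vert_vpart[symmetric])
  finally show "\<Omega> (g \<star> h) - (\<Sum>\<epsilon><2. op_part \<epsilon> \<Omega> g \<star> h + sinv \<epsilon> g \<star> op_part \<epsilon> \<Omega> h) \<in> cov_ideal \<E> G"
    by (simp only: diff_self cov_ideal_zero)
qed

lemma op_part_cov_ideal:
  assumes "\<And>g. g \<in> Cinf W \<Longrightarrow> \<Omega>' g - \<Omega> g \<in> cov_ideal \<E> G" "g \<in> Cinf W"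
  shows "op_part e \<Omega>' g - op_part e \<Omega> g \<in> cov_ideal \<E> G"
  unfolding op_part_def sum_subtractf[symmetric] spart_diff[symmetric]
  by (intro cov_ideal_sum cov_ideal_spart assms Cinf_spart) simp

text \<open>The commutator of a total derivative of the covering with a vertical field is only
  congruent to a vertical field, so being a derivation has to be transported along
  congruence.\<close>

lemma GT0_cong:
  assumes \<Omega>: "\<Omega> \<in> GT0 \<E> G"
    and cl: "\<And>g. g \<in> Cinf W \<Longrightarrow> \<Omega>' g \<in> Cinf W"
    and eq: "\<And>g. g \<in> Cinf W \<Longrightarrow> \<Omega>' g - \<Omega> g \<in> cov_ideal \<E> G"
  shows "\<Omega>' \<in> GT0 \<E> G"
  unfolding GT0_def mem_Collect_eq
proof (intro conjI ballI allI impI)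
  fix g h assume g: "g \<in> Cinf W" and h: "h \<in> Cinf W"
  note D = \<Omega>[unfolded GT0_def mem_Collect_eq]
  show "\<Omega>' g \<in> Cinf W" by (rule cl[OF g])
  show "\<Omega>' g - \<Omega>' h \<in> cov_ideal \<E> G" if "g - h \<in> cov_ideal \<E> G"
  proof -
    have k: "\<Omega> g - \<Omega> h \<in> cov_ideal \<E> G" using D g h that by blast
    from cov_ideal_add[OF eq[OF g] cov_ideal_diff[OF k eq[OF h]]]
    show ?thesis by (simp add: algebra_simps)
  qed
  show "\<Omega>' (g + h) - (\<Omega>' g + \<Omega>' h) \<in> cov_ideal \<E> G"
  proof -
    have k: "\<Omega> (g + h) - (\<Omega> g + \<Omega> h) \<in> cov_ideal \<E> G" using D g h by blast
    from cov_ideal_add[OF eq[OF Cinf_add[OF g h]] cov_ideal_diff[OF k cov_ideal_add[OF eq[OF g] eq[OF h]]]]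
    show ?thesis by (simp add: algebra_simps)
  qed
  show "\<Omega>' (cmul r g) - cmul r (\<Omega>' g) \<in> cov_ideal \<E> G" for r
  proof -
    have k: "\<Omega> (cmul r g) - cmul r (\<Omega> g) \<in> cov_ideal \<E> G" using D g by blast
    from cov_ideal_add[OF eq[OF Cinf_cmul[OF g, of r]] cov_ideal_diff[OF k cov_ideal_cmul[OF eq[OF g], of r]]]
    show ?thesis by (simp add: algebra_simps cmul_diff_right)
  qed
  let ?L = "\<lambda>\<Omega>. \<Sum>\<epsilon><2. op_part \<epsilon> \<Omega> g \<star> h + sinv \<epsilon> g \<star> op_part \<epsilon> \<Omega> h"
  have k: "\<Omega> (g \<star> h) - ?L \<Omega> \<in> cov_ideal \<E> G" using D g h by blast
  have "?L \<Omega>' - ?L \<Omega> = (\<Sum>\<epsilon><2. (op_part \<epsilon> \<Omega>' g - op_part \<epsilon> \<Omega> g) \<star> h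
      + sinv \<epsilon> g \<star> (op_part \<epsilon> \<Omega>' h - op_part \<epsilon> \<Omega> h))"
    by (simp add: smult_diff_left smult_diff_right sum_subtractf sum.distrib)
  also have "\<dots> \<in> cov_ideal \<E> G"
    by (intro cov_ideal_sum cov_ideal_add cov_ideal_smult_left cov_ideal_smult_right
        op_part_cov_ideal[OF eq] g h Cinf_sinv)
  finally have L: "?L \<Omega>' - ?L \<Omega> \<in> cov_ideal \<E> G" .
  have "\<Omega>' (g \<star> h) - ?L \<Omega>'
      = (\<Omega>' (g \<star> h) - \<Omega> (g \<star> h)) + ((\<Omega> (g \<star> h) - ?L \<Omega>) - (?L \<Omega>' - ?L \<Omega>))"
    by (simp only: algebra_simps diff_add_cancel add_diff_cancel)
  also have "\<dots> \<in> cov_ideal \<E> G"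
    by (rule cov_ideal_add[OF eq[OF Cinf_smult[OF g h]] cov_ideal_diff[OF k L]])
  finally show "\<Omega>' (g \<star> h) - ?L \<Omega>' \<in> cov_ideal \<E> G" .
qed

section \<open>Combinations of the realised basis fields with coefficients on the jets\<close>

abbreviation "R k \<equiv> realisation G \<mu> (gbasis G k)"

definition vop :: "(nat \<Rightarrow> superfun) \<Rightarrow> vfield"
  where "vop h g = (\<Sum>k<gdim G. h k \<star> R k g)"

definition vop_coef :: "(nat \<Rightarrow> superfun) \<Rightarrow> nat \<Rightarrow> superfun"
  where "vop_coef h l = (\<Sum>k<gdim G. h k \<star> rcoef G \<mu> (gbasis G k) l)"

lemma vop_vert:
  assumes "g \<in> Cinf W"
  shows "vop h g = vert G (vop_coef h) g"
proof -
  have "vert G (vop_coef h) g = vert G (\<lambda>l. \<Sum>k\<in>{..<gdim G}. h k \<star> rcoef G \<mu> (gbasis G k) l) g"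
    by (rule vert_cong) (simp add: vop_coef_def)
  then show ?thesis unfolding vop_def vert_lincomb realisation_eq_vert[OF assms] by simp
qed

lemma vop_coef_Cinf:
  assumes "\<And>k. k < gdim G \<Longrightarrow> h k \<in> Cinf (jet_coords \<E>)" "l \<in> {1..topidx G}"
  shows "vop_coef h l \<in> Cinf W"
  unfolding vop_coef_def using assms by (intro Cinf_sum Cinf_smult Cinf_rcoef_W Cinf_jet) auto

lemma vop_Cinf:
  assumes "\<And>k. k < gdim G \<Longrightarrow> h k \<in> Cinf (jet_coords \<E>)" "g \<in> Cinf W"
  shows "vop h g \<in> Cinf W"
  unfolding vop_vert[OF assms(2)] by (rule vert_Cinf[OF assms(2) vop_coef_Cinf[OF assms(1)]])

lemma vop_GT0:
  assumes "\<And>k. k < gdim G \<Longrightarrow> h k \<in> Cinf (jet_coords \<E>)"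
  shows "vop h \<in> GT0 \<E> G"
  by (rule GT0I[OF vop_vert vop_coef_Cinf[OF assms]])

lemma vop_cong:
  assumes "\<And>k. k < gdim G \<Longrightarrow> h k - h' k \<in> jet_ideal \<E>" "g \<in> Cinf W"
  shows "vop h g - vop h' g \<in> cov_ideal \<E> G"
  unfolding vop_def sum_subtractf[symmetric] smult_diff_left[symmetric]
  using assms by (intro cov_ideal_sum cov_ideal_smult_right jet_ideal_cov Cinf_realisation_W) auto

section \<open>The total derivatives of the covering and their commutators\<close>

abbreviation "wv v \<equiv> acomp wx wt v"

lemma wv_Cinf: "l \<in> {1..topidx G} \<Longrightarrow> wv v l \<in> Cinf W"
  and wv_parity: "vert_parity G 0 (wv v)"
proof -
  show "l \<in> {1..topidx G} \<Longrightarrow> wv v l \<in> Cinf W"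
    using covering unfolding covering_def acomp_def by (cases v) auto
  have "has_parity (cpar (wcoord G l)) (wv v l)" if "l \<in> {1..topidx G}" for l
    using covering that unfolding covering_def acomp_def by (cases v) auto
  then show "vert_parity G 0 (wv v)" by (simp add: vert_parity_def)
qed

lemma contract_coord_fun:
  assumes "l \<in> {1..topidx G}"
  shows "contract (R k) (extd (coord_fun (wcoord G l))) = rcoef G \<mu> (gbasis G k) l"
proof -
  have "sconst 1 \<noteq> 0" by (rule sconst_1_nonzero)
  then have "{z. extd (coord_fun (wcoord G l)) z \<noteq> 0} = {wcoord G l}"
    by (auto simp: extd_def pd_coord_fun)
  moreover have "R k (coord_fun (wcoord G l)) = rcoef G \<mu> (gbasis G k) l"
  proof -
    have "coord_fun (wcoord G l) \<in> Cinf W"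
      by (rule Cinf_coord_fun) (use fibre_subset assms in blast)
    then have "R k (coord_fun (wcoord G l)) = vert G (rcoef G \<mu> (gbasis G k)) (coord_fun (wcoord G l))"
      by (rule realisation_eq_vert)
    also have "\<dots> = rcoef G \<mu> (gbasis G k) l"
      by (rule vert_coord_fun[of l G "rcoef G \<mu> (gbasis G k)", OF assms Cinf_rcoef_W[OF assms]])
    finally show ?thesis .
  qed
  ultimately show ?thesis
    unfolding contract_def extd_def by (simp add: pd_coord_fun smult_sconst[OF Cinf_rcoef_W[OF assms]])
qed

lemma wv_velocity:
  assumes "l \<in> {1..topidx G}"
  shows "wv v l + vop_coef (av v) l \<in> cov_ideal \<E> G"
proof -
  have "wv v l - fibre_velocity G \<mu> (av v) l \<in> cov_ideal \<E> G"
    using wx_velocity wt_velocity assms by (cases v) (auto simp: acomp_def)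
  then show ?thesis
    unfolding fibre_velocity_def contract_coord_fun[OF assms] vop_coef_def by simp
qed

abbreviation "Dc v \<equiv> Dcov \<E> G v (wv v)"

lemma Dc_eq: "Dc v g = Dtot \<E> v g + vert G (wv v) g"
  by (simp add: Dcov_def vert_def)

lemma Dc_Cinf: "g \<in> Cinf W \<Longrightarrow> Dc v g \<in> Cinf W"
  unfolding Dc_eq by (intro Cinf_add Dtot_Cinf vert_Cinf wv_Cinf jet_deps_subset)

lemma Dc_add: "f \<in> Cinf W \<Longrightarrow> g \<in> Cinf W \<Longrightarrow> Dc v (f + g) = Dc v f + Dc v g"
  by (simp add: Dc_eq Dtot_add[of _ W _ W] vert_add[of _ W _ W])

lemma Dc_has_parity:
  assumes "g \<in> Cinf W" "has_parity e g" "e < 2"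
  shows "has_parity e (Dc v g)"
  using Dtot_has_parity[OF assms, of \<E> v] vert_has_parity[OF assms(1,2) wv_parity, of v] assms(3)
  by (simp add: Dc_eq has_parity_add)

text \<open>The components of \<open>R k\<close> are functions of the fibre alone, so
  \<open>Dtot\<close> kills them, and fibre derivatives commute with \<open>Dtot\<close>.\<close>

lemma Dtot_R:
  assumes "g \<in> Cinf W" "k < gdim G"
  shows "Dtot \<E> v (R k g) = R k (Dtot \<E> v g)"
proof -
  let ?c = "rcoef G \<mu> (gbasis G k)"
  have c: "?c l \<in> Cinf (wcoord G ` {1..topidx G})" if "l \<in> {1..topidx G}" for l
    by (rule Cinf_rcoef[OF \<mu>_nonzero order_refl that])
  have "Dtot \<E> v (?c l \<star> pd (wcoord G l) g) = ?c l \<star> pd (wcoord G l) (Dtot \<E> v g)"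
    if l: "l \<in> {1..topidx G}" for l
  proof -
    have "Dtot \<E> v (?c l) = 0" by (rule Dtot_outside[OF c[OF l]]) (use wcoord_jet in blast)
    then show ?thesis
      by (simp add: Dtot_smult[OF c[OF l] Cinf_pd[OF assms(1)]] pd_Dtot[OF assms(1) wcoord_jet])
  qed
  moreover have "Dtot \<E> v (vert G ?c g) = (\<Sum>l\<in>{1..topidx G}. Dtot \<E> v (?c l \<star> pd (wcoord G l) g))"
    unfolding vert_def by (rule Dtot_sum[of _ _ W]) (intro Cinf_smult Cinf_rcoef_W Cinf_pd assms(1))
  ultimately show ?thesis
    unfolding realisation_eq_vert[OF assms(1)] realisation_eq_vert[OF Dtot_Cinf[OF assms(1) jet_deps_subset]]
    by (simp add: vert_def)
qed

text \<open>Vertical fields annihilate functions on the jets, so only the sign of the Leibniz rule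
  is left of the first factor's derivative.\<close>

lemma R_smult_jet:
  assumes "f \<in> Cinf (jet_coords \<E>)" "g \<in> Cinf W" "k < gdim G"
  shows "R k (f \<star> g) = sinv (bpar G k) f \<star> R k g"
proof -
  have "vert G (rcoef G \<mu> (gbasis G k)) f = 0"
    unfolding vert_def by (simp add: pd_outside[OF assms(1) wcoord_jet])
  then show ?thesis
    unfolding realisation_eq_vert[OF Cinf_smult[OF Cinf_jet[OF assms(1)] assms(2)]]
      realisation_eq_vert[OF assms(2)]
    using vert_smult[OF assms(1,2) vert_parity_rcoef[OF basis_part[OF assms(3)], of \<mu>]] by simp
qed

lemma R_sum:
  assumes "\<And>i. i \<in> I \<Longrightarrow> f i \<in> Cinf W"
  shows "R k (\<Sum>i\<in>I. f i) = (\<Sum>i\<in>I. R k (f i))"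
proof -
  have "R k (\<Sum>i\<in>I. f i) = vert G (rcoef G \<mu> (gbasis G k)) (\<Sum>i\<in>I. f i)"
    by (rule realisation_eq_vert[OF Cinf_sum[OF assms]])
  also have "\<dots> = (\<Sum>i\<in>I. vert G (rcoef G \<mu> (gbasis G k)) (f i))" by (rule vert_sum[OF assms])
  also have "\<dots> = (\<Sum>i\<in>I. R k (f i))"
    by (rule sum.cong[OF refl]) (simp add: realisation_eq_vert[OF assms])
  finally show ?thesis .
qed

lemma R_commutator:
  assumes "x < gdim G" "y < gdim G" "g \<in> Cinf W"
  shows "R x (R y g) - cmul ((- 1) ^ (bpar G x * bpar G y)) (R y (R x g)) = (\<Sum>n<gdim G. cmul (c x y n) (R n g))"
proof -
  have "R x (R y g) - cmul ((- 1) ^ (bpar G x * bpar G y)) (R y (R x g))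
      = realisation G \<mu> (mat_bracket G (gbasis G x) (gbasis G y)) g"
    unfolding mat_bracket_homogeneous[OF basis_part[OF assms(1)] basis_part[OF assms(2)]
      bpar_less[OF assms(1)] bpar_less[OF assms(2)]]
    by (rule realisation_commutator[OF \<mu>_nonzero fibre_subset assms(3) basis_part[OF assms(1)] basis_part[OF assms(2)]])
  also have "\<dots> = (\<Sum>n<gdim G. cmul (c x y n) (R n g))"
    by (rule realisation_lincomb[OF bracket_basis[OF assms(1,2)]])
  finally show ?thesis .
qed

lemma vop_vop:
  assumes "\<And>k. k < gdim G \<Longrightarrow> f k \<in> Cinf (jet_coords \<E>)" "\<And>k. k < gdim G \<Longrightarrow> h k \<in> Cinf (jet_coords \<E>)"
    "g \<in> Cinf W"
  shows "vop f (vop h g) = (\<Sum>x<gdim G. \<Sum>y<gdim G. (f x \<star> sinv (bpar G x) (h y)) \<star> R x (R y g))"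
proof -
  have "R x (vop h g) = (\<Sum>y<gdim G. sinv (bpar G x) (h y) \<star> R x (R y g))" if "x < gdim G" for x
  proof -
    have "R x (vop h g) = (\<Sum>y<gdim G. R x (h y \<star> R y g))"
      unfolding vop_def
      by (intro R_sum Cinf_smult Cinf_realisation_W Cinf_jet[OF assms(2)] assms(3)) auto
    also have "\<dots> = (\<Sum>y<gdim G. sinv (bpar G x) (h y) \<star> R x (R y g))"
      by (rule sum.cong[OF refl]) (simp add: R_smult_jet assms Cinf_realisation_W that)
    finally show ?thesis .
  qed
  then show ?thesis
    unfolding vop_def[of f] by (intro sum.cong refl) (simp add: smult_sum_right smult_assoc)
qed

text \<open>\<open>av v x\<close> has the parity of its basis element, so \<open>vop (av v)\<close>
  is even and its commutator with any \<open>vop h\<close> carries no sign. Bringing the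
  coefficients into the same order turns it into supercommutators of the fields
  \<open>R x\<close>.\<close>

lemma vop_av_commutator:
  assumes h: "\<And>k. k < gdim G \<Longrightarrow> h k \<in> Cinf (jet_coords \<E>)" and g: "g \<in> Cinf W"
  shows "vop (av v) (vop h g) - vop h (vop (av v) g)
    = vop (\<lambda>n. \<Sum>x<gdim G. \<Sum>y<gdim G. cmul (c x y n) (av v x \<star> sinv (bpar G x) (h y))) g"
proof -
  let ?N = "{..<gdim G}"
  let ?q = "\<lambda>x y. av v x \<star> sinv (bpar G x) (h y)"
  have "vop h (vop (av v) g) = (\<Sum>y\<in>?N. \<Sum>x\<in>?N. (h y \<star> sinv (bpar G y) (av v x)) \<star> R y (R x g))"
    by (rule vop_vop[OF h av_Cinf g])
  also have "\<dots> = (\<Sum>x\<in>?N. \<Sum>y\<in>?N. (h y \<star> sinv (bpar G y) (av v x)) \<star> R y (R x g))"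
    by (rule sum.swap)
  also have "\<dots> = (\<Sum>x\<in>?N. \<Sum>y\<in>?N. ?q x y \<star> cmul ((- 1) ^ (bpar G x * bpar G y)) (R y (R x g)))"
  proof (rule sum.cong[OF refl], rule sum.cong[OF refl])
    fix x y assume "x \<in> ?N" "y \<in> ?N"
    then have p: "has_parity (bpar G x) (av v x)" using av_parity by auto
    show "(h y \<star> sinv (bpar G y) (av v x)) \<star> R y (R x g)
      = ?q x y \<star> cmul ((- 1) ^ (bpar G x * bpar G y)) (R y (R x g))"
      unfolding sinv_parity[OF p] by (simp add: smult_commute[OF p, of "h y"] mult.commute)
  qed
  finally have hv: "vop h (vop (av v) g)
    = (\<Sum>x\<in>?N. \<Sum>y\<in>?N. ?q x y \<star> cmul ((- 1) ^ (bpar G x * bpar G y)) (R y (R x g)))" .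
  have vh: "vop (av v) (vop h g) = (\<Sum>x\<in>?N. \<Sum>y\<in>?N. ?q x y \<star> R x (R y g))"
    by (rule vop_vop[OF av_Cinf h g])
  have "vop (av v) (vop h g) - vop h (vop (av v) g)
    = (\<Sum>x\<in>?N. \<Sum>y\<in>?N. ?q x y \<star> (R x (R y g) - cmul ((- 1) ^ (bpar G x * bpar G y)) (R y (R x g))))"
    unfolding vh hv smult_diff_right sum_subtractf ..
  also have "\<dots> = (\<Sum>x\<in>?N. \<Sum>y\<in>?N. \<Sum>n\<in>?N. cmul (c x y n) (?q x y) \<star> R n g)"
    by (rule sum.cong[OF refl], rule sum.cong[OF refl]) (simp add: R_commutator g smult_sum_right)
  also have "\<dots> = (\<Sum>n\<in>?N. \<Sum>x\<in>?N. \<Sum>y\<in>?N. cmul (c x y n) (?q x y) \<star> R n g)"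
    by (rule sum_swap3)
  finally show ?thesis unfolding vop_def smult_sum_left .
qed

lemma Dtot_vop:
  assumes h: "\<And>k. k < gdim G \<Longrightarrow> h k \<in> Cinf (jet_coords \<E>)" and g: "g \<in> Cinf W"
  shows "Dtot \<E> v (vop h g) - vop h (Dtot \<E> v g) = vop (\<lambda>k. Dtot \<E> v (h k)) g"
proof -
  have "Dtot \<E> v (vop h g) = (\<Sum>k<gdim G. Dtot \<E> v (h k \<star> R k g))"
    unfolding vop_def
    by (intro Dtot_sum[of _ _ W] Cinf_smult Cinf_realisation_W Cinf_jet[OF h] g) auto
  also have "\<dots> = (\<Sum>k<gdim G. Dtot \<E> v (h k) \<star> R k g + h k \<star> R k (Dtot \<E> v g))"
    by (rule sum.cong[OF refl])
      (simp add: Dtot_smult[OF h Cinf_realisation_W[OF g]] Dtot_R[OF g])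
  finally show ?thesis by (simp add: vop_def sum.distrib)
qed

text \<open>With \<open>- vop (av v)\<close> in place of the fibre part of \<open>Dc v\<close> the
  identity would be exact. The error operator \<open>?e\<close> takes values in the ideal, and what
  remains is its commutator with \<open>vop ?h\<close>.\<close>

lemma Dc_vop_commutator:
  assumes \<gamma>: "\<gamma> \<in> gforms \<E> G 0" and g: "g \<in> Cinf W"
  shows "(Dc v (vop (\<lambda>k. \<gamma> k {}) g) - vop (\<lambda>k. \<gamma> k {}) (Dc v g)) - vop (covd \<gamma> v) g \<in> cov_ideal \<E> G"
proof -
  let ?h = "\<lambda>k. \<gamma> k {}"
  let ?e = "\<lambda>f. vert G (wv v) f + vop (av v) f"
  have h: "?h k \<in> Cinf (jet_coords \<E>)" for k by (rule gforms_Cinf[OF \<gamma>])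
  have vop_h: "vop ?h f \<in> Cinf W" if "f \<in> Cinf W" for f by (rule vop_Cinf[OF h that])
  have vop_a: "vop (av v) f \<in> Cinf W" if "f \<in> Cinf W" for f by (rule vop_Cinf[OF av_Cinf that])
  have vert_w: "vert G (wv v) f \<in> Cinf W" if "f \<in> Cinf W" for f by (rule vert_Cinf[OF that wv_Cinf])
  have e: "?e f \<in> cov_ideal \<E> G" if "f \<in> Cinf W" for f
  proof -
    have "?e f = vert G (\<lambda>l. wv v l + vop_coef (av v) l) f"
      unfolding vop_vert[OF that] by (simp add: vert_def smult_add_left sum.distrib)
    then show ?thesis using cov_ideal_vert_coeff[OF that wv_velocity] by simp
  qed
  have add: "vop ?h (f + f') = vop ?h f + vop ?h f'" if "f \<in> Cinf W" "f' \<in> Cinf W" for f f'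
    unfolding vop_vert[OF that(1)] vop_vert[OF that(2)] vop_vert[OF Cinf_add[OF that]]
    by (rule vert_add[OF that])
  have ideal: "vop ?h f \<in> cov_ideal \<E> G" if "f \<in> cov_ideal \<E> G" for f
    unfolding vop_vert[OF cov_ideal_Cinf[OF that]] by (rule cov_ideal_vert[OF that vop_coef_Cinf[OF h]])
  have "vop (covd \<gamma> v) g = vop (\<lambda>k. Dtot \<E> v (?h k)) g
      - vop (\<lambda>n. \<Sum>x<gdim G. \<Sum>y<gdim G. cmul (c x y n) (av v x \<star> sinv (bpar G x) (?h y))) g"
    unfolding vop_def covd_def smult_diff_left sum_subtractf ..
  also have "\<dots> = Dtot \<E> v (vop ?h g) - vop ?h (Dtot \<E> v g)
      - (vop (av v) (vop ?h g) - vop ?h (vop (av v) g))"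
    unfolding Dtot_vop[OF h g] vop_av_commutator[OF h g] ..
  finally have covd: "vop (covd \<gamma> v) g = Dtot \<E> v (vop ?h g) - vop ?h (Dtot \<E> v g)
      - (vop (av v) (vop ?h g) - vop ?h (vop (av v) g))" .
  have "vop ?h (Dc v g) = vop ?h (Dtot \<E> v g) + vop ?h (vert G (wv v) g)"
    unfolding Dc_eq by (rule add[OF Dtot_Cinf[OF g jet_deps_subset] vert_w[OF g]])
  moreover have "vop ?h (?e g) = vop ?h (vert G (wv v) g) + vop ?h (vop (av v) g)"
    by (rule add[OF vert_w[OF g] vop_a[OF g]])
  ultimately have "(Dc v (vop ?h g) - vop ?h (Dc v g)) - vop (covd \<gamma> v) g = ?e (vop ?h g) - vop ?h (?e g)"
    unfolding covd Dc_eq[of v "vop ?h g"] by (simp add: fun_eq_iff)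
  also have "\<dots> \<in> cov_ideal \<E> G"
    by (intro cov_ideal_diff ideal e vop_h g)
  finally show ?thesis .
qed

end

section \<open>One-forms on the covering space and the bracket with the structure element\<close>

declare coord_fun.simps [simp del]

text \<open>The horizontal form with components \<open>F Xvar\<close> and \<open>F Tvar\<close>.
  Since dx and dt are even, signs, scalars and parity parts act on the components alone, and
  statements about vector-valued one-forms reduce to statements about functions.\<close>

definition hor :: "(indep \<Rightarrow> superfun) \<Rightarrow> oneform"
  where "hor F A = (case A of Inl (Base v) \<Rightarrow> F v | _ \<Rightarrow> 0)"

lemma hor_Base [simp]: "hor F (Inl (Base v)) = F v"
  by (simp add: hor_def)

lemma hor_other: "(\<And>v. A \<noteq> Inl (Base v)) \<Longrightarrow> hor F A = 0"
  by (auto simp: hor_def split: sum.split ecoord.split)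

lemma hor_cases:
  obtains v where "A = Inl (Base v)" | "\<And>v. A \<noteq> Inl (Base v)"
  by blast

lemma hor_eqI:
  assumes "\<And>v. \<omega> (Inl (Base v)) = F v" "\<And>A. (\<And>v. A \<noteq> Inl (Base v)) \<Longrightarrow> \<omega> A = 0"
  shows "\<omega> = hor F"
proof
  fix A
  show "\<omega> A = hor F A"
  proof (cases A rule: hor_cases)
    case (1 v)
    show ?thesis unfolding 1 hor_Base by (rule assms(1))
  next
    case 2
    show ?thesis unfolding assms(2)[OF 2] hor_other[OF 2] ..
  qed
qed

lemma hor_diff: "hor F - hor F' = hor (\<lambda>v. F v - F' v)"
  by (rule hor_eqI) (simp_all only: plus_fun_apply minus_apply hor_Base hor_other, simp_all add: hor_other)

lemma hor_add: "hor F + hor F' = hor (\<lambda>v. F v + F' v)"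
  by (rule hor_eqI) (simp_all only: plus_fun_apply minus_apply hor_Base hor_other, simp_all add: hor_other)

lemma hor_sum_lessThan_2: "(\<Sum>e<(2::nat). hor (F e)) = hor (\<lambda>v. \<Sum>e<2. F e v)"
  unfolding sum_lessThan_2 by (rule hor_add)

lemma form_scale_hor: "form_scale r (hor F) = hor (\<lambda>v. cmul r (F v))"
  by (rule hor_eqI) (simp_all only: plus_fun_apply minus_apply hor_Base hor_other form_scale_def, simp_all add: hor_other)

lemma rmul_hor: "rmul (hor F) f = hor (\<lambda>v. F v \<star> f)"
  by (rule hor_eqI) (simp_all only: plus_fun_apply minus_apply hor_Base hor_other rmul_def, simp_all add: hor_other)

lemma lmul_hor: "lmul f (hor F) = hor (\<lambda>v. f \<star> F v)"
  by (rule hor_eqI) (simp_all only: plus_fun_apply minus_apply hor_Base hor_other lmul_def, simp_all add: hor_other)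

lemma form_part_hor: "e < 2 \<Longrightarrow> form_part e (hor F) = hor (\<lambda>v. spart e (F v))"
  by (rule hor_eqI) (simp_all add: form_part_def hor_other)

lemma of_hform_hor: "of_hform \<omega> = hor (\<lambda>v. \<omega> {v})"
  by (simp add: of_hform_def hor_def fun_eq_iff)

lemma hor_cong: "(\<And>v. F v = F' v) \<Longrightarrow> hor F = hor F'"
  by (rule arg_cong[where f = hor], rule ext)

context covering_data
begin

lemma Base_in_W: "Inl (Base v) \<in> W"
  by (auto simp: cov_coords_def jet_coords_def)

lemma hor_Lambda1:
  assumes "\<And>v. F v \<in> Cinf W"
  shows "hor F \<in> Lambda1 \<E> G"
  unfolding Lambda1_def mem_Collect_eq
proof (intro conjI allI)
  show "hor F A \<in> Cinf W" for A
    by (cases A rule: hor_cases) (simp_all add: hor_other assms)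
  have *: "{A. hor F A \<noteq> 0} \<subseteq> {Inl (Base Xvar), Inl (Base Tvar)}"
  proof
    fix A assume "A \<in> {A. hor F A \<noteq> 0}"
    then obtain v where "A = Inl (Base v)" using hor_other by blast
    then show "A \<in> {Inl (Base Xvar), Inl (Base Tvar)}" by (cases v) auto
  qed
  then show "finite {A. hor F A \<noteq> 0}" by (rule finite_subset) simp
  show "{A. hor F A \<noteq> 0} \<subseteq> W" using * Base_in_W by blast
qed

lemma hor_null:
  assumes "\<And>v. F v \<in> cov_ideal \<E> G"
  shows "hor F \<in> null_forms \<E> G"
proof -
  let ?s = "\<lambda>v. hor (\<lambda>v'. if v' = v then sconst 1 else 0)"
  have L: "?s v \<in> Lambda1 \<E> G" for v by (rule hor_Lambda1) simp
  have "hor F = rmul (?s Xvar) (F Xvar) + rmul (?s Tvar) (F Tvar)"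
    unfolding rmul_hor hor_add
  proof (rule hor_cong)
    fix v
    show "F v = (if v = Xvar then sconst 1 else 0) \<star> F Xvar + (if v = Tvar then sconst 1 else 0) \<star> F Tvar"
      by (cases v) (simp_all add: sconst_smult[OF cov_ideal_Cinf[OF assms]])
  qed
  moreover have "rmul (?s v) (F v) \<in> null_forms \<E> G" for v by (rule null_forms.ideal[OF L assms])
  ultimately show ?thesis by (simp only: null_forms.add)
qed

lemma vform_part_hor:
  assumes "\<And>g. g \<in> Cinf W \<Longrightarrow> \<Theta> g = hor (\<lambda>v. P v g)" "g \<in> Cinf W"
  shows "vform_part e \<Theta> g = hor (\<lambda>v. op_part e (P v) g)"
proof -
  have "vform_part e \<Theta> g = (\<Sum>n<2. hor (\<lambda>v. spart ((e + n) mod 2) (P v (spart n g))))"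
    unfolding vform_part_def
    by (rule sum.cong[OF refl]) (simp add: assms(1) Cinf_spart[OF assms(2)] form_part_hor)
  then show ?thesis unfolding hor_sum_lessThan_2 op_part_def .
qed

text \<open>The conditions on a horizontal vector-valued form are those on its components; their
  errors lie in the ideal, and \<open>hor_null\<close> turns these into null forms.\<close>

lemma hor_GT1:
  assumes \<Theta>: "\<And>g. g \<in> Cinf W \<Longrightarrow> \<Theta> g = hor (\<lambda>v. P v g)" and P: "\<And>v. P v \<in> GT0 \<E> G"
  shows "\<Theta> \<in> GT1 \<E> G"
  unfolding GT1_def mem_Collect_eq
proof (intro conjI ballI allI impI)
  fix g h assume g: "g \<in> Cinf W" and h: "h \<in> Cinf W"
  note D = P[unfolded GT0_def mem_Collect_eq]
  have vp: "vform_part e \<Theta> f = hor (\<lambda>v. op_part e (P v) f)" if "f \<in> Cinf W" for e f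
    by (rule vform_part_hor[OF \<Theta> that])
  show "\<Theta> g \<in> Lambda1 \<E> G" unfolding \<Theta>[OF g] by (rule hor_Lambda1) (use D g in blast)
  show "\<Theta> g - \<Theta> h \<in> null_forms \<E> G" if "g - h \<in> cov_ideal \<E> G"
    unfolding \<Theta>[OF g] \<Theta>[OF h] hor_diff by (rule hor_null) (use D g h that in blast)
  show "\<Theta> (g + h) - (\<Theta> g + \<Theta> h) \<in> null_forms \<E> G"
    unfolding \<Theta>[OF g] \<Theta>[OF h] \<Theta>[OF Cinf_add[OF g h]] hor_add hor_diff
    by (rule hor_null) (use D g h in blast)
  show "\<Theta> (cmul r g) - form_scale r (\<Theta> g) \<in> null_forms \<E> G" for r
    unfolding \<Theta>[OF g] \<Theta>[OF Cinf_cmul[OF g]] form_scale_hor hor_diff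
    by (rule hor_null) (use D g in blast)
  show "\<Theta> (g \<star> h) - (\<Sum>\<epsilon><2. rmul (vform_part \<epsilon> \<Theta> g) h + lmul (sinv \<epsilon> g) (vform_part \<epsilon> \<Theta> h)) \<in> null_forms \<E> G"
    unfolding \<Theta>[OF Cinf_smult[OF g h]] vp[OF g] vp[OF h]
      rmul_hor lmul_hor hor_add hor_sum_lessThan_2 hor_diff
    by (rule hor_null) (use D g h in blast)
qed

lemma hor_vform_eq:
  assumes "\<And>g. g \<in> Cinf W \<Longrightarrow> \<Theta> g = hor (\<lambda>v. P v g)" "\<And>g. g \<in> Cinf W \<Longrightarrow> \<Theta>' g = hor (\<lambda>v. P' v g)"
    and "\<And>v g. g \<in> Cinf W \<Longrightarrow> P v g - P' v g \<in> cov_ideal \<E> G"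
  shows "vform_eq \<E> G \<Theta> \<Theta>'"
  unfolding vform_eq_def
proof
  fix g assume g: "g \<in> Cinf W"
  show "\<Theta> g - \<Theta>' g \<in> null_forms \<E> G"
    unfolding assms(1)[OF g] assms(2)[OF g] hor_diff by (rule hor_null[OF assms(3)[OF g]])
qed

section \<open>The structure element and its bracket with vertical fields\<close>

abbreviation "U \<equiv> structure_element \<E> G wx wt"

lemma cartan_d_eval:
  assumes "z \<in> jet_deps \<E>"
  shows "cartan_d \<E> (coord_fun z) A = pd A (coord_fun z) - hor (\<lambda>v. coord_fun (jet_shift v z)) A"
proof -
  have "of_hform (dh \<E> (hfun (coord_fun z))) = hor (\<lambda>v. coord_fun (jet_shift v z))"
    unfolding of_hform_hor dh_singleton by (rule hor_cong) (simp add: hfun_def Dtot_coord_fun[OF assms])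
  then show ?thesis by (simp add: cartan_d_def extd_def)
qed

abbreviation contact_form :: "nat \<Rightarrow> oneform"
  where "contact_form l \<equiv> extd (coord_fun (wcoord G l)) - lmul (wx l) (extd (coord_fun (Inl (Base Xvar))))
    - lmul (wt l) (extd (coord_fun (Inl (Base Tvar))))"

lemma contact_form_eval:
  assumes "l \<in> {1..topidx G}"
  shows "contact_form l A
    = pd A (coord_fun (wcoord G l)) - hor (\<lambda>v. wv v l) A"
proof -
  have w: "wx l \<in> Cinf W" "wt l \<in> Cinf W"
    using wv_Cinf[OF assms, of Xvar] wv_Cinf[OF assms, of Tvar] by (simp_all add: acomp_def)
  show ?thesis
  proof (cases A rule: hor_cases)
    case (1 v)
    then show ?thesis
      by (cases v) (simp_all add: extd_def lmul_def pd_coord_fun smult_sconst[OF w(1)] smult_sconst[OF w(2)] acomp_def)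
  next
    case 2
    then show ?thesis by (simp add: extd_def lmul_def pd_coord_fun hor_other)
  qed
qed

text \<open>The leading differentials of the contact forms contribute the jet and fibre components
  of \<open>extd g\<close>, while their horizontal corrections assemble into the total derivatives
  of the covering.\<close>

lemma structure_element_eq:
  assumes g: "g \<in> Cinf W"
  shows "U g = extd g - hor (\<lambda>v. Dc v g)"
proof
  fix A
  let ?Z = "jet_support \<E> g" and ?L = "{1..topidx G}"
  note pdC = Cinf_pd[OF g]
  have fin: "finite ?Z" by (rule jet_support_finite[OF g])
  have "U g A = (\<Sum>z\<in>?Z. cartan_d \<E> (coord_fun z) A \<star> pd z g)
      + (\<Sum>l\<in>?L. contact_form l A \<star> pd (wcoord G l) g)"
    unfolding structure_element_def jet_support_def[symmetric] plus_fun_apply sum_fun_eval[of _ _ A] rmul_def ..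
  also have "(\<Sum>z\<in>?Z. cartan_d \<E> (coord_fun z) A \<star> pd z g)
      = (\<Sum>z\<in>?Z. pd A (coord_fun z) \<star> pd z g) - (\<Sum>z\<in>?Z. hor (\<lambda>v. coord_fun (jet_shift v z)) A \<star> pd z g)"
    unfolding sum_subtractf[symmetric] smult_diff_left[symmetric]
    using jet_support_deps by (intro sum.cong refl arg_cong2[where f = "(\<star>)"] cartan_d_eval) blast
  also have "(\<Sum>z\<in>?Z. pd A (coord_fun z) \<star> pd z g) = (if A \<in> ?Z then pd A g else 0)"
  proof -
    have "(\<Sum>z\<in>?Z. pd A (coord_fun z) \<star> pd z g) = (\<Sum>z\<in>?Z. if z = A then pd A g else 0)"
      by (rule sum.cong[OF refl]) (auto simp: pd_coord_fun sconst_smult[OF pdC])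
    then show ?thesis using fin by simp
  qed
  also have "(\<Sum>l\<in>?L. contact_form l A \<star> pd (wcoord G l) g)
      = (\<Sum>l\<in>?L. pd A (coord_fun (wcoord G l)) \<star> pd (wcoord G l) g)
        - (\<Sum>l\<in>?L. hor (\<lambda>v. wv v l) A \<star> pd (wcoord G l) g)"
    unfolding sum_subtractf[symmetric] smult_diff_left[symmetric]
    by (rule sum.cong[OF refl]) (simp only: contact_form_eval)
  also have "(\<Sum>l\<in>?L. pd A (coord_fun (wcoord G l)) \<star> pd (wcoord G l) g)
      = (if A \<in> wcoord G ` ?L then pd A g else 0)"
  proof (cases "A \<in> wcoord G ` ?L")
    case True
    then obtain l where l: "A = wcoord G l" "l \<in> ?L" by blast
    have "(\<Sum>l'\<in>?L. pd A (coord_fun (wcoord G l')) \<star> pd (wcoord G l') g)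
        = (\<Sum>l'\<in>?L. if l' = l then pd A g else 0)"
      by (rule sum.cong[OF refl]) (auto simp: l(1) wcoord_inject pd_coord_fun sconst_smult[OF pdC])
    then show ?thesis using True l by simp
  next
    case False
    have "(\<Sum>l\<in>?L. pd A (coord_fun (wcoord G l)) \<star> pd (wcoord G l) g) = 0"
      by (rule sum.neutral) (use False in \<open>auto simp: pd_coord_fun\<close>)
    then show ?thesis using False by simp
  qed
  finally have U: "U g A = (if A \<in> ?Z then pd A g else 0)
      - (\<Sum>z\<in>?Z. hor (\<lambda>v. coord_fun (jet_shift v z)) A \<star> pd z g)
      + ((if A \<in> wcoord G ` ?L then pd A g else 0) - (\<Sum>l\<in>?L. hor (\<lambda>v. wv v l) A \<star> pd (wcoord G l) g))" .
  show "U g A = (extd g - hor (\<lambda>v. Dc v g)) A"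
  proof (cases A rule: hor_cases)
    case (1 v)
    \<comment> \<open>No contact form has dx or dt as leading differential. On the right the base
      derivative in \<open>extd g\<close> cancels the one inside \<open>Dtot\<close>, which
      matches.\<close>
    have "A \<notin> ?Z" "A \<notin> wcoord G ` ?L"
      unfolding 1 by (auto simp: jet_support_def jet_deps_def wcoord_def split: if_splits)
    then show ?thesis
      unfolding U
      by (simp add: 1 extd_def Dc_eq vert_def Dtot_eq[OF fin jet_support_deps jet_support_zero])
        (simp add: fun_eq_iff)
  next
    case 2
    \<comment> \<open>Every other coordinate of the covering is either a jet or a fibre variable and
      never both, so exactly one summand can contribute.\<close>
    have "(if A \<in> ?Z then pd A g else 0) + (if A \<in> wcoord G ` ?L then pd A g else 0) = pd A g"
    proof (cases "A \<in> W")
      case True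
      then have "A \<in> jet_deps \<E> \<or> A \<in> wcoord G ` ?L"
        using 2 by (auto simp: cov_coords_def jet_coords_def)
      moreover have "A \<notin> jet_deps \<E>" if "A \<in> wcoord G ` ?L"
        using that wcoord_jet by (auto simp: jet_coords_def)
      ultimately show ?thesis using jet_support_deps[of \<E> g] jet_support_zero[of A \<E> g] by auto
    next
      case False
      then show ?thesis using pd_outside[OF g] by simp
    qed
    then show ?thesis unfolding U hor_other[OF 2] by (simp add: extd_def hor_other[OF 2])
  qed
qed

lemma structure_element_apply:
  assumes "g \<in> Cinf W"
  shows "U g A = pd A g - hor (\<lambda>v. Dc v g) A"
  unfolding structure_element_eq[OF assms] by (simp add: extd_def)

lemma extd_add: "f \<in> Cinf W \<Longrightarrow> g \<in> Cinf W \<Longrightarrow> extd (f + g) = extd f + extd g"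
  by (simp add: extd_def pd_add fun_eq_iff)

lemma structure_element_add:
  assumes "f \<in> Cinf W" "g \<in> Cinf W"
  shows "U (f + g) = U f + U g"
proof -
  have "U (f + g) = extd f + extd g - (hor (\<lambda>v. Dc v f) + hor (\<lambda>v. Dc v g))"
    unfolding structure_element_eq[OF Cinf_add[OF assms]] extd_add[OF assms] Dc_add[OF assms] hor_add ..
  then show ?thesis
    unfolding structure_element_eq[OF assms(1)] structure_element_eq[OF assms(2)] by simp
qed

lemma structure_element_parity:
  assumes "g \<in> Cinf W" "has_parity e g" "e < 2"
  shows "has_parity ((e + cpar A) mod 2) (U g A)"
proof -
  have "has_parity ((e + cpar A) mod 2) (hor (\<lambda>v. Dc v g) A)"
    by (cases A rule: hor_cases) (use Dc_has_parity[OF assms] assms(3) in \<open>simp_all add: hor_other\<close>)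
  with has_parity_pd[OF assms(1,2) refl, of A] show ?thesis
    unfolding structure_element_eq[OF assms(1)] by (simp add: extd_def has_parity_diff)
qed

text \<open>The structure element is even once the parity of each differential is counted, so a
  single parity survives in the bracket.\<close>

lemma structure_element_part:
  assumes "g \<in> Cinf W" "d < 2"
  shows "vform_part d U g = (if d = 0 then U g else 0)"
proof -
  have part: "form_part ((d + e) mod 2) (U (spart e g)) = (if d = 0 then U (spart e g) else 0)" if "e < 2" for e
  proof
    fix A
    have "((d + e) mod 2 + cpar A) mod 2 = (e + cpar A) mod 2 \<longleftrightarrow> d = 0"
      using assms(2) by presburger
    then show "form_part ((d + e) mod 2) (U (spart e g)) A = (if d = 0 then U (spart e g) else 0) A"
      using spart_parity[OF structure_element_parity[OF Cinf_spart[OF assms(1)] has_parity_spart that, of A]]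
      by (simp add: form_part_def)
  qed
  have "vform_part d U g = (if d = 0 then U (spart 0 g) + U (spart 1 g) else 0)"
    unfolding vform_part_def sum_lessThan_2 using part[of 0] part[of 1] by simp
  also have "U (spart 0 g) + U (spart 1 g) = U (spart 0 g + spart 1 g)"
    by (rule structure_element_add[symmetric]) (intro Cinf_spart assms(1))+
  also have "spart 0 g + spart 1 g = g" using spart_decompose[of g] by (simp only: sum_lessThan_2)
  finally show ?thesis .
qed

lemma structure_element_Cinf: "g \<in> Cinf W \<Longrightarrow> U g A \<in> Cinf W"
  unfolding structure_element_eq
  by (cases A rule: hor_cases) (simp_all add: hor_other extd_def Cinf_diff Cinf_pd Dc_Cinf)

lemma structure_element_support:
  assumes g: "g \<in> Cinf W"
  shows "finite {A. U g A \<noteq> 0}" "{A. U g A \<noteq> 0} \<subseteq> W"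
proof -
  have sub: "{A. U g A \<noteq> 0} \<subseteq> {A. pd A g \<noteq> 0} \<union> {A. hor (\<lambda>v. Dc v g) A \<noteq> 0}"
    unfolding structure_element_eq[OF g] by (auto simp: extd_def)
  have "hor (\<lambda>v. Dc v g) \<in> Lambda1 \<E> G" by (rule hor_Lambda1[OF Dc_Cinf[OF g]])
  then have h: "finite {A. hor (\<lambda>v. Dc v g) A \<noteq> 0}" "{A. hor (\<lambda>v. Dc v g) A \<noteq> 0} \<subseteq> W"
    unfolding Lambda1_def by blast+
  show "finite {A. U g A \<noteq> 0}" using finite_subset[OF sub] finite_pd[OF g] h(1) by blast
  show "{A. U g A \<noteq> 0} \<subseteq> W" using sub h(2) pd_outside[OF g] by blast
qed

text \<open>A vertical field moves only the fibre coordinates, which reduces the terms with the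
  differential of \<open>V (coord_fun A)\<close> to the fibre; in the other terms the differential
  of \<open>A\<close> picks out the component at \<open>B\<close>.\<close>

lemma lie_form_eval:
  assumes V: "\<And>f. f \<in> Cinf W \<Longrightarrow> V f = vert G d f" and d: "\<And>l. l \<in> {1..topidx G} \<Longrightarrow> d l \<in> Cinf W"
    and \<omega>: "\<And>A. \<omega> A \<in> Cinf W" "finite {A. \<omega> A \<noteq> 0}" "{A. \<omega> A \<noteq> 0} \<subseteq> W"
  shows "lie_form e V \<omega> B = (\<Sum>l\<in>{1..topidx G}. pd B (d l) \<star> \<omega> (wcoord G l))
    + cmul ((- 1) ^ (e * cpar B)) (vert G d (\<omega> B))"
proof -
  let ?T = "{A. \<omega> A \<noteq> 0}" and ?L = "{1..topidx G}"
  have "lie_form e V \<omega> B = (\<Sum>A\<in>?T. pd B (V (coord_fun A)) \<star> \<omega> A)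
      + (\<Sum>A\<in>?T. cmul ((- 1) ^ (e * cpar A)) (pd B (coord_fun A) \<star> V (\<omega> A)))"
    unfolding lie_form_def sum_fun_eval[of _ _ B]
    by (simp add: rmul_def extd_def form_scale_def sum.distrib)
  \<comment> \<open>Enlarging the support by all fibre coordinates, and then dropping the
    coordinates that \<open>V\<close> annihilates, gives a range that no longer depends on
    \<omega>.\<close>
  also have "(\<Sum>A\<in>?T. pd B (V (coord_fun A)) \<star> \<omega> A)
      = (\<Sum>A\<in>?T \<union> wcoord G ` ?L. pd B (V (coord_fun A)) \<star> \<omega> A)"
    by (rule sum.mono_neutral_left) (use \<omega>(2) in auto)
  also have "\<dots> = (\<Sum>A\<in>wcoord G ` ?L. pd B (V (coord_fun A)) \<star> \<omega> A)"
  proof (rule sum.mono_neutral_right)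
    show "\<forall>A\<in>(?T \<union> wcoord G ` ?L) - wcoord G ` ?L. pd B (V (coord_fun A)) \<star> \<omega> A = 0"
    proof
      fix A assume A: "A \<in> (?T \<union> wcoord G ` ?L) - wcoord G ` ?L"
      then have "V (coord_fun A) = vert G d (coord_fun A)" using \<omega>(3) by (intro V Cinf_coord_fun) auto
      also have "\<dots> = 0" using A by (intro vert_coord_fun_outside) auto
      finally show "pd B (V (coord_fun A)) \<star> \<omega> A = 0" by simp
    qed
  qed (use \<omega>(2) in auto)
  also have "\<dots> = (\<Sum>l\<in>?L. pd B (d l) \<star> \<omega> (wcoord G l))"
  proof -
    have "inj_on (wcoord G) ?L" by (rule inj_onI) (simp add: wcoord_inject)
    moreover have "V (coord_fun (wcoord G l)) = d l" if l: "l \<in> ?L" for l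
    proof -
      have "V (coord_fun (wcoord G l)) = vert G d (coord_fun (wcoord G l))"
        using fibre_subset l by (intro V Cinf_coord_fun) blast
      then show ?thesis using vert_coord_fun[of l G d W, OF l d[OF l]] by simp
    qed
    ultimately show ?thesis by (simp add: sum.reindex)
  qed
  also have "(\<Sum>A\<in>?T. cmul ((- 1) ^ (e * cpar A)) (pd B (coord_fun A) \<star> V (\<omega> A)))
      = cmul ((- 1) ^ (e * cpar B)) (vert G d (\<omega> B))"
  proof -
    have C: "vert G d (\<omega> B) \<in> Cinf W" by (rule vert_Cinf[OF \<omega>(1) d])
    have "(\<Sum>A\<in>?T. cmul ((- 1) ^ (e * cpar A)) (pd B (coord_fun A) \<star> V (\<omega> A)))
        = (\<Sum>A\<in>?T. if A = B then cmul ((- 1) ^ (e * cpar B)) (vert G d (\<omega> B)) else 0)"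
      by (rule sum.cong[OF refl]) (auto simp: pd_coord_fun V[OF \<omega>(1)] sconst_smult[OF C])
    also have "\<dots> = cmul ((- 1) ^ (e * cpar B)) (vert G d (\<omega> B))"
      using \<omega>(2) by auto
    finally show ?thesis .
  qed
  finally show ?thesis .
qed

text \<open>By \<open>pd_vert\<close> the \<open>extd\<close> part of the Lie derivative cancels
  that of \<open>U (V g)\<close>. As \<open>V\<close> annihilates x and t, it acts on the horizontal
  part through the coefficients, without a sign since dx and dt are even.\<close>

lemma lie_form_structure_element:
  assumes V: "\<And>f. f \<in> Cinf W \<Longrightarrow> V f = vert G d f" and d: "\<And>l. l \<in> {1..topidx G} \<Longrightarrow> d l \<in> Cinf W"
    and p: "vert_parity G e d" and g: "g \<in> Cinf W"
  shows "lie_form e V (U g) - U (V g) = hor (\<lambda>v. Dc v (V g) - V (Dc v g))"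
proof
  fix B
  have Vg: "V g \<in> Cinf W" unfolding V[OF g] by (rule vert_Cinf[OF g d])
  have fibre: "U g (wcoord G l) = pd (wcoord G l) g" for l
  proof -
    have "hor (\<lambda>v. Dc v g) (wcoord G l) = 0" by (rule hor_other) (simp add: wcoord_def)
    then show ?thesis unfolding structure_element_eq[OF g] by (simp add: extd_def)
  qed
  have hC: "hor (\<lambda>v. Dc v g) B \<in> Cinf W"
    by (cases B rule: hor_cases) (simp_all add: hor_other Dc_Cinf[OF g])
  have pv: "pd B (vert G d g)
      = vert G (\<lambda>l. pd B (d l)) g + cmul ((- 1) ^ (e * cpar B)) (vert G d (pd B g))"
    by (rule pd_vert[OF g d p])
  have "lie_form e V (U g) B = (\<Sum>l\<in>{1..topidx G}. pd B (d l) \<star> U g (wcoord G l))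
      + cmul ((- 1) ^ (e * cpar B)) (vert G d (U g B))"
    by (rule lie_form_eval[OF V d structure_element_Cinf[OF g] structure_element_support[OF g]])
  also have "(\<Sum>l\<in>{1..topidx G}. pd B (d l) \<star> U g (wcoord G l)) = vert G (\<lambda>l. pd B (d l)) g"
    unfolding fibre vert_def ..
  also have "vert G d (U g B) = vert G d (pd B g) - vert G d (hor (\<lambda>v. Dc v g) B)"
    unfolding structure_element_apply[OF g]
    by (rule vert_diff[OF Cinf_pd[OF g] hC])
  finally have "lie_form e V (U g) B = pd B (vert G d g) - cmul ((- 1) ^ (e * cpar B)) (vert G d (hor (\<lambda>v. Dc v g) B))"
    unfolding pv cmul_diff_right by (simp only: add_diff_eq)
  then have "(lie_form e V (U g) - U (V g)) B
      = hor (\<lambda>v. Dc v (V g)) B - cmul ((- 1) ^ (e * cpar B)) (vert G d (hor (\<lambda>v. Dc v g) B))"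
    using structure_element_apply[OF Vg, of B] by (simp add: V[OF g])
  also have "\<dots> = hor (\<lambda>v. Dc v (V g) - V (Dc v g)) B"
  proof (cases B rule: hor_cases)
    case (1 v)
    show ?thesis
      unfolding 1 hor_Base V[OF Dc_Cinf[OF g]]
      by (simp only: cpar.simps mult_zero_right power_0 cmul_one)
  next
    case 2
    show ?thesis unfolding hor_other[OF 2] by simp
  qed
  finally show "(lie_form e V (U g) - U (V g)) B = hor (\<lambda>v. Dc v (V g) - V (Dc v g)) B" .
qed

lemma lie_form_0: "lie_form e V 0 = 0"
  by (simp add: lie_form_def)

lemma form_scale_simps: "form_scale 1 \<omega> = \<omega>" "form_scale r 0 = 0"
  by (simp_all add: form_scale_def fun_eq_iff cmul_def)

text \<open>For each parity part of \<Omega> only the even part of the structure element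
  contributes, with sign 1; additivity of \<open>Dc v\<close> then reassembles the parts.\<close>

lemma partial_U_vert:
  assumes \<Omega>: "\<And>f. f \<in> Cinf W \<Longrightarrow> \<Omega> f = vert G d f" and d: "\<And>l. l \<in> {1..topidx G} \<Longrightarrow> d l \<in> Cinf W"
    and g: "g \<in> Cinf W"
  shows "partial_U U \<Omega> g = hor (\<lambda>v. Dc v (\<Omega> g) - \<Omega> (Dc v g))"
proof -
  have op: "op_part e \<Omega> f = vert G (vpart e d) f" if "e < 2" "f \<in> Cinf W" for e f
  proof -
    have "op_part e \<Omega> f = op_part e (vert G d) f" by (rule op_part_cong[OF \<Omega> that(2)])
    then show ?thesis using op_part_vert_vpart[OF that(2,1)] by simp
  qed
  have one2: "(1::nat) < 2" by simp
  have vd: "vpart e d l \<in> Cinf W" if "l \<in> {1..topidx G}" for e l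
    unfolding vpart_def by (rule Cinf_spart[OF d[OF that]])
  have opC: "op_part e \<Omega> g \<in> Cinf W" if "e < 2" for e
    unfolding op[OF that g] by (rule vert_Cinf[OF g vd])
  have main: "lie_form e (op_part e \<Omega>) (U g) - U (op_part e \<Omega> g)
      = hor (\<lambda>v. Dc v (op_part e \<Omega> g) - op_part e \<Omega> (Dc v g))" if "e < 2" for e
    by (rule lie_form_structure_element[OF op[OF that] vd vert_parity_vpart g])
  have "partial_U U \<Omega> g = (\<Sum>e<2. lie_form e (op_part e \<Omega>) (U g) - U (op_part e \<Omega> g))"
    unfolding partial_U_def fn_bracket_def
  proof (rule sum.cong[OF refl])
    fix e :: nat assume "e \<in> {..<2}"
    then have e: "e < 2" by simp
    show "(\<Sum>\<delta><2. lie_form e (op_part e \<Omega>) (vform_part \<delta> U g)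
        - form_scale ((- 1) ^ (0 * 1 + e * \<delta>)) (vform_part \<delta> U (op_part e \<Omega> g)))
      = lie_form e (op_part e \<Omega>) (U g) - U (op_part e \<Omega> g)"
      unfolding sum_lessThan_2 structure_element_part[OF g pos2] structure_element_part[OF g one2]
        structure_element_part[OF opC[OF e] pos2] structure_element_part[OF opC[OF e] one2]
      by (simp add: lie_form_0 form_scale_simps)
  qed
  also have "\<dots> = hor (\<lambda>v. \<Sum>e<2. Dc v (op_part e \<Omega> g) - op_part e \<Omega> (Dc v g))"
    unfolding hor_sum_lessThan_2[symmetric] by (rule sum.cong[OF refl]) (simp add: main)
  also have "\<dots> = hor (\<lambda>v. Dc v (\<Omega> g) - \<Omega> (Dc v g))"
  proof (rule hor_cong)
    fix v
    have split: "\<Omega> f = op_part 0 \<Omega> f + op_part 1 \<Omega> f" if "f \<in> Cinf W" for f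
      unfolding \<Omega>[OF that] vert_vpart[of d f] sum_lessThan_2 using op[of 0 f] op[of 1 f] that by simp
    show "(\<Sum>e<2. Dc v (op_part e \<Omega> g) - op_part e \<Omega> (Dc v g)) = Dc v (\<Omega> g) - \<Omega> (Dc v g)"
      unfolding split[OF g] split[OF Dc_Cinf[OF g]] sum_lessThan_2 Dc_add[OF opC[OF pos2] opC[OF one2]]
      by simp
  qed
  finally show ?thesis .
qed

section \<open>The arrows of the diagram on representatives\<close>

lemma varrho0_vop: "varrho0 G \<mu> \<gamma> = vop (\<lambda>k. \<gamma> k {})"
  by (simp add: varrho0_def vop_def fun_eq_iff)

lemma varrho1_hor: "varrho1 G \<mu> \<gamma> g = hor (\<lambda>v. vop (\<lambda>k. \<gamma> k {v}) g)"
proof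
  fix A
  show "varrho1 G \<mu> \<gamma> g A = hor (\<lambda>v. vop (\<lambda>k. \<gamma> k {v}) g) A"
    unfolding varrho1_def sum_fun_eval[of _ _ A] of_hform_hor rmul_hor
    by (cases A rule: hor_cases) (simp_all add: hor_other vop_def)
qed

lemma varrho0_GT0: "\<gamma> \<in> gforms \<E> G 0 \<Longrightarrow> varrho0 G \<mu> \<gamma> \<in> GT0 \<E> G"
  unfolding varrho0_vop by (intro vop_GT0 gforms_Cinf)

lemma varrho1_GT1: "\<gamma> \<in> gforms \<E> G 1 \<Longrightarrow> varrho1 G \<mu> \<gamma> \<in> GT1 \<E> G"
  by (rule hor_GT1[OF varrho1_hor vop_GT0[OF gforms_Cinf]])

lemma varrho0_cong: "gf_eq \<E> \<gamma> \<gamma>' \<Longrightarrow> vfield_eq \<E> G (varrho0 G \<mu> \<gamma>) (varrho0 G \<mu> \<gamma>')"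
  unfolding vfield_eq_def varrho0_vop gf_eq_def by (intro ballI vop_cong) auto

lemma varrho1_cong: "gf_eq \<E> \<gamma> \<gamma>' \<Longrightarrow> vform_eq \<E> G (varrho1 G \<mu> \<gamma>) (varrho1 G \<mu> \<gamma>')"
  unfolding gf_eq_def by (rule hor_vform_eq[OF varrho1_hor varrho1_hor]) (intro vop_cong, auto)

lemma partial_U_varrho0:
  assumes "\<gamma> \<in> gforms \<E> G 0" "g \<in> Cinf W"
  shows "partial_U U (varrho0 G \<mu> \<gamma>) g
    = hor (\<lambda>v. Dc v (vop (\<lambda>k. \<gamma> k {}) g) - vop (\<lambda>k. \<gamma> k {}) (Dc v g))"
  unfolding varrho0_vop
  by (rule partial_U_vert[OF vop_vert vop_coef_Cinf[OF gforms_Cinf[OF assms(1)]] assms(2)])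

lemma vop_covd_form: "vop (\<lambda>k. covd_form \<gamma> k {v}) g = vop (covd \<gamma> v) g"
  unfolding vop_def by (rule sum.cong[OF refl]) (simp add: covd_form_eval)

lemma partial_U_varrho0_eq:
  assumes "\<gamma> \<in> gforms \<E> G 0"
  shows "vform_eq \<E> G (varrho1 G \<mu> (covd_form \<gamma>)) (partial_U U (varrho0 G \<mu> \<gamma>))"
proof (rule hor_vform_eq[OF varrho1_hor partial_U_varrho0[OF assms]])
  fix v g assume "g \<in> Cinf W"
  from cov_ideal_minus[OF Dc_vop_commutator[OF assms this]]
  show "vop (\<lambda>k. covd_form \<gamma> k {v}) g
      - (Dc v (vop (\<lambda>k. \<gamma> k {}) g) - vop (\<lambda>k. \<gamma> k {}) (Dc v g)) \<in> cov_ideal \<E> G"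
    unfolding vop_covd_form by (simp only: minus_diff_eq)
qed

lemma partial_U_varrho0_GT1:
  assumes "\<gamma> \<in> gforms \<E> G 0"
  shows "partial_U U (varrho0 G \<mu> \<gamma>) \<in> GT1 \<E> G"
proof (rule hor_GT1[OF partial_U_varrho0[OF assms]])
  fix v
  have vC: "vop (\<lambda>k. \<gamma> k {}) f \<in> Cinf W" if "f \<in> Cinf W" for f
    by (rule vop_Cinf[OF gforms_Cinf[OF assms] that])
  show "(\<lambda>g. Dc v (vop (\<lambda>k. \<gamma> k {}) g) - vop (\<lambda>k. \<gamma> k {}) (Dc v g)) \<in> GT0 \<E> G"
    by (rule GT0_cong[OF vop_GT0[of "covd \<gamma> v"]])
      (intro covd_Cinf assms Cinf_diff Dc_Cinf vC Dc_vop_commutator | assumption)+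
qed

lemma vform_eq_trans:
  assumes "vform_eq \<E> G \<Theta> \<Theta>'" "vform_eq \<E> G \<Theta>' \<Theta>''"
  shows "vform_eq \<E> G \<Theta> \<Theta>''"
  unfolding vform_eq_def
proof
  fix g assume "g \<in> Cinf W"
  then have "(\<Theta> g - \<Theta>' g) + (\<Theta>' g - \<Theta>'' g) \<in> null_forms \<E> G"
    using assms unfolding vform_eq_def by (blast intro: null_forms.add)
  then show "\<Theta> g - \<Theta>'' g \<in> null_forms \<E> G" by (simp only: diff_add_cancel add_diff_eq)
qed

end

section \<open>Commutativity of the diagram\<close>

context covering_data
begin

lemma covd_cong:
  assumes "\<gamma> \<in> gforms \<E> G 0" "\<gamma>' \<in> gforms \<E> G 0" "gf_eq \<E> \<gamma> \<gamma>'"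
  shows "covd \<gamma> v n - covd \<gamma>' v n \<in> jet_ideal \<E>"
proof -
  have d: "\<gamma> k {} - \<gamma>' k {} \<in> jet_ideal \<E>" for k using assms(3) unfolding gf_eq_def by blast
  have "covd \<gamma> v n - covd \<gamma>' v n = Dtot \<E> v (\<gamma> n {} - \<gamma>' n {})
      - (\<Sum>x<gdim G. \<Sum>y<gdim G. cmul (c x y n) (av v x \<star> sinv (bpar G x) (\<gamma> y {} - \<gamma>' y {})))"
    unfolding covd_def Dtot_diff[OF gforms_Cinf[OF assms(1)] gforms_Cinf[OF assms(2)]]
      sinv_diff smult_diff_right cmul_diff_right sum_subtractf
    by (simp add: algebra_simps)
  also have "\<dots> \<in> jet_ideal \<E>"
    by (intro jet_ideal_diff jet_ideal_Dtot jet_ideal_sum jet_ideal_cmul jet_ideal_smult_left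
        jet_ideal_sinv av_Cinf d) auto
  finally show ?thesis .
qed

text \<open>Each commutator is compared with its field \<open>vop (covd \<gamma> v)\<close>, for
  which congruence can be checked on the coefficients.\<close>

lemma partial_U_varrho0_cong:
  assumes "\<gamma> \<in> gforms \<E> G 0" "\<gamma>' \<in> gforms \<E> G 0" "gf_eq \<E> \<gamma> \<gamma>'"
  shows "vform_eq \<E> G (partial_U U (varrho0 G \<mu> \<gamma>)) (partial_U U (varrho0 G \<mu> \<gamma>'))"
proof (rule hor_vform_eq[OF partial_U_varrho0[OF assms(1)] partial_U_varrho0[OF assms(2)]])
  fix v g assume g: "g \<in> Cinf W"
  let ?P = "\<lambda>\<gamma> :: gform. Dc v (vop (\<lambda>k. \<gamma> k {}) g) - vop (\<lambda>k. \<gamma> k {}) (Dc v g)"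
  have "?P \<gamma> - ?P \<gamma>' = ((?P \<gamma> - vop (covd \<gamma> v) g) - (?P \<gamma>' - vop (covd \<gamma>' v) g))
      + (vop (covd \<gamma> v) g - vop (covd \<gamma>' v) g)"
    by (simp only: diff_diff_eq2 diff_add_cancel add_diff_cancel algebra_simps)
  also have "\<dots> \<in> cov_ideal \<E> G"
    by (rule cov_ideal_add[OF cov_ideal_diff[OF Dc_vop_commutator[OF assms(1) g] Dc_vop_commutator[OF assms(2) g]]
          vop_cong[OF covd_cong[OF assms] g]])
  finally show "?P \<gamma> - ?P \<gamma>' \<in> cov_ideal \<E> G" .
qed

lemma nabla0_eq:
  assumes "\<gamma> \<in> gforms \<E> G 0" "\<sigma> \<in> rho_image \<E> G 0" "mf_eq \<E> (rho G \<gamma>) \<sigma>"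
  shows "vfield_eq \<E> G (nabla0 \<E> G \<mu> \<sigma>) (varrho0 G \<mu> \<gamma>)"
  unfolding nabla0_def by (rule varrho0_cong[OF rho_inverse_eq[OF assms]])

lemma nabla1_eq:
  assumes "\<gamma> \<in> gforms \<E> G 1" "\<sigma> \<in> rho_image \<E> G 1" "mf_eq \<E> (rho G \<gamma>) \<sigma>"
  shows "vform_eq \<E> G (nabla1 \<E> G \<mu> \<sigma>) (varrho1 G \<mu> \<gamma>)"
  unfolding nabla1_def by (rule varrho1_cong[OF rho_inverse_eq[OF assms]])

lemma rho_image_mforms: "\<sigma> \<in> rho_image \<E> G q \<Longrightarrow> \<sigma> \<in> mforms \<E> G q"
  unfolding rho_image_def by blast

text \<open>\<open>covd_form \<gamma>\<close> is an explicit preimage of the covariant differential;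
  this is what makes \<open>nabla1\<close> applicable to the result.\<close>

lemma partial_alpha_rho_image:
  assumes "\<gamma> \<in> gforms \<E> G 0" "\<sigma> \<in> rho_image \<E> G 0" "mf_eq \<E> (rho G \<gamma>) \<sigma>"
  shows "mf_eq \<E> (rho G (covd_form \<gamma>)) (partial_alpha \<E> G 0 \<alpha> \<sigma>)"
    and "partial_alpha \<E> G 0 \<alpha> \<sigma> \<in> rho_image \<E> G 1"
proof -
  show eq: "mf_eq \<E> (rho G (covd_form \<gamma>)) (partial_alpha \<E> G 0 \<alpha> \<sigma>)"
    using partial_alpha_cong[OF rho_mforms[OF assms(1)] rho_image_mforms[OF assms(2)] assms(3)]
    unfolding partial_alpha_rho[OF assms(1)] .
  show "partial_alpha \<E> G 0 \<alpha> \<sigma> \<in> rho_image \<E> G 1"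
    using eq covd_form_gforms[OF assms(1)] partial_alpha_closed[OF rho_image_mforms[OF assms(2)]]
    unfolding rho_image_def by blast
qed

lemma nabla_partial_alpha:
  assumes "\<gamma> \<in> gforms \<E> G 0" "\<sigma> \<in> rho_image \<E> G 0" "mf_eq \<E> (rho G \<gamma>) \<sigma>"
  shows "vform_eq \<E> G (nabla1 \<E> G \<mu> (partial_alpha \<E> G 0 \<alpha> \<sigma>)) (partial_U U (varrho0 G \<mu> \<gamma>))"
  by (rule vform_eq_trans[OF nabla1_eq[OF covd_form_gforms[OF assms(1)] partial_alpha_rho_image(2)[OF assms]
        partial_alpha_rho_image(1)[OF assms]] partial_U_varrho0_eq[OF assms(1)]])

text \<open>The first seven items say that the arrows are maps of the quotients; then come the left
  square, the right square and the outer rectangle. The right square lives on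
  \<open>rho_image\<close>, the domain of the inverse of \<open>rho\<close>.\<close>

lemma diagram:
  "well_defined_map (gforms \<E> G 0) (gf_eq \<E>) (rho_image \<E> G 0) (mf_eq \<E>) (rho G)"
    (is ?g0)
  "well_defined_map (mforms \<E> G 0) (mf_eq \<E>) (mforms \<E> G 1) (mf_eq \<E>) (partial_alpha \<E> G 0 \<alpha>)"
    (is ?g1)
  "well_defined_map (rho_image \<E> G 0) (mf_eq \<E>) (rho_image \<E> G 1) (mf_eq \<E>) (partial_alpha \<E> G 0 \<alpha>)"
    (is ?g2)
  "well_defined_map (rho_image \<E> G 0) (mf_eq \<E>) (GT0 \<E> G) (vfield_eq \<E> G) (nabla0 \<E> G \<mu>)"
    (is ?g3)
  "well_defined_map (rho_image \<E> G 1) (mf_eq \<E>) (GT1 \<E> G) (vform_eq \<E> G) (nabla1 \<E> G \<mu>)"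
    (is ?g4)
  "well_defined_map (gforms \<E> G 0) (gf_eq \<E>) (GT0 \<E> G) (vfield_eq \<E> G) (varrho0 G \<mu>)"
    (is ?g5)
  "well_defined_map (gforms \<E> G 0) (gf_eq \<E>) (GT1 \<E> G) (vform_eq \<E> G) (\<lambda>\<gamma>. partial_U U (varrho0 G \<mu> \<gamma>))"
    (is ?g6)
  "\<forall>\<gamma>\<in>gforms \<E> G 0. vfield_eq \<E> G (nabla0 \<E> G \<mu> (rho G \<gamma>)) (varrho0 G \<mu> \<gamma>)"
    (is ?g7)
  "\<forall>\<sigma>\<in>rho_image \<E> G 0.
    vform_eq \<E> G (nabla1 \<E> G \<mu> (partial_alpha \<E> G 0 \<alpha> \<sigma>)) (partial_U U (nabla0 \<E> G \<mu> \<sigma>))"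
    (is ?g8)
  "\<forall>\<gamma>\<in>gforms \<E> G 0.
    vform_eq \<E> G (nabla1 \<E> G \<mu> (partial_alpha \<E> G 0 \<alpha> (rho G \<gamma>))) (partial_U U (varrho0 G \<mu> \<gamma>))"
    (is ?g9)
proof -
  have rep: "mf_eq \<E> (rho G (rho_inverse \<E> G q \<sigma>')) \<sigma>"
    if "\<sigma>' \<in> rho_image \<E> G q" "mf_eq \<E> \<sigma> \<sigma>'" for q \<sigma> \<sigma>'
    by (rule mf_eq_trans[OF rho_inverse_props(2)[OF that(1)] mf_eq_sym[OF that(2)]])
  show ?g0
    unfolding well_defined_map_def using rho_rho_image rho_cong by blast
  show ?g1
    unfolding well_defined_map_def using partial_alpha_closed partial_alpha_cong by blast
  show ?g2
    unfolding well_defined_map_def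
    using partial_alpha_rho_image(2)[OF rho_inverse_props(1) _ rho_inverse_props(2)]
      partial_alpha_cong rho_image_mforms by blast
  show ?g3
    unfolding well_defined_map_def
  proof (intro conjI ballI impI)
    fix \<sigma> assume s: "\<sigma> \<in> rho_image \<E> G 0"
    show "nabla0 \<E> G \<mu> \<sigma> \<in> GT0 \<E> G"
      unfolding nabla0_def by (rule varrho0_GT0[OF rho_inverse_props(1)[OF s]])
    fix \<sigma>' assume s': "\<sigma>' \<in> rho_image \<E> G 0" and eq: "mf_eq \<E> \<sigma> \<sigma>'"
    show "vfield_eq \<E> G (nabla0 \<E> G \<mu> \<sigma>) (nabla0 \<E> G \<mu> \<sigma>')"
      unfolding nabla0_def[of _ _ _ \<sigma>'] by (rule nabla0_eq[OF rho_inverse_props(1)[OF s'] s rep[OF s' eq]])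
  qed
  show ?g4
    unfolding well_defined_map_def
  proof (intro conjI ballI impI)
    fix \<sigma> assume s: "\<sigma> \<in> rho_image \<E> G 1"
    show "nabla1 \<E> G \<mu> \<sigma> \<in> GT1 \<E> G"
      unfolding nabla1_def by (rule varrho1_GT1[OF rho_inverse_props(1)[OF s]])
    fix \<sigma>' assume s': "\<sigma>' \<in> rho_image \<E> G 1" and eq: "mf_eq \<E> \<sigma> \<sigma>'"
    show "vform_eq \<E> G (nabla1 \<E> G \<mu> \<sigma>) (nabla1 \<E> G \<mu> \<sigma>')"
      unfolding nabla1_def[of _ _ _ \<sigma>'] by (rule nabla1_eq[OF rho_inverse_props(1)[OF s'] s rep[OF s' eq]])
  qed
  show ?g5
    unfolding well_defined_map_def using varrho0_GT0 varrho0_cong by blast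
  show ?g6
    unfolding well_defined_map_def using partial_U_varrho0_GT1 partial_U_varrho0_cong by blast
  show ?g7
    using nabla0_eq[OF _ rho_rho_image mf_eq_refl] by blast
  show ?g8
    \<comment> \<open>\<open>nabla0\<close> is \<open>varrho0\<close> of the chosen preimage, so the
      right square is the general identity for that preimage.\<close>
    unfolding nabla0_def
    using nabla_partial_alpha[OF rho_inverse_props(1) _ rho_inverse_props(2)] by blast
  show ?g9
    using nabla_partial_alpha[OF _ rho_rho_image mf_eq_refl] by blast
qed

end

theorem lemma4:
  fixes \<E> :: zsystem and G :: matalg and \<mu> :: real
    and a b wx wt :: "nat \<Rightarrow> superfun"
    and \<alpha> :: mform and U :: vform
  assumes "zgraded_system \<E>"
    and "lie_subsuperalgebra G" and "homogeneous_basis G"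
    and "\<mu> \<noteq> 0"
    and "zero_curvature \<E> G a b"
    and "covering \<E> G wx wt"
    and "\<forall>l\<in>{1..topidx G}. wx l - fibre_velocity G \<mu> a l \<in> cov_ideal \<E> G"
    and "\<forall>l\<in>{1..topidx G}. wt l - fibre_velocity G \<mu> b l \<in> cov_ideal \<E> G"
    and "\<alpha> = rho G (alpha_form G a b)"
    and "U = structure_element \<E> G wx wt"
  shows
    "well_defined_map (gforms \<E> G 0) (gf_eq \<E>) (rho_image \<E> G 0) (mf_eq \<E>) (rho G) \<and>
     well_defined_map (mforms \<E> G 0) (mf_eq \<E>) (mforms \<E> G 1) (mf_eq \<E>) (partial_alpha \<E> G 0 \<alpha>) \<and>
     well_defined_map (rho_image \<E> G 0) (mf_eq \<E>) (rho_image \<E> G 1) (mf_eq \<E>) (partial_alpha \<E> G 0 \<alpha>) \<and>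
     well_defined_map (rho_image \<E> G 0) (mf_eq \<E>) (GT0 \<E> G) (vfield_eq \<E> G) (nabla0 \<E> G \<mu>) \<and>
     well_defined_map (rho_image \<E> G 1) (mf_eq \<E>) (GT1 \<E> G) (vform_eq \<E> G) (nabla1 \<E> G \<mu>) \<and>
     well_defined_map (gforms \<E> G 0) (gf_eq \<E>) (GT0 \<E> G) (vfield_eq \<E> G) (varrho0 G \<mu>) \<and>
     well_defined_map (gforms \<E> G 0) (gf_eq \<E>) (GT1 \<E> G) (vform_eq \<E> G) (\<lambda>\<gamma>. partial_U U (varrho0 G \<mu> \<gamma>)) \<and>
     (\<forall>\<gamma>\<in>gforms \<E> G 0.
        vfield_eq \<E> G (nabla0 \<E> G \<mu> (rho G \<gamma>)) (varrho0 G \<mu> \<gamma>)) \<and>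
     (\<forall>\<sigma>\<in>rho_image \<E> G 0.
        vform_eq \<E> G (nabla1 \<E> G \<mu> (partial_alpha \<E> G 0 \<alpha> \<sigma>)) (partial_U U (nabla0 \<E> G \<mu> \<sigma>))) \<and>
     (\<forall>\<gamma>\<in>gforms \<E> G 0.
        vform_eq \<E> G (nabla1 \<E> G \<mu> (partial_alpha \<E> G 0 \<alpha> (rho G \<gamma>))) (partial_U U (varrho0 G \<mu> \<gamma>)))"
proof (rule structure_constants[OF assms(2,3)])
  fix c
  assume c: "\<And>x y i j. x < gdim G \<Longrightarrow> y < gdim G \<Longrightarrow>
      mat_bracket G (gbasis G x) (gbasis G y) i j = (\<Sum>n<gdim G. c x y n * gbasis G n i j)"
    "\<And>x y n. n < gdim G \<Longrightarrow> c x y n \<noteq> 0 \<Longrightarrow> bpar G n = (bpar G x + bpar G y) mod 2"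
  interpret covering_data \<E> G a b c \<mu> wx wt
    by unfold_locales (fact assms c)+
  show ?thesis
    unfolding assms(9,10) by (intro conjI diagram)
qed

end
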